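(* Let $\mathrm{Pol}:\mathcal{T}^\#\to\mathbb{N}[\mathcal{V}]$ be a multilinear polynomial interpretation. Let $\mathcal{P}=\mathcal{P}_{\ge}\uplus\mathcal{P}_{>}$ be an ADP problem with $\mathcal{P}_{>}\ne\emptyset$ such that: (1) for every $\ell\to\{p_1:r_1,\dots,p_k:r_k\}^m\in\mathcal{P}$: $\mathrm{Pol}(\ell^\#)\ge\sum_{1\le j\le k}p_j\cdot\mathcal{S}um(r_j)$; (2) for every $\ell\to\{p_1:r_1,\dots,p_k:r_k\}^m\in\mathcal{P}_{>}$ there is a $j\in\{1,\dots,k\}$ with $\mathrm{Pol}(\ell^\#)>\mathcal{S}um(r_j)$, and if $m=\mathsf{true}$, then additionally (for this $j$) $\mathrm{Pol}(\ell)\ge\mathrm{Pol}(\flat(r_j))$; (3) for every $\ell\to\{p_1:r_1,\dots,p_k:r_k\}^{\mathsf{true}}\in\mathcal{P}$: $\mathrm{Pol}(\ell)\ge\sum_{1\le j\le k}p_j\cdot\mathrm{Pol}(\flat(r_j))$. Then the processor $\mathrm{Proc}_{\mathtt{RP}}(\mathcal{P})=\{\mathcal{P}_{\ge}\cup\flat(\mathcal{P}_{>})\}$ is sound and complete for $\mathtt{iAST}$ and for $\mathtt{AST}$. That is, $\mathcal{P}$ is $\mathtt{iAST}$ iff $\mathcal{P}_{\ge}\cup\flat(\mathcal{P}_{>})$ is $\mathtt{iAST}$, and $\mathcal{P}$ is $\mathtt{AST}$ iff $\mathcal{P}_{\ge}\cup\flat(\mathcal{P}_{>})$ is $\mathtt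{AST}$.
   Context: **Terms and annotations.** $\Sigma$ is a finite signature, $\mathcal{V}$ a set of variables, $\mathcal{T}=\mathcal{T}(\Sigma,\mathcal{V})$. $\mathcal{D}\subseteq\Sigma$ is the set of defined symbols, i.e., root symbols of left-hand sides of the ADPs under consideration. $\mathrm{Pos}(t)$, $t|_\pi$, $t[r]_\pi$ denote positions, subterm, replacement. A substitution is $\sigma:\mathcal{V}\to\mathcal{T}$ with $\sigma(x)=x$ for all but finitely many $x$. For each $f\in\mathcal{D}$ let $f^\#$ be a fresh symbol of the same arity; $\mathcal{D}^\#=\{f^\#\mid f\in\mathcal{D}\}$, $\Sigma^\#=\Sigma\uplus\mathcal{D}^\#$, $\mathcal{T}^\#=\mathcal{T}(\Sigma^\#,\mathcal{V})$. For $t=f(t_1,\dots,t_n)\in\mathcal{T}$ with $f\in\mathcal{D}$, $t^\#=f^\#(t_1,\dots,t_n)$. $\mathrm{Pos}_X(t)$ is the set of positions of $t$ carrying a symbol or variable from $X$. For $\Phi\subseteq\mathrm{Pos}_{\mathcal{D}\cup\mathcal{D}^\#}(t)$, $\#_\Phi(t)$ is the variant of $t$ where exactly the symbols at positions in $\Phi$ are annotated (all other annotations removed); $\flat(t)=\#_\emptyset(t)$. $\flat^\uparrow_\pi(t)$ results from $t$ by removing all annotations strictly above $\pi$. **Polynomial interpretations.** A polynomial interpretation $\mathrm{Pol}$ maps every $f\in\Sigma^\#$ of arity $n$ to an $n$-ary polynomial $f_{\mathrm{Pol}}$ with coefficients in $\mathbb{N}$, and is extended to terms by $\mathrm{Pol}(x)=x$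 for variables and $\mathrm{Pol}(f(t_1,\dots,t_n))=f_{\mathrm{Pol}}(\mathrm{Pol}(t_1),\dots,\mathrm{Pol}(t_n))$. It is multilinear if all monomials of all $f_{\mathrm{Pol}}(x_1,\dots,x_n)$ have the form $c\cdot x_1^{e_1}\cdots x_n^{e_n}$ with $c\in\mathbb{N}$ and $e_1,\dots,e_n\in\{0,1\}$. Inequations between polynomials hold if they are true for all instantiations of the variables by natural numbers. For $r\in\mathcal{T}^\#$, $\mathcal{S}um(r)=\sum_{\pi\in\mathrm{Pos}_{\mathcal{D}^\#}(r)}\mathrm{Pol}\big((\flat(r|_\pi))^\#\big)$ (the sum over all annotated subterm occurrences of $r$). **ADPs.** An annotated dependency pair (ADP) has the form $\ell\to\{p_1:r_1,\dots,p_k:r_k\}^m$ with $\ell\in\mathcal{T}\setminus\mathcal{V}$, $m\in\{\mathsf{true},\mathsf{false}\}$, $r_j\in\mathcal{T}^\#$, all variables of $r_j$ occurring in $\ell$, probabilities $p_j\in(0,1]$ summing to $1$. An ADP problem is a finite set of ADPs. $\flat(\mathcal{P})$ is $\mathcal{P}$ with all annotations removed from all right-hand sides (flags kept). **Rewriting with ADPs (full).** A variable reposition function (VRF) for an ADP $\ell\to\{p_1:r_1,\dots,p_k:r_k\}^m$ is a family of functions $\varphi_j:\mathrm{Pos}_{\mathcal{V}}(\ell)\to\mathrm{Pos}_{\mathcal{V}}(r_j)\uplus\{\bot\}$, $1\le j\le k$, with $\ell|_\rho=r_j|_{\varphi_j(\rho)}$ whenever $\varphi_j(\rho)\ne\bot$.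 A term $s\in\mathcal{T}^\#$ rewrites with $\mathcal{P}$ to $\{p_1:t_1,\dots,p_k:t_k\}$ (written $s\hookrightarrow_{\mathcal{P}}\{p_1:t_1,\dots,p_k:t_k\}$) if there are an ADP $\ell\to\{p_1:r_1,\dots,p_k:r_k\}^m\in\mathcal{P}$, a VRF $(\varphi_j)_j$ for it, a substitution $\sigma$ and $\pi\in\mathrm{Pos}_{\mathcal{D}\cup\mathcal{D}^\#}(s)$ with $\flat(s|_\pi)=\ell\sigma$, such that for all $j$: - (at) $t_j=s[\#_{\Phi_j}(r_j\sigma)]_\pi$ if $\pi\in\mathrm{Pos}_{\mathcal{D}^\#}(s)$ and $m=\mathsf{true}$; - (af) $t_j=\flat^\uparrow_\pi(s[\#_{\Phi_j}(r_j\sigma)]_\pi)$ if $\pi\in\mathrm{Pos}_{\mathcal{D}^\#}(s)$ and $m=\mathsf{false}$; - (nt) $t_j=s[\#_{\Psi_j}(r_j\sigma)]_\pi$ if $\pi\notin\mathrm{Pos}_{\mathcal{D}^\#}(s)$ and $m=\mathsf{true}$. (There is no step if $\pi\notin\mathrm{Pos}_{\mathcal{D}^\#}(s)$ and $m=\mathsf{false}$.) Here $\Psi_j=\{\varphi_j(\rho).\tau\mid\rho\in\mathrm{Pos}_{\mathcal{V}}(\ell),\ \varphi_j(\rho)\ne\bot,\ \rho.\tau\in\mathrm{Pos}_{\mathcal{D}^\#}(s|_\pi)\}$ and $\Phi_j=\mathrm{Pos}_{\mathcal{D}^\#}(r_j)\cup\Psi_j$. **Innermost rewriting with ADPs.**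 $t\in\mathtt{ANF}_{\mathcal{P}}$ if there is no proper subterm $t'$ of $t$, ADP $\ell\to\mu^m\in\mathcal{P}$ and substitution $\sigma$ with $\ell\sigma=\flat(t')$. A term $s\in\mathcal{T}^\#$ rewrites innermost with $\mathcal{P}$ to $\{p_1:t_1,\dots,p_k:t_k\}$ if there are an ADP $\ell\to\{p_1:r_1,\dots,p_k:r_k\}^m\in\mathcal{P}$, a substitution $\sigma$ and $\pi\in\mathrm{Pos}_{\mathcal{D}\cup\mathcal{D}^\#}(s)$ with $\flat(s|_\pi)=\ell\sigma\in\mathtt{ANF}_{\mathcal{P}}$, such that for all $j$: - (at) $t_j=s[r_j\sigma]_\pi$ if $\pi\in\mathrm{Pos}_{\mathcal{D}^\#}(s)$, $m=\mathsf{true}$; - (af) $t_j=\flat^\uparrow_\pi(s[r_j\sigma]_\pi)$ if $\pi\in\mathrm{Pos}_{\mathcal{D}^\#}(s)$, $m=\mathsf{false}$; - (nt) $t_j=s[\flat(r_j)\sigma]_\pi$ if $\pi\notin\mathrm{Pos}_{\mathcal{D}^\#}(s)$, $m=\mathsf{true}$; - (nf) $t_j=\flat^\uparrow_\pi(s[\flat(r_j)\sigma]_\pi)$ if $\pi\notin\mathrm{Pos}_{\mathcal{D}^\#}(s)$, $m=\mathsf{false}$. **Chain trees, AST, iAST.** A $\mathcal{P}$-chain tree (CT) is $\mathfrak{T}=(V,E,L,A)$ where $(V,E)$ is a non-empty, possibly infinite, finitely branching directed tree; $L$ labels each node $v$ by a probability $p_v\in(0,1]$ and a term $t_v\in\mathcal{T}^\#$,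 with $p_v=1$ for the root; $A$ is a subset of the inner nodes; for each inner node $v$ with successors $w_1,\dots,w_k$, $t_v\hookrightarrow_{\mathcal{P}}\{\frac{p_{w_1}}{p_v}:t_{w_1},\dots,\frac{p_{w_k}}{p_v}:t_{w_k}\}$ using case (at) or (af) if $v\in A$ and another case if $v\notin A$; and every infinite path contains infinitely many nodes from $A$. A $\mathcal{P}$-innermost chain tree (iCT) is defined in the same way with innermost rewriting with $\mathcal{P}$ instead of $\hookrightarrow_{\mathcal{P}}$. $|\mathfrak{T}|_{\mathrm{Leaf}}$ is the sum of $p_v$ over all leaves $v$. $\mathcal{P}$ is $\mathtt{AST}$ (resp. $\mathtt{iAST}$) if $|\mathfrak{T}|_{\mathrm{Leaf}}=1$ for all $\mathcal{P}$-CTs (resp. $\mathcal{P}$-iCTs) $\mathfrak{T}$. **Processors.** A processor maps an ADP problem to a finite set of ADP problems. It is sound for a property if the input has the property whenever all resulting problems have it, and complete if all resulting problems have it whenever the input has it. *)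

theory Defs
  imports
    "HOL-Analysis.Analysis"
    "HOL-Library.Poly_Mapping"
    "HOL-Library.Multiset"
    "HOL-Library.Sublist"
begin

section \<open>Terms, positions, substitutions\<close>

datatype ('g, vars: 'v) trm = Var 'v | Fun 'g "('g, 'v) trm list"

text \<open>A signature is a partial map from symbols to arities; its domain is the set of symbols.\<close>

inductive_set terms :: "('g \<rightharpoonup> nat) \<Rightarrow> ('g, 'v) trm set" for F :: "'g \<rightharpoonup> nat" where
  "Var x \<in> terms F"
| "\<lbrakk>F g = Some (length ts); \<forall>t\<in>set ts. t \<in> terms F\<rbrakk> \<Longrightarrow> Fun g ts \<in> terms F"

type_synonym pos = "nat list"

text \<open>Argument positions are counted from 0.\<close>

primrec poss :: "('g, 'v) trm \<Rightarrow> pos set" where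
  "poss (Var x) = {[]}"
| "poss (Fun g ts) = insert [] (\<Union>i<length ts. (#) i ` (map poss ts ! i))"

text \<open>\<open>subt_at\<close> and \<open>replace_at\<close> are only meaningful at positions of the given term.\<close>

fun subt_at :: "('g, 'v) trm \<Rightarrow> pos \<Rightarrow> ('g, 'v) trm" where
  "subt_at t [] = t"
| "subt_at (Fun g ts) (i # \<pi>) = subt_at (ts ! i) \<pi>"
| "subt_at (Var x) (i # \<pi>) = Var x"

fun replace_at :: "('g, 'v) trm \<Rightarrow> pos \<Rightarrow> ('g, 'v) trm \<Rightarrow> ('g, 'v) trm" where
  "replace_at t [] r = r"
| "replace_at (Fun g ts) (i # \<pi>) r = Fun g (ts[i := replace_at (ts ! i) \<pi> r])"
| "replace_at (Var x) (i # \<pi>) r = Var x"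

definition var_poss :: "('g, 'v) trm \<Rightarrow> pos set" where
  "var_poss t = {\<pi> \<in> poss t. \<exists>x. subt_at t \<pi> = Var x}"

definition fun_poss :: "'g set \<Rightarrow> ('g, 'v) trm \<Rightarrow> pos set" where
  "fun_poss X t = {\<pi> \<in> poss t. \<exists>g\<in>X. \<exists>ts. subt_at t \<pi> = Fun g ts}"

primrec inst :: "('g, 'v) trm \<Rightarrow> ('v \<Rightarrow> ('g, 'v) trm) \<Rightarrow> ('g, 'v) trm" where
  "inst (Var x) \<sigma> = \<sigma> x"
| "inst (Fun g ts) \<sigma> = Fun g (map (\<lambda>t. inst t \<sigma>) ts)"


section \<open>Annotations\<close>

datatype 'f asym = Plain (base: 'f) | Sharp (base: 'f)

text \<open>
  \<open>asig F D\<close> extends the signature \<open>F\<close> by an annotated copy of the symbols in \<open>D\<close>. The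
  unannotated terms over \<open>F\<close> are represented as those annotated terms that contain no \<open>Sharp\<close>
  symbol, i.e., \<open>\<T> = plain_terms F \<subseteq> ann_terms F D = \<T>\<^sup>#\<close>.
\<close>

fun asig :: "('f \<rightharpoonup> nat) \<Rightarrow> 'f set \<Rightarrow> ('f asym \<rightharpoonup> nat)" where
  "asig F D (Plain f) = F f"
| "asig F D (Sharp f) = (if f \<in> D then F f else None)"

type_synonym ('f, 'v) aterm = "('f asym, 'v) trm"

abbreviation ann_terms :: "('f \<rightharpoonup> nat) \<Rightarrow> 'f set \<Rightarrow> ('f, 'v) aterm set" where
  "ann_terms F D \<equiv> terms (asig F D)"

abbreviation plain_terms :: "('f \<rightharpoonup> nat) \<Rightarrow> ('f, 'v) aterm set" where
  "plain_terms F \<equiv> terms (asig F {})"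

text \<open>On \<open>ann_terms F D\<close> the annotated symbols are exactly those from \<open>D\<^sup>#\<close>.\<close>

definition sharp_poss :: "('f, 'v) aterm \<Rightarrow> pos set" where
  "sharp_poss t = fun_poss (range Sharp) t"

text \<open>\<open>annot \<Phi> t\<close> is the variant of \<open>t\<close> in which exactly the positions in \<open>\<Phi>\<close> are annotated.\<close>

function annot :: "pos set \<Rightarrow> ('f, 'v) aterm \<Rightarrow> ('f, 'v) aterm" where
  "annot \<Phi> (Var x) = Var x"
| "annot \<Phi> (Fun g ts) =
     Fun (if [] \<in> \<Phi> then Sharp (base g) else Plain (base g))
         (map (\<lambda>i. annot {\<pi>. i # \<pi> \<in> \<Phi>} (ts ! i)) [0..<length ts])"
  by pat_completeness auto
termination
  by (relation "Wellfounded.measure (\<lambda>(\<Phi>, t). size t)") (auto simp: less_Suc_eq_le intro: size_list_estimation'[OF nth_mem order_refl])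

definition flat :: "('f, 'v) aterm \<Rightarrow> ('f, 'v) aterm" where
  "flat t = annot {} t"

definition flat_above :: "pos \<Rightarrow> ('f, 'v) aterm \<Rightarrow> ('f, 'v) aterm" where
  "flat_above \<pi> t = annot {\<tau> \<in> sharp_poss t. \<not> strict_prefix \<tau> \<pi>} t"

fun sharp :: "('f, 'v) aterm \<Rightarrow> ('f, 'v) aterm" where
  "sharp (Fun g ts) = Fun (Sharp (base g)) ts"
| "sharp (Var x) = Var x"

definition substs :: "('f \<rightharpoonup> nat) \<Rightarrow> ('v \<Rightarrow> ('f, 'v) aterm) set" where
  "substs F = {\<sigma>. (\<forall>x. \<sigma> x \<in> plain_terms F) \<and> finite {x. \<sigma> x \<noteq> Var x}}"


section \<open>Polynomial interpretations\<close>

text \<open>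
  Polynomials with natural coefficients in indeterminates \<open>'x\<close>: finitely supported maps from
  monomials (finitely supported exponent maps) to coefficients.
\<close>

type_synonym 'x npoly = "('x \<Rightarrow>\<^sub>0 nat) \<Rightarrow>\<^sub>0 nat"

definition indet :: "'x \<Rightarrow> 'x npoly" where
  "indet x = Poly_Mapping.single (Poly_Mapping.single x 1) 1"

text \<open>
  Substitution of values for the indeterminates. With values in \<open>nat\<close> this is evaluation, with
  values in \<open>'y npoly\<close> it is composition of polynomials.
\<close>

definition psubst :: "'x npoly \<Rightarrow> ('x \<Rightarrow> 'r::comm_semiring_1) \<Rightarrow> 'r" where
  "psubst p a = (\<Sum>m\<in>Poly_Mapping.keys p. of_nat (Poly_Mapping.lookup p m) *
     (\<Prod>x\<in>Poly_Mapping.keys m. a x ^ Poly_Mapping.lookup m x))"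

text \<open>The argument variables of an \<open>n\<close>-ary polynomial are the indeterminates \<open>0, \<dots>, n - 1\<close>.\<close>

definition poly_interpretation :: "('g \<rightharpoonup> nat) \<Rightarrow> ('g \<Rightarrow> nat npoly) \<Rightarrow> bool" where
  "poly_interpretation F I \<longleftrightarrow>
     (\<forall>g n. F g = Some n \<longrightarrow> (\<forall>m\<in>Poly_Mapping.keys (I g). Poly_Mapping.keys m \<subseteq> {..<n}))"

definition multilinear :: "('g \<rightharpoonup> nat) \<Rightarrow> ('g \<Rightarrow> nat npoly) \<Rightarrow> bool" where
  "multilinear F I \<longleftrightarrow>
     (\<forall>g\<in>dom F. \<forall>m\<in>Poly_Mapping.keys (I g). \<forall>i. Poly_Mapping.lookup m i \<in> {0, 1})"

primrec pol :: "('g \<Rightarrow> nat npoly) \<Rightarrow> ('g, 'v) trm \<Rightarrow> 'v npoly" where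
  "pol I (Var x) = indet x"
| "pol I (Fun g ts) = psubst (I g) (\<lambda>i. map (pol I) ts ! i)"

definition ann_sum :: "('f asym \<Rightarrow> nat npoly) \<Rightarrow> ('f, 'v) aterm \<Rightarrow> 'v npoly" where
  "ann_sum I r = (\<Sum>\<pi>\<in>sharp_poss r. pol I (sharp (flat (subt_at r \<pi>))))"


section \<open>Annotated dependency pairs\<close>

text \<open>Finite multi-distributions, where the same pair may occur several times.\<close>

type_synonym ('f, 'v) mdist = "(real \<times> ('f, 'v) aterm) multiset"

type_synonym ('f, 'v) adp = "('f, 'v) aterm \<times> ('f, 'v) mdist \<times> bool"

definition defined :: "('f, 'v) adp set \<Rightarrow> 'f set" where
  "defined P = {f. \<exists>ts \<mu> m. (Fun (Plain f) ts, \<mu>, m) \<in> P}"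

definition is_adp :: "('f \<rightharpoonup> nat) \<Rightarrow> 'f set \<Rightarrow> ('f, 'v) adp \<Rightarrow> bool" where
  "is_adp F D = (\<lambda>(l, \<mu>, m).
     l \<in> plain_terms F \<and> l \<notin> range Var \<and>
     (\<forall>(p, r)\<in>#\<mu>. 0 < p \<and> p \<le> 1 \<and> r \<in> ann_terms F D \<and> vars r \<subseteq> vars l) \<and>
     (\<Sum>(p, r)\<in>#\<mu>. p) = 1)"

definition adp_problem :: "('f \<rightharpoonup> nat) \<Rightarrow> ('f, 'v) adp set \<Rightarrow> bool" where
  "adp_problem F P \<longleftrightarrow> finite P \<and> (\<forall>\<alpha>\<in>P. is_adp F (defined P) \<alpha>)"

definition flat_adps :: "('f, 'v) adp set \<Rightarrow> ('f, 'v) adp set" where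
  "flat_adps P = (\<lambda>(l, \<mu>, m). (l, image_mset (\<lambda>(p, r). (p, flat r)) \<mu>, m)) ` P"


section \<open>Rewriting with annotated dependency pairs\<close>

definition redex_poss :: "'f set \<Rightarrow> ('f, 'v) aterm \<Rightarrow> pos set" where
  "redex_poss D s = fun_poss (Plain ` D \<union> Sharp ` D) s"

text \<open>
  The right-hand side of the applied ADP is enumerated as a list \<open>prs\<close> of pairs \<open>(p\<^sub>j, r\<^sub>j)\<close>;
  \<open>with_terms prs t\<close> is the multi-distribution of the pairs \<open>(p\<^sub>j, t\<^sub>j)\<close>.
\<close>

definition with_terms ::
    "(real \<times> ('f, 'v) aterm) list \<Rightarrow> (nat \<Rightarrow> ('f, 'v) aterm) \<Rightarrow> ('f, 'v) mdist" where
  "with_terms prs t = mset (map (\<lambda>j. (fst (prs ! j), t j)) [0..<length prs])"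

text \<open>Variable reposition functions, with \<open>None\<close> in the role of \<open>\<bottom>\<close>.\<close>

definition vrf :: "('f, 'v) aterm \<Rightarrow> (real \<times> ('f, 'v) aterm) list \<Rightarrow>
    (nat \<Rightarrow> pos \<Rightarrow> pos option) \<Rightarrow> bool" where
  "vrf l prs \<phi> \<longleftrightarrow> (\<forall>j<length prs. \<forall>\<rho>\<in>var_poss l. \<forall>\<rho>'. \<phi> j \<rho> = Some \<rho>' \<longrightarrow>
     \<rho>' \<in> var_poss (snd (prs ! j)) \<and> subt_at l \<rho> = subt_at (snd (prs ! j)) \<rho>')"

definition Psi :: "('f, 'v) aterm \<Rightarrow> (pos \<Rightarrow> pos option) \<Rightarrow> ('f, 'v) aterm \<Rightarrow> pos set" where
  "Psi l \<phi> u = {\<rho>' @ \<tau> | \<rho> \<rho>' \<tau>. \<rho> \<in> var_poss l \<and> \<phi> \<rho> = Some \<rho>' \<and> \<rho> @ \<tau> \<in> sharp_poss u}"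

definition Phi :: "('f, 'v) aterm \<Rightarrow> (pos \<Rightarrow> pos option) \<Rightarrow> ('f, 'v) aterm \<Rightarrow>
    ('f, 'v) aterm \<Rightarrow> pos set" where
  "Phi l \<phi> r u = sharp_poss r \<union> Psi l \<phi> u"

text \<open>
  The boolean argument of the following two relations records whether the redex is annotated,
  i.e., whether one of the cases (at) and (af) is used.
\<close>

inductive full_step :: "('f \<rightharpoonup> nat) \<Rightarrow> ('f, 'v) adp set \<Rightarrow>
    bool \<Rightarrow> ('f, 'v) aterm \<Rightarrow> ('f, 'v) mdist \<Rightarrow> bool"
  for F :: "'f \<rightharpoonup> nat" and P :: "('f, 'v) adp set" where
  full_at: "\<lbrakk>s \<in> ann_terms F (defined P); (l, mset prs, True) \<in> P; vrf l prs \<phi>; \<sigma> \<in> substs F;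
     \<pi> \<in> redex_poss (defined P) s; flat (subt_at s \<pi>) = inst l \<sigma>; \<pi> \<in> sharp_poss s\<rbrakk>
   \<Longrightarrow> full_step F P True s (with_terms prs (\<lambda>j.
         replace_at s \<pi> (annot (Phi l (\<phi> j) (snd (prs ! j)) (subt_at s \<pi>)) (inst (snd (prs ! j)) \<sigma>))))"
| full_af: "\<lbrakk>s \<in> ann_terms F (defined P); (l, mset prs, False) \<in> P; vrf l prs \<phi>; \<sigma> \<in> substs F;
     \<pi> \<in> redex_poss (defined P) s; flat (subt_at s \<pi>) = inst l \<sigma>; \<pi> \<in> sharp_poss s\<rbrakk>
   \<Longrightarrow> full_step F P True s (with_terms prs (\<lambda>j. flat_above \<pi>
         (replace_at s \<pi> (annot (Phi l (\<phi> j) (snd (prs ! j)) (subt_at s \<pi>)) (inst (snd (prs ! j)) \<sigma>)))))"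
| full_nt: "\<lbrakk>s \<in> ann_terms F (defined P); (l, mset prs, True) \<in> P; vrf l prs \<phi>; \<sigma> \<in> substs F;
     \<pi> \<in> redex_poss (defined P) s; flat (subt_at s \<pi>) = inst l \<sigma>; \<pi> \<notin> sharp_poss s\<rbrakk>
   \<Longrightarrow> full_step F P False s (with_terms prs (\<lambda>j.
         replace_at s \<pi> (annot (Psi l (\<phi> j) (subt_at s \<pi>)) (inst (snd (prs ! j)) \<sigma>))))"

text \<open>No proper subterm is a redex; the term itself may well be one.\<close>

definition ANF :: "('f \<rightharpoonup> nat) \<Rightarrow> ('f, 'v) adp set \<Rightarrow> ('f, 'v) aterm set" where
  "ANF F P = {t. \<not> (\<exists>\<tau>\<in>poss t - {[]}. \<exists>(l, \<mu>, m)\<in>P. \<exists>\<sigma>\<in>substs F. inst l \<sigma> = flat (subt_at t \<tau>))}"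

inductive innermost_step :: "('f \<rightharpoonup> nat) \<Rightarrow> ('f, 'v) adp set \<Rightarrow>
    bool \<Rightarrow> ('f, 'v) aterm \<Rightarrow> ('f, 'v) mdist \<Rightarrow> bool"
  for F :: "'f \<rightharpoonup> nat" and P :: "('f, 'v) adp set" where
  inn_at: "\<lbrakk>s \<in> ann_terms F (defined P); (l, mset prs, True) \<in> P; \<sigma> \<in> substs F;
     \<pi> \<in> redex_poss (defined P) s; flat (subt_at s \<pi>) = inst l \<sigma>; inst l \<sigma> \<in> ANF F P;
     \<pi> \<in> sharp_poss s\<rbrakk>
   \<Longrightarrow> innermost_step F P True s (with_terms prs (\<lambda>j.
         replace_at s \<pi> (inst (snd (prs ! j)) \<sigma>)))"
| inn_af: "\<lbrakk>s \<in> ann_terms F (defined P); (l, mset prs, False) \<in> P; \<sigma> \<in> substs F;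
     \<pi> \<in> redex_poss (defined P) s; flat (subt_at s \<pi>) = inst l \<sigma>; inst l \<sigma> \<in> ANF F P;
     \<pi> \<in> sharp_poss s\<rbrakk>
   \<Longrightarrow> innermost_step F P True s (with_terms prs (\<lambda>j.
         flat_above \<pi> (replace_at s \<pi> (inst (snd (prs ! j)) \<sigma>))))"
| inn_nt: "\<lbrakk>s \<in> ann_terms F (defined P); (l, mset prs, True) \<in> P; \<sigma> \<in> substs F;
     \<pi> \<in> redex_poss (defined P) s; flat (subt_at s \<pi>) = inst l \<sigma>; inst l \<sigma> \<in> ANF F P;
     \<pi> \<notin> sharp_poss s\<rbrakk>
   \<Longrightarrow> innermost_step F P False s (with_terms prs (\<lambda>j.
         replace_at s \<pi> (inst (flat (snd (prs ! j))) \<sigma>)))"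
| inn_nf: "\<lbrakk>s \<in> ann_terms F (defined P); (l, mset prs, False) \<in> P; \<sigma> \<in> substs F;
     \<pi> \<in> redex_poss (defined P) s; flat (subt_at s \<pi>) = inst l \<sigma>; inst l \<sigma> \<in> ANF F P;
     \<pi> \<notin> sharp_poss s\<rbrakk>
   \<Longrightarrow> innermost_step F P False s (with_terms prs (\<lambda>j.
         flat_above \<pi> (replace_at s \<pi> (inst (flat (snd (prs ! j))) \<sigma>))))"


section \<open>Chain trees and almost-sure termination\<close>

definition directed_tree :: "'n set \<Rightarrow> 'n rel \<Rightarrow> 'n \<Rightarrow> bool" where
  "directed_tree V E v0 \<longleftrightarrow> v0 \<in> V \<and> E \<subseteq> V \<times> V \<and>
     (\<forall>v\<in>V. (v0, v) \<in> E\<^sup>*) \<and> (\<forall>v. (v, v0) \<notin> E) \<and>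
     (\<forall>u v w. (u, w) \<in> E \<longrightarrow> (v, w) \<in> E \<longrightarrow> u = v)"

definition inner_nodes :: "'n set \<Rightarrow> 'n rel \<Rightarrow> 'n set" where
  "inner_nodes V E = {v \<in> V. E `` {v} \<noteq> {}}"

definition leaves :: "'n set \<Rightarrow> 'n rel \<Rightarrow> 'n set" where
  "leaves V E = {v \<in> V. E `` {v} = {}}"

text \<open>
  The label \<open>L v\<close> is the pair of the probability and the term of \<open>v\<close>. \<open>T\<close> is the set of
  admissible terms, and \<open>step True\<close> / \<open>step False\<close> are the steps at annotated / other redexes.
\<close>

definition chain_tree :: "('f, 'v) aterm set \<Rightarrow>
    (bool \<Rightarrow> ('f, 'v) aterm \<Rightarrow> ('f, 'v) mdist \<Rightarrow> bool) \<Rightarrow>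
    'n set \<Rightarrow> 'n rel \<Rightarrow> ('n \<Rightarrow> real \<times> ('f, 'v) aterm) \<Rightarrow> 'n set \<Rightarrow> bool" where
  "chain_tree T step V E L A \<longleftrightarrow>
     (\<exists>v0. directed_tree V E v0 \<and> fst (L v0) = 1) \<and>
     (\<forall>v\<in>V. finite (E `` {v})) \<and>
     (\<forall>v\<in>V. 0 < fst (L v) \<and> fst (L v) \<le> 1 \<and> snd (L v) \<in> T) \<and>
     A \<subseteq> inner_nodes V E \<and>
     (\<forall>v\<in>inner_nodes V E. step (v \<in> A) (snd (L v))
        (image_mset (\<lambda>w. (fst (L w) / fst (L v), snd (L w))) (mset_set (E `` {v})))) \<and>
     (\<forall>x. (\<forall>i::nat. (x i, x (Suc i)) \<in> E) \<longrightarrow> infinite {i. x i \<in> A})"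

definition leaf_prob :: "'n set \<Rightarrow> 'n rel \<Rightarrow> ('n \<Rightarrow> real \<times> ('f, 'v) aterm) \<Rightarrow> real" where
  "leaf_prob V E L = (\<Sum>\<^sub>\<infinity>v\<in>leaves V E. fst (L v))"

text \<open>
  Finitely branching rooted trees have countably many nodes, so it suffices to consider trees
  whose nodes are natural numbers.
\<close>

definition AST :: "('f \<rightharpoonup> nat) \<Rightarrow> ('f, 'v) adp set \<Rightarrow> bool" where
  "AST F P \<longleftrightarrow> (\<forall>(V :: nat set) E L A.
     chain_tree (ann_terms F (defined P)) (full_step F P) V E L A \<longrightarrow> leaf_prob V E L = 1)"

definition iAST :: "('f \<rightharpoonup> nat) \<Rightarrow> ('f, 'v) adp set \<Rightarrow> bool" where
  "iAST F P \<longleftrightarrow> (\<forall>(V :: nat set) E L A.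
     chain_tree (ann_terms F (defined P)) (innermost_step F P) V E L A \<longrightarrow> leaf_prob V E L = 1)"


section \<open>Processors\<close>

text \<open>Soundness and completeness of a processor on an input \<open>P\<close> for which it returns \<open>\<Q>\<close>.\<close>

definition sound_for :: "(('f, 'v) adp set \<Rightarrow> bool) \<Rightarrow>
    ('f, 'v) adp set \<Rightarrow> ('f, 'v) adp set set \<Rightarrow> bool" where
  "sound_for prop P \<Q> \<longleftrightarrow> ((\<forall>Q\<in>\<Q>. prop Q) \<longrightarrow> prop P)"

definition complete_for :: "(('f, 'v) adp set \<Rightarrow> bool) \<Rightarrow>
    ('f, 'v) adp set \<Rightarrow> ('f, 'v) adp set set \<Rightarrow> bool" where
  "complete_for prop P \<Q> \<longleftrightarrow> (prop P \<longrightarrow> (\<forall>Q\<in>\<Q>. prop Q))"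

definition Proc_RP :: "('f, 'v) adp set \<Rightarrow> ('f, 'v) adp set \<Rightarrow> ('f, 'v) adp set set" where
  "Proc_RP P_ge P_gt = {P_ge \<union> flat_adps P_gt}"

end

(*
Soundness. Evaluate Pol at a fixed assignment and let the weight of a term be the sum of the values
of its annotated subterms. By (1), (3) and multilinearity, the weights of the labels of a P-chain
tree form a non-negative supermartingale. At an annotated step with an ADP of P_> the weight drops
by at least 1 with a probability bounded away from 0, so the strictly concave potential
1 - 1/(1 + w) decreases in expectation by at least c/(1 + w)^3. Hence the sum of
p/(1 + w)^3 over these nodes is finite, and by the maximal inequality for supermartingales the weight
ever exceeds N only with probability at most (initial weight)/N. If the leaves of the tree had total
probability 1 - e < 1, then for large N and a deep enough level d, cutting below level d at all nodes
of weight > N and at all annotated P_>-steps would lose mass less than e. So the cut tree below some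
node of level d still does not converge. It contains no annotated P_>-step, hence it is a chain tree
of the processed problem.

Completeness. A chain tree of the processed problem is turned into a P-chain tree by putting back
the annotations that the flattened ADPs have dropped.
*)

theory Submission
  imports Defs
begin

text \<open>Only the expected weight is controlled: a drop on one branch may be balanced by growth
  on others, so the expected weight itself need not decrease. A strictly concave potential gains
  even then. Its gap to the tangent at w, for an integer drop, is at least 1/(1 + w)^3, which
  explains the exponent. This gap has no positive lower bound, hence the truncation at weight N. A
  step with an ADP of P_> at a redex without annotation needs no drop: the annotations of the
  right-hand side are discarded there anyway, so the flattened ADP makes the same step. Three kinds
  of annotations change in a step. Those above the redex have values affine in the contractum by
  multilinearity, so (3) passes through the context in expectation. Those of the right-hand side are
  bounded by (1) at the assignment composed with the matching substitution. Those repositioned in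
  full rewriting are paid by old ones below the redex, since each of these is moved to at most one
  place. In the completeness proof, extra annotations can only turn other steps into annotated ones,
  so the condition on infinite paths survives.\<close>

section \<open>Sums over the levels of a tree\<close>

text \<open>A leaf contributes at its own depth and at no later one. With \<open>h\<close> the
  probabilities, this is the mass of the paths that have not stopped before level
  \<open>n\<close>.\<close>

primrec level_sum :: "'n rel \<Rightarrow> ('n \<Rightarrow> real) \<Rightarrow> nat \<Rightarrow> 'n \<Rightarrow> real" where
  "level_sum E h 0 v = h v"
| "level_sum E h (Suc n) v = (\<Sum>u\<in>E `` {v}. level_sum E h n u)"

lemma level_sum_plus: "level_sum E h (m + n) v = level_sum E (level_sum E h n) m v"
  by (induction m arbitrary: v) auto

lemma level_sum_Suc_right: "level_sum E h (Suc n) v = level_sum E (\<lambda>u. \<Sum>w\<in>E `` {u}. h w) n v"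
  by (induction n arbitrary: v) auto

lemma level_sum_mono:
  assumes "E \<subseteq> V \<times> V" "v \<in> V" "\<And>u. u \<in> V \<Longrightarrow> h u \<le> h' u"
  shows "level_sum E h n v \<le> level_sum E h' n v"
  using assms(2)
proof (induction n arbitrary: v)
  case (Suc n)
  then show ?case using assms(1) by (auto intro!: sum_mono)
qed (use assms in auto)

lemma level_sum_add: "level_sum E (\<lambda>u. h u + h' u) n v = level_sum E h n v + level_sum E h' n v"
  by (induction n arbitrary: v) (auto simp: sum.distrib)

lemma level_sum_mult: "level_sum E (\<lambda>u. c * h u) n v = c * level_sum E h n v"
  by (induction n arbitrary: v) (auto simp: sum_distrib_left)

lemma level_sum_nonneg:
  assumes "E \<subseteq> V \<times> V" "v \<in> V" "\<And>u. u \<in> V \<Longrightarrow> 0 \<le> h u"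
  shows "0 \<le> level_sum E h n v"
  using level_sum_mono[OF assms(1,2), of "\<lambda>_. 0" h n] assms(3) level_sum_mult[of E 0 "\<lambda>_. 0" n v]
  by simp

text \<open>The last assumption is the supermartingale condition for a quantity already weighted by
  probability; at a leaf it says 0 \<le> \<open>h u\<close>.\<close>

lemma level_sum_decreasing:
  assumes "E \<subseteq> V \<times> V" "v \<in> V" "\<And>u. u \<in> V \<Longrightarrow> (\<Sum>w\<in>E `` {u}. h w) \<le> h u"
  shows "level_sum E h (Suc n) v \<le> level_sum E h n v"
  unfolding level_sum_Suc_right by (intro level_sum_mono[OF assms(1,2)] assms(3))

lemma level_sum_antimono:
  assumes "E \<subseteq> V \<times> V" "v \<in> V" "\<And>u. u \<in> V \<Longrightarrow> (\<Sum>w\<in>E `` {u}. h w) \<le> h u" "m \<le> n"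
  shows "level_sum E h n v \<le> level_sum E h m v"
  using assms(4)
proof (induction rule: dec_induct)
  case (step n)
  have "level_sum E h (Suc n) v \<le> level_sum E h n v"
    by (rule level_sum_decreasing[OF assms(1-3)])
  with step.IH show ?case by linarith
qed simp

lemma level_sum_tendsto_0:
  assumes "E \<subseteq> V \<times> V" "v \<in> V" "\<And>u. u \<in> V \<Longrightarrow> (\<lambda>n. h n u) \<longlonglongrightarrow> 0"
  shows "(\<lambda>n. level_sum E (h n) d v) \<longlonglongrightarrow> 0"
  using assms(2)
proof (induction d arbitrary: v)
  case (Suc d)
  have "(\<lambda>n. level_sum E (h n) d u) \<longlonglongrightarrow> 0" if "u \<in> E `` {v}" for u
    using Suc that assms(1) by auto
  from tendsto_sum[OF this, of "E `` {v}"] show ?case by simp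
qed (use assms in auto)

text \<open>No edge enters the root and parents are unique, so two paths from the root to one node
  can be compared backwards edge by edge and have equal length.\<close>

lemma directed_tree_depth:
  assumes "directed_tree V E v0"
  obtains d :: "'n \<Rightarrow> nat" where "d v0 = 0" "\<And>u w. (u, w) \<in> E \<Longrightarrow> d w = Suc (d u)"
    "\<And>v n. v \<in> V \<Longrightarrow> (v0, v) \<in> E ^^ n \<longleftrightarrow> n = d v"
proof -
  have uniq: "(v0, w) \<in> E ^^ n \<Longrightarrow> (v0, w) \<in> E ^^ m \<Longrightarrow> n = m" for n m w
  proof (induction n arbitrary: m w)
    case 0
    with assms show ?case by (cases m) (auto simp: directed_tree_def)
  next
    case (Suc n)
    then obtain u where u: "(v0, u) \<in> E ^^ n" "(u, w) \<in> E" by auto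
    show ?case
    proof (cases m)
      case 0
      with Suc u assms show ?thesis by (auto simp: directed_tree_def)
    next
      case (Suc m')
      with Suc.prems obtain u' where u': "(v0, u') \<in> E ^^ m'" "(u', w) \<in> E" by auto
      with u assms have "u = u'" by (auto simp: directed_tree_def)
      with u u' Suc.IH Suc show ?thesis by auto
    qed
  qed
  have ex: "\<exists>n. (v0, v) \<in> E ^^ n" if "v \<in> V" for v
    using assms that by (auto simp: directed_tree_def rtrancl_power)
  define d where "d v = (SOME n. (v0, v) \<in> E ^^ n)" for v
  have d: "(v0, v) \<in> E ^^ n \<longleftrightarrow> n = d v" if "v \<in> V" for v n
    using someI_ex[OF ex[OF that]] uniq unfolding d_def by blast
  have "d v0 = 0" using d[of v0 0] assms by (auto simp: directed_tree_def)
  moreover have "d w = Suc (d u)" if "(u, w) \<in> E" for u w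
  proof -
    have uw: "u \<in> V" "w \<in> V" using that assms by (auto simp: directed_tree_def)
    then have "(v0, u) \<in> E ^^ d u" using d by blast
    with that have "(v0, w) \<in> E ^^ Suc (d u)" by auto
    with d[OF uw(2), of "Suc (d u)"] show ?thesis by metis
  qed
  ultimately show ?thesis using d that by blast
qed

text \<open>Unique parents make the successor sets of distinct nodes disjoint, so the recursive sum
  counts no node twice.\<close>

lemma level_sum_eq_sum:
  assumes tree: "directed_tree V E v0" and fin: "\<And>v. v \<in> V \<Longrightarrow> finite (E `` {v})"
  shows "finite ((E ^^ n) `` {v0}) \<and> level_sum E h n v0 = sum h ((E ^^ n) `` {v0})"
proof (induction n arbitrary: h)
  case (Suc n)
  have sub: "(E ^^ n) `` {v0} \<subseteq> V"
    using tree by (cases n) (auto simp: directed_tree_def)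
  have eq: "(E ^^ Suc n) `` {v0} = (\<Union>u\<in>(E ^^ n) `` {v0}. E `` {u})" by auto
  have fin': "finite (E `` {u})" if "u \<in> (E ^^ n) `` {v0}" for u using sub fin that by auto
  have "sum h ((E ^^ Suc n) `` {v0}) = (\<Sum>u\<in>(E ^^ n) `` {v0}. \<Sum>w\<in>E `` {u}. h w)"
    unfolding eq using Suc fin' tree by (intro sum.UNION_disjoint) (auto simp: directed_tree_def)
  also have "\<dots> = level_sum E h (Suc n) v0" unfolding level_sum_Suc_right using Suc by auto
  finally show ?case using Suc fin' unfolding eq by auto
qed auto

text \<open>At every \<open>n\<close>, the value \<open>h v0\<close> splits into the leaves above
  level \<open>n\<close> and the entire level \<open>n\<close>. The partial leaf sums therefore
  approach \<open>h v0\<close> exactly when the levels vanish.\<close>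

lemma leaf_sum_iff_level_sum_tendsto_0:
  assumes tree: "directed_tree V E v0" and fin: "\<And>v. v \<in> V \<Longrightarrow> finite (E `` {v})"
    and nonneg: "\<And>v. v \<in> V \<Longrightarrow> 0 \<le> h v"
    and conserve: "\<And>v. v \<in> inner_nodes V E \<Longrightarrow> (\<Sum>w\<in>E `` {v}. h w) = h v"
  shows "(\<Sum>\<^sub>\<infinity>v\<in>leaves V E. h v) = h v0 \<longleftrightarrow> (\<lambda>n. level_sum E h n v0) \<longlonglongrightarrow> 0"
proof -
  obtain d where d: "\<And>v n. v \<in> V \<Longrightarrow> (v0, v) \<in> E ^^ n \<longleftrightarrow> n = d v"
    by (rule directed_tree_depth[OF tree]) blast
  let ?L = "\<lambda>n. (E ^^ n) `` {v0}"
  \<comment> \<open>The inequality is strict because the leaves at depth \<open>n\<close> are still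
    counted by \<open>level_sum\<close> at \<open>n\<close>.\<close>
  define X where "X n = {v \<in> leaves V E. d v < n}" for n
  have E: "E \<subseteq> V \<times> V" and v0: "v0 \<in> V" using tree by (auto simp: directed_tree_def)
  have sub: "?L n \<subseteq> V" for n using tree by (cases n) (auto simp: directed_tree_def)
  have step: "X (Suc n) = X n \<union> (?L n \<inter> leaves V E)" for n
    using d unfolding X_def leaves_def by (auto simp: less_Suc_eq)
  have disj: "X n \<inter> (?L n \<inter> leaves V E) = {}" for n
    using d unfolding X_def leaves_def by auto
  have finL: "finite (?L n)" and sumL: "level_sum E h n v0 = sum h (?L n)" for n h
    using level_sum_eq_sum[OF tree fin] by auto
  have finX: "finite (X n)" for n
  proof (induction n)
    case 0
    then show ?case by (simp add: X_def)
  next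
    case (Suc n)
    then show ?case unfolding step using finL by auto
  qed
  \<comment> \<open>One level down, the leaves of level \<open>n\<close> move into
    \<open>X (Suc n)\<close>, and by \<open>conserve\<close> the inner nodes are replaced by their
    children.\<close>
  have total: "sum h (X n) + level_sum E h n v0 = h v0" for n
  proof (induction n)
    case 0
    then show ?case by (simp add: X_def)
  next
    case (Suc n)
    have "level_sum E h (Suc n) v0 = (\<Sum>u\<in>?L n. \<Sum>w\<in>E `` {u}. h w)"
      unfolding level_sum_Suc_right sumL ..
    also have "\<dots> = (\<Sum>u\<in>?L n - leaves V E. h u)"
      using sub[of n] by (intro sum.mono_neutral_cong_right finL)
        (auto simp: leaves_def inner_nodes_def intro!: conserve)
    finally have "sum h (X (Suc n)) + level_sum E h (Suc n) v0
      = sum h (X n) + (sum h (?L n \<inter> leaves V E) + sum h (?L n - leaves V E))"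
      unfolding step using disj finX finL by (subst sum.union_disjoint) auto
    also have "sum h (?L n \<inter> leaves V E) + sum h (?L n - leaves V E) = sum h (?L n)"
      using sum.Int_Diff[OF finL] by metis
    finally show ?case using Suc sumL by simp
  qed
  have pos: "0 \<le> level_sum E h n v0" for n by (rule level_sum_nonneg[OF E v0 nonneg])
  have hleaf: "0 \<le> h v" if "v \<in> leaves V E" for v using that nonneg by (auto simp: leaves_def)
  have cover: "\<exists>n. S \<subseteq> X n" if "finite S" "S \<subseteq> leaves V E" for S
  proof (intro exI subsetI)
    fix v assume "v \<in> S"
    with that have "d v \<le> Max (d ` S)" by auto
    with \<open>v \<in> S\<close> that show "v \<in> X (Suc (Max (d ` S)))" by (auto simp: X_def less_Suc_eq_le)
  qed
  have bound: "sum h S \<le> h v0" if S: "finite S" "S \<subseteq> leaves V E" for S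
  proof -
    obtain n where "S \<subseteq> X n" using cover[OF S] by blast
    then have "sum h S \<le> sum h (X n)" using finX hleaf by (intro sum_mono2) (auto simp: X_def)
    with total[of n] pos[of n] show ?thesis by linarith
  qed
  have summ: "h summable_on leaves V E"
    by (rule nonneg_bdd_above_summable_on[OF hleaf]) (auto intro!: bdd_aboveI2[where M = "h v0"] bound)
  have lower: "sum h (X n) \<le> (\<Sum>\<^sub>\<infinity>v\<in>leaves V E. h v)" for n
    using finX hleaf by (intro finite_sum_le_infsum[OF summ]) (auto simp: X_def)
  have upper: "(\<Sum>\<^sub>\<infinity>v\<in>leaves V E. h v) \<le> h v0"
    by (rule infsum_le_finite_sums[OF summ bound])
  show ?thesis
  proof
    assume eq: "(\<Sum>\<^sub>\<infinity>v\<in>leaves V E. h v) = h v0"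
    have anti: "level_sum E h n v0 \<le> level_sum E h m v0" if "m \<le> n" for m n
    proof (rule level_sum_antimono[OF E v0 _ that])
      fix u assume "u \<in> V"
      then show "(\<Sum>w\<in>E `` {u}. h w) \<le> h u"
        using conserve[of u] nonneg[of u] by (cases "E `` {u} = {}") (auto simp: inner_nodes_def)
    qed
    show "(\<lambda>n. level_sum E h n v0) \<longlonglongrightarrow> 0"
    proof (rule LIMSEQ_I)
      fix e :: real assume "0 < e"
      have "\<exists>S. finite S \<and> S \<subseteq> leaves V E \<and> h v0 - e < sum h S"
      proof (rule ccontr)
        assume "\<not> ?thesis"
        then have "(\<Sum>\<^sub>\<infinity>v\<in>leaves V E. h v) \<le> h v0 - e"
          by (intro infsum_le_finite_sums[OF summ]) (auto simp: not_less)
        with eq \<open>0 < e\<close> show False by simp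
      qed
      then obtain S where S: "finite S" "S \<subseteq> leaves V E" "h v0 - e < sum h S" by blast
      obtain n where n: "S \<subseteq> X n" using cover[OF S(1,2)] by blast
      have "sum h S \<le> sum h (X n)" using n finX hleaf by (intro sum_mono2) (auto simp: X_def)
      with total[of n] S have "level_sum E h n v0 < e" by linarith
      then show "\<exists>no. \<forall>n\<ge>no. norm (level_sum E h n v0 - 0) < e"
        using anti[of n] pos by (intro exI[of _ n]) (auto intro: order.strict_trans1)
    qed
  next
    assume "(\<lambda>n. level_sum E h n v0) \<longlonglongrightarrow> 0"
    then have "(\<lambda>n. h v0 - level_sum E h n v0) \<longlonglongrightarrow> h v0 - 0" by (intro tendsto_intros)
    moreover have "h v0 - level_sum E h n v0 \<le> (\<Sum>\<^sub>\<infinity>v\<in>leaves V E. h v)" for n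
      using lower[of n] total[of n] by linarith
    ultimately have "h v0 - 0 \<le> (\<Sum>\<^sub>\<infinity>v\<in>leaves V E. h v)" by (intro LIMSEQ_le_const2) auto
    with upper show "(\<Sum>\<^sub>\<infinity>v\<in>leaves V E. h v) = h v0" by simp
  qed
qed

section \<open>Cutting and relabelling chain trees\<close>

text \<open>The distribution that \<open>chain_tree\<close> requires of the step at
  \<open>v\<close>; the division turns absolute into conditional probabilities.\<close>

definition children_dist :: "'n rel \<Rightarrow> ('n \<Rightarrow> real \<times> ('f, 'v) aterm) \<Rightarrow> 'n \<Rightarrow> ('f, 'v) mdist" where
  "children_dist E L v = image_mset (\<lambda>w. (fst (L w) / fst (L v), snd (L w))) (mset_set (E `` {v}))"

lemma sum_children_dist:
  "(\<Sum>(p, t)\<in>#children_dist E L v. p * g t) = (\<Sum>w\<in>E `` {v}. fst (L w) * g (snd (L w))) / fst (L v)"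
  by (simp add: children_dist_def image_mset.compositionality comp_def sum_unfold_sum_mset[symmetric]
      sum_divide_distrib)

lemma chain_tree_conserve:
  assumes tree: "chain_tree T step V E L A"
    and prob: "\<And>b s \<mu>. step b s \<mu> \<Longrightarrow> (\<Sum>(p, t)\<in>#\<mu>. p) = 1"
    and v: "v \<in> inner_nodes V E"
  shows "(\<Sum>w\<in>E `` {v}. fst (L w)) = fst (L v)"
proof -
  have "step (v \<in> A) (snd (L v)) (children_dist E L v)"
    using tree v by (auto simp: chain_tree_def children_dist_def)
  from prob[OF this] have "(\<Sum>(p, t)\<in>#children_dist E L v. p * 1) = 1" by simp
  moreover have "0 < fst (L v)" using tree v by (auto simp: chain_tree_def inner_nodes_def)
  ultimately show ?thesis unfolding sum_children_dist by (simp add: field_simps)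
qed

lemma leaf_prob_iff_level_sum_tendsto_0:
  assumes tree: "chain_tree T step V E L A" "directed_tree V E v0"
    and prob: "\<And>b s \<mu>. step b s \<mu> \<Longrightarrow> (\<Sum>(p, t)\<in>#\<mu>. p) = 1"
  shows "leaf_prob V E L = 1 \<longleftrightarrow> (\<lambda>n. level_sum E (\<lambda>v. fst (L v)) n v0) \<longlonglongrightarrow> 0"
proof -
  obtain v1 where v1: "directed_tree V E v1" "fst (L v1) = 1"
    using tree(1) by (auto simp: chain_tree_def)
  \<comment> \<open>The root in \<open>chain_tree\<close> is given only existentially; no edge
    enters it, so the path from \<open>v0\<close> to it is empty.\<close>
  have "v0 = v1"
  proof -
    have "(v0, v1) \<in> E\<^sup>*" using v1(1) tree(2) by (auto simp: directed_tree_def)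
    then show ?thesis using v1(1) by (cases rule: rtrancl.cases) (auto simp: directed_tree_def)
  qed
  have "(\<Sum>\<^sub>\<infinity>v\<in>leaves V E. fst (L v)) = fst (L v0) \<longleftrightarrow>
    (\<lambda>n. level_sum E (\<lambda>v. fst (L v)) n v0) \<longlonglongrightarrow> 0"
    using tree(1) chain_tree_conserve[OF tree(1) prob]
    by (intro leaf_sum_iff_level_sum_tendsto_0[OF tree(2)]) (auto simp: chain_tree_def intro: less_imp_le)
  then show ?thesis using v1 \<open>v0 = v1\<close> by (simp add: leaf_prob_def)
qed

text \<open>Nodes of \<open>C\<close> stay as leaves, so they need no step of \<open>stepQ\<close>,
  and every remaining inner node keeps all its children. Dividing by the label of \<open>v\<close>
  restores probability 1 at the new root.\<close>

lemma cut_subtree: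
  assumes tree: "chain_tree T stepP V E L A" and v: "v \<in> V"
    and conserve: "\<And>u. u \<in> inner_nodes V E \<Longrightarrow> (\<Sum>w\<in>E `` {u}. fst (L w)) = fst (L u)"
    and stepQ: "\<And>u. u \<in> inner_nodes V E \<Longrightarrow> u \<notin> C \<Longrightarrow>
      stepQ (u \<in> A) (snd (L u)) (children_dist E L u)"
    and E2: "E2 = {(u, w) \<in> E. u \<notin> C}" and W: "W = E2\<^sup>* `` {v}"
    and E3: "E3 = E2 \<inter> W \<times> W"
  shows "directed_tree W E3 v"
    "chain_tree T stepQ W E3 (\<lambda>w. (fst (L w) / fst (L v), snd (L w))) (A \<inter> inner_nodes W E3)"
proof -
  obtain v0 where v0: "directed_tree V E v0" using tree by (auto simp: chain_tree_def)
  obtain d where d: "\<And>u w. (u, w) \<in> E \<Longrightarrow> d w = Suc (d u)"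
    by (rule directed_tree_depth[OF v0]) blast
  have EV: "E \<subseteq> V \<times> V" using v0 by (auto simp: directed_tree_def)
  have pos: "0 < fst (L u)" if "u \<in> V" for u using tree that by (auto simp: chain_tree_def)
  \<comment> \<open>The depth bound rules out an edge back into \<open>v\<close>, and the
    probability bound keeps the rescaled labels at most 1.\<close>
  have W1: "u \<in> V \<and> d v \<le> d u \<and> fst (L u) \<le> fst (L v) \<and> (v, u) \<in> E3\<^sup>*" if "(v, u) \<in> E2\<^sup>*" for u
    using that
  proof (induction rule: rtrancl_induct)
    case base
    then show ?case using v by auto
  next
    case (step y z)
    then have yz: "(y, z) \<in> E" "(y, z) \<in> E3" using E2 E3 W by (auto intro: rtrancl_into_rtrancl)
    then have "fst (L z) \<le> (\<Sum>w\<in>E `` {y}. fst (L w))"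
      using tree EV pos by (intro member_le_sum) (auto simp: chain_tree_def intro!: less_imp_le)
    also have "\<dots> = fst (L y)"
      using yz EV by (intro conserve) (auto simp: inner_nodes_def)
    finally show ?case using step yz d[OF yz(1)] EV by (auto intro: rtrancl_into_rtrancl)
  qed
  have succ: "E3 `` {u} = (if u \<in> C then {} else E `` {u})" if "u \<in> W" for u
    using that unfolding E3 W E2 by (auto intro: rtrancl_into_rtrancl)
  show dt: "directed_tree W E3 v"
    unfolding directed_tree_def
  proof (intro conjI allI ballI impI)
    show "(u, v) \<notin> E3" for u
    proof
      assume "(u, v) \<in> E3"
      then have "(u, v) \<in> E" "(v, u) \<in> E2\<^sup>*" using E3 E2 W by auto
      with W1 d show False by fastforce
    qed
    show "u = u'" if "(u, w) \<in> E3" "(u', w) \<in> E3" for u u' w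
      using that v0 E3 E2 by (auto simp: directed_tree_def)
  qed (use W W1 E3 in auto)
  have inner: "u \<in> inner_nodes V E \<and> u \<notin> C" if "u \<in> inner_nodes W E3" for u
    using that succ[of u] W1 W by (auto simp: inner_nodes_def split: if_splits)
  show "chain_tree T stepQ W E3 (\<lambda>w. (fst (L w) / fst (L v), snd (L w))) (A \<inter> inner_nodes W E3)"
    unfolding chain_tree_def
  proof (intro conjI ballI allI impI)
    show "\<exists>v0. directed_tree W E3 v0 \<and> fst (fst (L v0) / fst (L v), snd (L v0)) = 1"
      using dt pos[OF v] by (intro exI[of _ v]) auto
    fix u assume "u \<in> W"
    then have u: "u \<in> V" "fst (L u) \<le> fst (L v)" using W1 W by auto
    show "finite (E3 `` {u})" using tree u succ[OF \<open>u \<in> W\<close>] by (auto simp: chain_tree_def)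
    show "0 < fst (fst (L u) / fst (L v), snd (L u))"
      "fst (fst (L u) / fst (L v), snd (L u)) \<le> 1"
      "snd (fst (L u) / fst (L v), snd (L u)) \<in> T"
      using u pos[OF u(1)] pos[OF v] tree by (auto simp: chain_tree_def)
  next
    fix u assume u: "u \<in> inner_nodes W E3"
    have uW: "u \<in> W" using u by (auto simp: inner_nodes_def)
    have "E3 `` {u} = E `` {u}" using succ[OF uW] inner[OF u] by auto
    then have "children_dist E3 (\<lambda>w. (fst (L w) / fst (L v), snd (L w))) u = children_dist E L u"
      using pos[OF v] by (auto simp: children_dist_def intro!: image_mset_cong)
    with stepQ[of u] inner[OF u] u
    show "stepQ (u \<in> A \<inter> inner_nodes W E3) (snd (fst (L u) / fst (L v), snd (L u)))
      (image_mset (\<lambda>w. (fst (fst (L w) / fst (L v), snd (L w)) / fst (fst (L u) / fst (L v), snd (L u)),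
        snd (fst (L w) / fst (L v), snd (L w)))) (mset_set (E3 `` {u})))"
      unfolding children_dist_def by auto
  next
    fix x assume x: "\<forall>i::nat. (x i, x (Suc i)) \<in> E3"
    then have "\<forall>i. (x i, x (Suc i)) \<in> E" using E3 E2 by auto
    then have "infinite {i. x i \<in> A}" using tree by (auto simp: chain_tree_def)
    moreover have "x i \<in> inner_nodes W E3" for i using x E3 by (auto simp: inner_nodes_def)
    ultimately show "infinite {i. x i \<in> A \<inter> inner_nodes W E3}" by auto
  qed auto
qed

section \<open>From a ranking of terms to convergence of chain trees\<close>

primrec acc_sum :: "'n rel \<Rightarrow> ('n \<Rightarrow> real) \<Rightarrow> nat \<Rightarrow> 'n \<Rightarrow> real" where
  "acc_sum E h 0 v = 0"
| "acc_sum E h (Suc n) v = h v + (\<Sum>u\<in>E `` {v}. acc_sum E h n u)"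

text \<open>The tangent of the concave potential $1 - 1/(1+x)$ at $y$, with the gap made explicit for $x < y$.\<close>

lemma concave_potential:
  fixes x y :: nat
  shows "1 - 1 / (1 + real x) \<le> 1 - 1 / (1 + real y) + (real x - real y) / (1 + real y)^2
     - (if x < y then 1 / (1 + real y)^3 else 0)"
proof -
  define a b where ab: "a = 1 + real x" "b = 1 + real y"
  have pos: "0 < a" "0 < b" by (auto simp: ab)
  \<comment> \<open>The gap between tangent and potential is a square over \<open>a * b^2\<close>.
    Weights are integers, so a drop makes the square at least 1, and \<open>a \<le> b\<close>
    enlarges the denominator to \<open>b^3\<close>.\<close>
  have eq: "1 - 1 / b + (a - b) / b^2 - (1 - 1 / a) = (a - b)^2 / (a * b^2)"
    using pos by (simp add: field_simps power2_eq_square)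
  have "(if x < y then 1 / b^3 else 0) \<le> (a - b)^2 / (a * b^2)"
  proof (cases "x < y")
    case True
    then have "1 \<le> b - a" "a \<le> b" by (auto simp: ab)
    then have "1 \<le> (b - a)^2" by (simp add: one_le_power)
    then have "1 / b^3 \<le> (b - a)^2 / b^3" using pos by (simp add: divide_right_mono)
    also have "\<dots> \<le> (b - a)^2 / (a * b^2)"
      using pos \<open>a \<le> b\<close> by (intro divide_left_mono) (auto simp: power3_eq_cube power2_eq_square)
    finally show ?thesis using True by (simp add: power2_commute)
  qed (use pos in auto)
  with eq have "1 - 1 / a \<le> 1 - 1 / b + (a - b) / b^2 - (if x < y then 1 / b^3 else 0)" by linarith
  moreover have "a - b = real x - real y" by (simp add: ab)
  ultimately show ?thesis unfolding ab by metis
qed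

text \<open>The probabilistic core, free of annotations and rules: by \<open>dec\<close> a step is
  either available in the processed problem or lowers the weight on a branch of probability at least
  \<open>q\<close>.\<close>

lemma ranking_soundness:
  fixes W :: "('f, 'v) aterm \<Rightarrow> nat" and V :: "nat set"
  assumes prob: "\<And>b s \<mu>. stepP b s \<mu> \<Longrightarrow> (\<Sum>(p, t)\<in>#\<mu>. p) = 1"
    and probQ: "\<And>b s \<mu>. stepQ b s \<mu> \<Longrightarrow> (\<Sum>(p, t)\<in>#\<mu>. p) = 1"
    and super: "\<And>b s \<mu>. s \<in> T \<Longrightarrow> stepP b s \<mu> \<Longrightarrow> (\<Sum>(p, t)\<in>#\<mu>. p * real (W t)) \<le> real (W s)"
    and q: "0 < q"
    and dec: "\<And>b s \<mu>. s \<in> T \<Longrightarrow> stepP b s \<mu> \<Longrightarrow>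
      stepQ b s \<mu> \<or> (\<exists>(p, t)\<in>#\<mu>. q \<le> p \<and> W t < W s)"
    and Q: "\<And>(V :: nat set) E L A. chain_tree T stepQ V E L A \<Longrightarrow> leaf_prob V E L = 1"
    and tree: "chain_tree T stepP V E L A"
  shows "leaf_prob V E L = 1"
proof (rule ccontr)
  assume contra: "leaf_prob V E L \<noteq> 1"
  define p where "p v = fst (L v)" for v
  define X where "X v = W (snd (L v))" for v
  obtain v0 where v0: "directed_tree V E v0" and p0: "p v0 = 1"
    using tree by (auto simp: chain_tree_def p_def)
  have EV: "E \<subseteq> V \<times> V" and v0V: "v0 \<in> V" using v0 by (auto simp: directed_tree_def)
  have fin: "finite (E `` {v})" if "v \<in> V" for v using tree that by (auto simp: chain_tree_def)
  have pos: "0 < p v" if "v \<in> V" for v using tree that by (auto simp: chain_tree_def p_def)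
  have cons: "(\<Sum>w\<in>E `` {v}. p w) = p v" if "v \<in> inner_nodes V E" for v
    using chain_tree_conserve[OF tree prob that] by (simp add: p_def)
  have p_super: "(\<Sum>w\<in>E `` {v}. p w) \<le> p v" if "v \<in> V" for v
    using cons[of v] pos[OF that] that by (cases "E `` {v} = {}") (auto simp: inner_nodes_def)
  have stepP: "stepP (v \<in> A) (snd (L v)) (children_dist E L v)" if "v \<in> inner_nodes V E" for v
    using tree that by (auto simp: chain_tree_def children_dist_def)
  have inT: "snd (L v) \<in> T" if "v \<in> V" for v using tree that by (auto simp: chain_tree_def)
  have X_super: "(\<Sum>w\<in>E `` {v}. p w * X w) \<le> p v * X v" if "v \<in> V" for v
  proof (cases "E `` {v} = {}")
    case False
    with that have "v \<in> inner_nodes V E" by (auto simp: inner_nodes_def)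
    from super[OF inT[OF that] stepP[OF this]] show ?thesis
      unfolding sum_children_dist using pos[OF that] by (simp add: p_def X_def field_simps)
  qed (use pos[OF that] in auto)
  define G where "G = {v \<in> inner_nodes V E. \<not> stepQ (v \<in> A) (snd (L v)) (children_dist E L v)}"
  define f where "f v = p v * (1 - 1 / (1 + real (X v)))" for v
  define c where "c v = (if v \<in> G then q * p v / (1 + real (X v))^3 else 0)" for v
  have f_nonneg: "0 \<le> f v" if "v \<in> V" for v using pos[OF that] by (auto simp: f_def)
  have c_nonneg: "0 \<le> c v" if "v \<in> V" for v using pos[OF that] q by (auto simp: c_def)
  have f_super: "c v + (\<Sum>w\<in>E `` {v}. f w) \<le> f v" if v: "v \<in> V" for v
  proof (cases "E `` {v} = {}")
    case True
    then have "v \<notin> G" by (auto simp: G_def inner_nodes_def)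
    with True f_nonneg[OF v] show ?thesis by (simp add: c_def)
  next
    case False
    with v have inner: "v \<in> inner_nodes V E" by (auto simp: inner_nodes_def)
    let ?S = "E `` {v}" and ?b = "1 + real (X v)"
    define e where "e w = (if X w < X v then 1 / ?b^3 else 0)" for w
    \<comment> \<open>The tangent at \<open>X v\<close> is applied to every child: its linear part
      does not increase in expectation by \<open>X_super\<close>, and the gaps \<open>e\<close>
      remain as gain.\<close>
    have "(\<Sum>w\<in>?S. f w) \<le> (\<Sum>w\<in>?S. p w * (1 - 1 / ?b + (real (X w) - X v) / ?b^2 - e w))"
      unfolding f_def e_def using pos EV by (intro sum_mono mult_left_mono concave_potential less_imp_le) auto
    also have "\<dots> = (\<Sum>w\<in>?S. p w * (1 - 1 / ?b - X v / ?b^2) + (p w * X w) / ?b^2 - p w * e w)"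
      by (intro sum.cong refl) (simp add: algebra_simps diff_divide_distrib)
    also have "\<dots> = (\<Sum>w\<in>?S. p w) * (1 - 1 / ?b - X v / ?b^2) + (\<Sum>w\<in>?S. p w * X w) / ?b^2
        - (\<Sum>w\<in>?S. p w * e w)"
      by (simp only: sum_subtractf sum.distrib sum_distrib_right sum_divide_distrib)
    also have "\<dots> \<le> p v * (1 - 1 / ?b - X v / ?b^2) + (p v * X v) / ?b^2 - (\<Sum>w\<in>?S. p w * e w)"
      unfolding cons[OF inner] using X_super[OF v]
      by (intro diff_right_mono add_left_mono divide_right_mono) auto
    also have "\<dots> = f v - (\<Sum>w\<in>?S. p w * e w)" by (simp add: f_def algebra_simps)
    finally have 1: "(\<Sum>w\<in>?S. f w) \<le> f v - (\<Sum>w\<in>?S. p w * e w)" .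
    \<comment> \<open>By \<open>dec\<close> one child carries at least the fraction \<open>q\<close>
      of the mass and has smaller weight, so its gap alone pays for \<open>c v\<close>.\<close>
    have "c v \<le> (\<Sum>w\<in>?S. p w * e w)"
    proof (cases "v \<in> G")
      case True
      then have "\<exists>(r, t)\<in>#children_dist E L v. q \<le> r \<and> W t < W (snd (L v))"
        using dec[OF inT[OF v] stepP[OF inner]] by (auto simp: G_def)
      then obtain w where w: "w \<in> ?S" "q \<le> p w / p v" "X w < X v"
        using fin[OF v] by (auto simp: children_dist_def p_def X_def)
      have "q * p v \<le> p w" using w(2) pos[OF v] by (simp add: field_simps)
      then have "c v \<le> p w * e w" using w(3) True by (auto simp: c_def e_def divide_right_mono)
      also have "\<dots> \<le> (\<Sum>w\<in>?S. p w * e w)"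
        using w(1) fin[OF v] pos EV by (intro member_le_sum) (auto simp: e_def intro!: less_imp_le)
      finally show ?thesis .
    next
      case False
      have "0 \<le> (\<Sum>w\<in>?S. p w * e w)"
        using pos EV by (intro sum_nonneg mult_nonneg_nonneg) (auto simp: e_def intro: less_imp_le)
      with False show ?thesis by (simp add: c_def)
    qed
    with 1 show ?thesis by linarith
  qed
  have f_super': "(\<Sum>w\<in>E `` {v}. f w) \<le> f v" if "v \<in> V" for v
    using f_super[OF that] c_nonneg[OF that] by linarith
  have acc_nonneg: "0 \<le> acc_sum E c n v" if "v \<in> V" for n v
    using that c_nonneg EV by (induction n arbitrary: v) (auto intro!: add_nonneg_nonneg sum_nonneg)
  have acc: "acc_sum E c n v + level_sum E f n v \<le> f v" if "v \<in> V" for n v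
    using that
  proof (induction n arbitrary: v)
    case (Suc n)
    have "(\<Sum>u\<in>E `` {v}. acc_sum E c n u + level_sum E f n u) \<le> (\<Sum>u\<in>E `` {v}. f u)"
      using Suc EV by (intro sum_mono) auto
    with f_super[OF Suc.prems] show ?case by (simp add: sum.distrib)
  qed simp
  have p_anti: "level_sum E p n v \<le> level_sum E p m v" if "v \<in> V" "m \<le> n" for m n v
    by (rule level_sum_antimono[OF EV that(1) p_super that(2)])
  have "\<not> (\<lambda>n. level_sum E p n v0) \<longlonglongrightarrow> 0"
    using contra leaf_prob_iff_level_sum_tendsto_0[OF tree v0 prob] by (simp add: p_def[abs_def])
  \<comment> \<open>Level masses never increase, so without convergence to 0 they stay above one
    positive bound.\<close>
  have "\<exists>e>0. \<forall>n. e \<le> level_sum E p n v0"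
  proof (rule ccontr)
    assume neg: "\<not> ?thesis"
    have "(\<lambda>n. level_sum E p n v0) \<longlonglongrightarrow> 0"
    proof (rule LIMSEQ_I)
      fix r :: real assume "0 < r"
      with neg obtain n where n: "level_sum E p n v0 < r" by (auto simp: not_le)
      have "norm (level_sum E p m v0 - 0) < r" if "n \<le> m" for m
        using p_anti[OF v0V that] n level_sum_nonneg[OF EV v0V, of p m] less_imp_le[OF pos] by simp
      then show "\<exists>no. \<forall>m\<ge>no. norm (level_sum E p m v0 - 0) < r" by blast
    qed
    with \<open>\<not> (\<lambda>n. level_sum E p n v0) \<longlonglongrightarrow> 0\<close> show False by blast
  qed
  then obtain \<epsilon> where \<epsilon>: "0 < \<epsilon>" "\<And>n. \<epsilon> \<le> level_sum E p n v0" by blast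
  \<comment> \<open>The mass \<epsilon> is split into thirds: one for nodes of weight above
    \<open>N\<close>, one for nodes of \<open>G\<close>, and one that survives both cuts.\<close>
  obtain N :: nat where N: "0 < N" "real (X v0) / N \<le> \<epsilon> / 3"
  proof -
    obtain N :: nat where "3 * real (X v0) / \<epsilon> < N" using reals_Archimedean2 by blast
    then have "real (X v0) / Suc N \<le> \<epsilon> / 3" using \<epsilon> by (simp add: field_simps)
    then show ?thesis using that by blast
  qed
  \<comment> \<open>A node of \<open>G\<close> with weight at most \<open>N\<close> costs at least
    \<open>cN\<close> times its probability.\<close>
  define cN where "cN = q / (1 + real N)^3"
  have cN: "0 < cN" using q by (simp add: cN_def)
  define C where "C = {v. N < X v} \<union> G"
  define E2 where "E2 = {(u, w) \<in> E. u \<notin> C}"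
  have succ2: "E2 `` {v} = (if v \<in> C then {} else E `` {v})" for v by (auto simp: E2_def)
  \<comment> \<open>The mass lost at a cut node is charged to its weight divided by \<open>N\<close>
    if that weight exceeds \<open>N\<close>, and otherwise to its cost. \<open>X_super\<close>
    carries the first charge up to the start node, which is the maximal inequality.\<close>
  have cut: "level_sum E p n v \<le> level_sum E2 p n v + (1 / N) * (p v * X v) + (1 / cN) * acc_sum E c n v"
    if "v \<in> V" for n v
    using that
  proof (induction n arbitrary: v)
    case 0
    then show ?case using pos[OF 0] by simp
  next
    case (Suc n)
    show ?case
    proof (cases "v \<in> C")
      case True
      have le: "level_sum E p (Suc n) v \<le> p v" using p_anti[OF Suc.prems, of 0 "Suc n"] by simp
      have acc0: "0 \<le> (1 / cN) * acc_sum E c (Suc n) v"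
        using cN by (intro mult_nonneg_nonneg acc_nonneg[OF Suc.prems]) auto
      have l2: "level_sum E2 p (Suc n) v = 0" using True succ2[of v] by simp
      show ?thesis
      proof (cases "N < X v")
        case big: True
        have "p v * 1 \<le> p v * (X v / N)" using big N pos[OF Suc.prems] by (intro mult_left_mono) auto
        with le acc0 l2 show ?thesis by simp
      next
        case False
        with True have G: "v \<in> G" "X v \<le> N" by (auto simp: C_def)
        have "0 \<le> (\<Sum>u\<in>E `` {v}. acc_sum E c n u)" using acc_nonneg EV by (intro sum_nonneg) auto
        then have "q * p v / (1 + real (X v))^3 \<le> acc_sum E c (Suc n) v" using G by (simp add: c_def)
        moreover have "cN * p v \<le> q * p v / (1 + real (X v))^3"
          unfolding cN_def times_divide_eq_left using G q pos[OF Suc.prems]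
          by (intro divide_left_mono power_mono) auto
        ultimately have "cN * p v \<le> acc_sum E c (Suc n) v" by linarith
        then have "p v \<le> (1 / cN) * acc_sum E c (Suc n) v" using cN by (simp add: field_simps)
        moreover have "0 \<le> (1 / N) * (p v * X v)" using pos[OF Suc.prems] by simp
        ultimately show ?thesis using le l2 by linarith
      qed
    next
      case False
      have "level_sum E p (Suc n) v \<le> (\<Sum>u\<in>E `` {v}. level_sum E2 p n u + (1 / N) * (p u * X u)
          + (1 / cN) * acc_sum E c n u)"
        using Suc EV by (auto intro!: sum_mono)
      also have "\<dots> = level_sum E2 p (Suc n) v + (1 / N) * (\<Sum>u\<in>E `` {v}. p u * X u)
          + (1 / cN) * (\<Sum>u\<in>E `` {v}. acc_sum E c n u)"
        using False succ2[of v] by (simp only: sum.distrib sum_distrib_left level_sum.simps if_False)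
      also have "\<dots> \<le> level_sum E2 p (Suc n) v + (1 / N) * (p v * X v) + (1 / cN) * acc_sum E c (Suc n) v"
        using X_super[OF Suc.prems] c_nonneg[OF Suc.prems] cN
        by (intro add_mono mult_left_mono) auto
      finally show ?thesis .
    qed
  qed
  have f_anti: "level_sum E f n v0 \<le> level_sum E f m v0" if "m \<le> n" for m n
    by (rule level_sum_antimono[OF EV v0V f_super' that])
  \<comment> \<open>By \<open>acc\<close>, the cost incurred from level \<open>d\<close> on is at
    most a drop between level sums of \<open>f\<close>. These decrease to a limit, so from some
    \<open>d\<close> on the drop is small for all \<open>n\<close> at once.\<close>
  have "\<exists>d. \<forall>n. level_sum E f d v0 - level_sum E f (d + n) v0 \<le> cN * (\<epsilon> / 3)"
  proof -
    have "decseq (\<lambda>n. level_sum E f n v0)" using f_anti by (simp add: decseq_def)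
    then obtain l where l: "(\<lambda>n. level_sum E f n v0) \<longlonglongrightarrow> l" "\<forall>n. l \<le> level_sum E f n v0"
      by (rule decseq_convergent[of _ 0]) (auto intro!: level_sum_nonneg[OF EV v0V] f_nonneg)
    have "\<forall>\<^sub>F n in sequentially. level_sum E f n v0 < l + cN * (\<epsilon> / 3)"
      using l(1) cN \<epsilon> by (intro order_tendstoD) auto
    then obtain d where "level_sum E f d v0 < l + cN * (\<epsilon> / 3)" by (auto simp: eventually_sequentially)
    then have "level_sum E f d v0 - level_sum E f (d + n) v0 \<le> cN * (\<epsilon> / 3)" for n
      using l(2)[rule_format, of "d + n"] by linarith
    then show ?thesis by blast
  qed
  then obtain d where d: "\<And>n. level_sum E f d v0 - level_sum E f (d + n) v0 \<le> cN * (\<epsilon> / 3)" by blast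
  have mass: "\<epsilon> / 3 \<le> level_sum E (level_sum E2 p n) d v0" for n
  proof -
    have "\<epsilon> \<le> level_sum E (level_sum E p n) d v0" using \<epsilon>(2)[of "d + n"] by (simp add: level_sum_plus)
    also have "\<dots> \<le> level_sum E (\<lambda>v. level_sum E2 p n v + (1 / N) * (p v * X v)
        + (1 / cN) * (f v + (- 1) * level_sum E f n v)) d v0"
    proof (rule level_sum_mono[OF EV v0V])
      fix u assume u: "u \<in> V"
      have "(1 / cN) * acc_sum E c n u \<le> (1 / cN) * (f u + (- 1) * level_sum E f n u)"
        using acc[OF u, of n] cN by (intro mult_left_mono) auto
      with cut[OF u, of n]
      show "level_sum E p n u \<le> level_sum E2 p n u + (1 / N) * (p u * X u)
        + (1 / cN) * (f u + (- 1) * level_sum E f n u)" by linarith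
    qed
    also have "\<dots> = level_sum E (level_sum E2 p n) d v0 + (1 / N) * level_sum E (\<lambda>v. p v * X v) d v0
        + (1 / cN) * (level_sum E f d v0 + (- 1) * level_sum E f (d + n) v0)"
      unfolding level_sum_plus by (simp only: level_sum_add level_sum_mult)
    also have "\<dots> \<le> level_sum E (level_sum E2 p n) d v0 + (1 / N) * (p v0 * X v0)
        + (1 / cN) * (cN * (\<epsilon> / 3))"
      using level_sum_antimono[OF EV v0V X_super, of 0 d] d[of n] cN
      by (intro add_mono mult_left_mono order_refl) auto
    also have "\<dots> \<le> level_sum E (level_sum E2 p n) d v0 + \<epsilon> / 3 + \<epsilon> / 3"
      using N cN p0 by simp
    finally show ?thesis by simp
  qed
  \<comment> \<open>Otherwise the finite sum over level \<open>d\<close> would tend to 0, against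
    \<open>mass\<close>.\<close>
  have "\<exists>v\<in>V. \<not> (\<lambda>n. level_sum E2 p n v) \<longlonglongrightarrow> 0"
  proof (rule ccontr)
    assume "\<not> ?thesis"
    then have "(\<lambda>n. level_sum E (level_sum E2 p n) d v0) \<longlonglongrightarrow> 0"
      by (intro level_sum_tendsto_0[OF EV v0V]) auto
    then have "\<epsilon> / 3 \<le> 0" by (rule LIMSEQ_le_const) (use mass in auto)
    with \<epsilon> show False by simp
  qed
  then obtain v where v: "v \<in> V" "\<not> (\<lambda>n. level_sum E2 p n v) \<longlonglongrightarrow> 0" by blast
  define S where "S = E2\<^sup>* `` {v}"
  define E3 where "E3 = E2 \<inter> S \<times> S"
  have sub: "directed_tree S E3 v"
    "chain_tree T stepQ S E3 (\<lambda>w. (fst (L w) / fst (L v), snd (L w))) (A \<inter> inner_nodes S E3)"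
    by (rule cut_subtree[where stepQ = stepQ and C = C, OF tree v(1) _ _ E2_def S_def E3_def];
        use cons in \<open>auto simp: p_def C_def G_def\<close>)+
  have "(\<lambda>n. level_sum E3 (\<lambda>w. fst (fst (L w) / fst (L v), snd (L w))) n v) \<longlonglongrightarrow> 0"
    by (rule iffD1[OF leaf_prob_iff_level_sum_tendsto_0[OF sub(2,1)] Q[OF sub(2)]]) (rule probQ)
  then have lim: "(\<lambda>n. level_sum E3 (\<lambda>w. p w / p v) n v) \<longlonglongrightarrow> 0" by (simp add: p_def)
  have eq: "level_sum E3 (\<lambda>w. p w / p v) n u = level_sum E2 p n u / p v" if "u \<in> S" for n u
    using that
  proof (induction n arbitrary: u)
    case (Suc n)
    have "E3 `` {u} = E2 `` {u}" "E2 `` {u} \<subseteq> S"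
      using Suc.prems by (auto simp: E3_def S_def intro: rtrancl_into_rtrancl)
    then show ?case using Suc.IH by (auto simp: sum_divide_distrib intro!: sum.cong)
  qed simp
  have "v \<in> S" by (simp add: S_def)
  have "(\<lambda>n. p v * level_sum E3 (\<lambda>w. p w / p v) n v) \<longlonglongrightarrow> p v * 0" by (intro tendsto_intros lim)
  then have "(\<lambda>n. level_sum E2 p n v) \<longlonglongrightarrow> 0"
    using pos[OF v(1)] by (simp add: eq[OF \<open>v \<in> S\<close>])
  with v(2) show False by blast
qed


text \<open>Lets a relation between distributions be read child by child: the related distribution
  is indexed by the same set of children.\<close>

lemma rel_mset_image_mset_set:
  assumes "finite S" "rel_mset Q (image_mset g (mset_set S)) M"
  shows "\<exists>h. M = image_mset h (mset_set S) \<and> (\<forall>w\<in>S. Q (g w) (h w))"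
  using assms
proof (induction S arbitrary: M rule: finite_induct)
  case (insert x S)
  then have "rel_mset Q (add_mset (g x) (image_mset g (mset_set S))) M" by simp
  then obtain M' b where M: "M = add_mset b M'" "Q (g x) b" "rel_mset Q (image_mset g (mset_set S)) M'"
    by (auto dest: msed_rel_invL)
  from insert.IH[OF M(3)] obtain h where h: "M' = image_mset h (mset_set S)" "\<forall>w\<in>S. Q (g w) (h w)"
    by blast
  have "image_mset h (mset_set S) = image_mset (h(x := b)) (mset_set S)"
    using insert.hyps by (intro image_mset_cong) auto
  with M(1) h(1) insert.hyps have "M = image_mset (h(x := b)) (mset_set (insert x S))" by (simp del: fun_upd_apply, simp)
  moreover have "\<forall>w\<in>insert x S. Q (g w) ((h(x := b)) w)" using h(2) M(2) insert.hyps by auto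
  ultimately show ?case by blast
qed auto

text \<open>
  The new tree may have more steps at annotated redexes than the old one (\<open>b \<longrightarrow> b'\<close>), which preserves
  the condition on infinite paths.
\<close>

lemma simulate_chain_tree:
  assumes tree: "chain_tree T step V E L A"
    and sim: "\<And>b s t \<mu>. R s t \<Longrightarrow> step b s \<mu> \<Longrightarrow>
      \<exists>b' \<mu>'. (b \<longrightarrow> b') \<and> step' b' t \<mu>' \<and> rel_mset (rel_prod (=) R) \<mu> \<mu>'"
    and refl: "\<And>s. s \<in> T \<Longrightarrow> R s s"
    and closed: "\<And>s t. R s t \<Longrightarrow> t \<in> T"
  shows "\<exists>L' A'. chain_tree T step' V E L' A' \<and> leaf_prob V E L' = leaf_prob V E L"
proof -
  obtain v0 where v0: "directed_tree V E v0" "fst (L v0) = 1" using tree by (auto simp: chain_tree_def)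
  obtain d where d: "d v0 = 0" "\<And>u w. (u, w) \<in> E \<Longrightarrow> d w = Suc (d u)"
    by (rule directed_tree_depth[OF v0(1)]) blast
  let ?dist = "\<lambda>u h. image_mset (\<lambda>w. (fst (L w) / fst (L u), h w)) (mset_set (E `` {u}))"
  have "\<exists>b h. u \<in> inner_nodes V E \<longrightarrow> R (snd (L u)) t \<longrightarrow> (u \<in> A \<longrightarrow> b) \<and> step' b t (?dist u h) \<and>
      (\<forall>w\<in>E `` {u}. R (snd (L w)) (h w))" for u t
  proof (cases "u \<in> inner_nodes V E \<and> R (snd (L u)) t")
    case True
    then have "step (u \<in> A) (snd (L u)) (?dist u (\<lambda>w. snd (L w)))" and fin: "finite (E `` {u})"
      using tree by (auto simp: chain_tree_def inner_nodes_def)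
    from sim[OF _ this(1)] True obtain b' \<mu>' where b': "u \<in> A \<longrightarrow> b'" "step' b' t \<mu>'"
      "rel_mset (rel_prod (=) R) (?dist u (\<lambda>w. snd (L w))) \<mu>'" by blast
    from rel_mset_image_mset_set[OF fin b'(3)] obtain h where h: "\<mu>' = image_mset h (mset_set (E `` {u}))"
      "\<forall>w\<in>E `` {u}. rel_prod (=) R (fst (L w) / fst (L u), snd (L w)) (h w)" by blast
    have "\<mu>' = ?dist u (\<lambda>w. snd (h w))"
      unfolding h(1) using h(2) fin by (intro image_mset_cong) (auto simp: rel_prod_sel prod_eq_iff)
    moreover have "\<forall>w\<in>E `` {u}. R (snd (L w)) (snd (h w))" using h(2) by (auto simp: rel_prod_sel)
    ultimately show ?thesis using b'(1,2) by (intro exI[of _ b'] exI[of _ "\<lambda>w. snd (h w)"]) simp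
  qed blast
  then have "\<forall>u t. \<exists>b h. u \<in> inner_nodes V E \<longrightarrow> R (snd (L u)) t \<longrightarrow> (u \<in> A \<longrightarrow> b) \<and>
      step' b t (?dist u h) \<and> (\<forall>w\<in>E `` {u}. R (snd (L w)) (h w))" by blast
  \<comment> \<open>Choice functions: for a node \<open>u\<close> that has received the new term
    \<open>t\<close>, they fix the new flag and the new terms of its children.\<close>
  then obtain B H where "\<forall>u t. u \<in> inner_nodes V E \<longrightarrow> R (snd (L u)) t \<longrightarrow>
      (u \<in> A \<longrightarrow> B u t) \<and> step' (B u t) t (?dist u (H u t)) \<and> (\<forall>w\<in>E `` {u}. R (snd (L w)) (H u t w))"
    by moura
  then have BH: "(u \<in> A \<longrightarrow> B u t) \<and> step' (B u t) t (?dist u (H u t)) \<and>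
      (\<forall>w\<in>E `` {u}. R (snd (L w)) (H u t w))" if "u \<in> inner_nodes V E" "R (snd (L u)) t" for u t
    using that by blast
  \<comment> \<open>New terms are fixed from the root downwards, as \<open>H\<close> needs the new
    term of the parent. The recursion runs on the depth, and \<open>lab n\<close> is meaningful only
    at nodes of depth \<open>n\<close>.\<close>
  define par where "par w = (SOME u. (u, w) \<in> E)" for w
  have par: "par w = u" if "(u, w) \<in> E" for u w
    using someI[of "\<lambda>u. (u, w) \<in> E", OF that] v0(1) that unfolding par_def directed_tree_def by blast
  define lab where "lab = rec_nat (\<lambda>_. snd (L v0)) (\<lambda>_ g w. H (par w) (g (par w)) w)"
  define t where "t w = lab (d w) w" for w
  have t0: "t v0 = snd (L v0)" by (simp add: t_def d lab_def)
  have t_step: "t w = H u (t u) w" if "(u, w) \<in> E" for u w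
    using par[OF that] d(2)[OF that] by (simp add: t_def lab_def)
  have R: "R (snd (L v)) (t v)" if "v \<in> V" for v
  proof -
    have "(v0, v) \<in> E\<^sup>*" using v0(1) that by (auto simp: directed_tree_def)
    then show ?thesis
    proof (induction rule: rtrancl_induct)
      case base
      then show ?case using t0 refl v0 tree by (auto simp: chain_tree_def directed_tree_def)
    next
      case (step y z)
      then have "y \<in> inner_nodes V E" using v0(1) by (auto simp: inner_nodes_def directed_tree_def)
      from BH[OF this step.IH] step.hyps t_step[OF step.hyps(2)] show ?case by auto
    qed
  qed
  define L' where "L' w = (fst (L w), t w)" for w
  define A' where "A' = {u \<in> inner_nodes V E. B u (t u)}"
  have sub: "A \<subseteq> A'"
  proof
    fix u assume "u \<in> A"
    then have u: "u \<in> inner_nodes V E" using tree by (auto simp: chain_tree_def)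
    then have "u \<in> V" by (auto simp: inner_nodes_def)
    with BH[OF u R] u \<open>u \<in> A\<close> show "u \<in> A'" by (auto simp: A'_def)
  qed
  have "chain_tree T step' V E L' A'"
    unfolding chain_tree_def
  proof (intro conjI ballI allI impI)
    show "\<exists>v0. directed_tree V E v0 \<and> fst (L' v0) = 1" using v0 by (auto simp: L'_def)
    show "A' \<subseteq> inner_nodes V E" by (auto simp: A'_def)
    fix u assume u: "u \<in> inner_nodes V E"
    then have uV: "u \<in> V" by (auto simp: inner_nodes_def)
    have "image_mset (\<lambda>w. (fst (L' w) / fst (L' u), snd (L' w))) (mset_set (E `` {u})) = ?dist u (H u (t u))"
    proof (rule image_mset_cong)
      fix w assume "w \<in># mset_set (E `` {u})"
      then have "(u, w) \<in> E" by (cases "finite (E `` {u})") auto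
      from t_step[OF this]
      show "(fst (L' w) / fst (L' u), snd (L' w)) = (fst (L w) / fst (L u), H u (t u) w)"
        by (simp add: L'_def)
    qed
    then show "step' (u \<in> A') (snd (L' u))
        (image_mset (\<lambda>w. (fst (L' w) / fst (L' u), snd (L' w))) (mset_set (E `` {u})))"
      using BH[OF u R[OF uV]] u by (simp add: L'_def A'_def)
  next
    fix x assume "\<forall>i::nat. (x i, x (Suc i)) \<in> E"
    then have "infinite {i. x i \<in> A}" using tree by (auto simp: chain_tree_def)
    moreover have "{i. x i \<in> A} \<subseteq> {i. x i \<in> A'}" using sub by auto
    ultimately show "infinite {i. x i \<in> A'}" using finite_subset by blast
  qed (use tree R closed in \<open>auto simp: chain_tree_def L'_def\<close>)
  moreover have "leaf_prob V E L' = leaf_prob V E L" by (simp add: leaf_prob_def L'_def)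
  ultimately show ?thesis by blast
qed

section \<open>Positions and annotations\<close>

lemma Var_in_terms [simp]: "Var x \<in> terms S"
  by (rule terms.intros)

lemma Fun_in_terms [simp]: "Fun g ts \<in> terms S \<longleftrightarrow> S g = Some (length ts) \<and> (\<forall>t\<in>set ts. t \<in> terms S)"
  by (auto intro: terms.intros elim: terms.cases)

lemma Nil_in_poss [simp]: "[] \<in> poss t"
  by (cases t) auto

lemma Cons_in_poss_Fun [simp]: "i # \<pi> \<in> poss (Fun g ts) \<longleftrightarrow> i < length ts \<and> \<pi> \<in> poss (ts ! i)"
  by auto

lemma poss_append: "\<pi> @ \<tau> \<in> poss t \<longleftrightarrow> \<pi> \<in> poss t \<and> \<tau> \<in> poss (subt_at t \<pi>)"
proof (induction \<pi> arbitrary: t)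
  case (Cons i \<pi>)
  then show ?case by (cases t) (auto simp del: poss.simps(2))
qed simp

lemma subt_at_append: "\<pi> \<in> poss t \<Longrightarrow> subt_at t (\<pi> @ \<tau>) = subt_at (subt_at t \<pi>) \<tau>"
proof (induction \<pi> arbitrary: t)
  case (Cons i \<pi>)
  then show ?case by (cases t) (auto simp del: poss.simps(2))
qed simp

lemma fun_poss_Var [simp]: "fun_poss X (Var x) = {}"
  by (auto simp: fun_poss_def)

lemma Nil_in_fun_poss [simp]: "[] \<in> fun_poss X (Fun g ts) \<longleftrightarrow> g \<in> X"
  by (auto simp: fun_poss_def)

lemma Cons_in_fun_poss [simp]: "i # \<pi> \<in> fun_poss X (Fun g ts) \<longleftrightarrow> i < length ts \<and> \<pi> \<in> fun_poss X (ts ! i)"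
  by (auto simp: fun_poss_def simp del: poss.simps(2))

lemma fun_poss_subset_poss: "fun_poss X t \<subseteq> poss t"
  by (auto simp: fun_poss_def)

lemma fun_poss_append: "\<pi> \<in> poss t \<Longrightarrow> \<pi> @ \<tau> \<in> fun_poss X t \<longleftrightarrow> \<tau> \<in> fun_poss X (subt_at t \<pi>)"
  by (auto simp: fun_poss_def poss_append subt_at_append)

lemma finite_poss [simp]: "finite (poss t)"
  by (induction t) auto

lemma finite_fun_poss [simp]: "finite (fun_poss X t)"
  using finite_subset[OF fun_poss_subset_poss finite_poss] .

lemma finite_sharp_poss [simp]: "finite (sharp_poss t)"
  by (simp add: sharp_poss_def)

lemma Nil_in_sharp_poss [simp]: "[] \<in> sharp_poss (Fun g ts) \<longleftrightarrow> g \<in> range Sharp"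
  by (simp add: sharp_poss_def)

lemma Cons_in_sharp_poss [simp]:
  "i # \<pi> \<in> sharp_poss (Fun g ts) \<longleftrightarrow> i < length ts \<and> \<pi> \<in> sharp_poss (ts ! i)"
  by (simp add: sharp_poss_def)

lemma sharp_poss_Var [simp]: "sharp_poss (Var x) = {}"
  by (simp add: sharp_poss_def)

lemma Nil_in_redex_poss [simp]: "[] \<in> redex_poss D (Fun g ts) \<longleftrightarrow> base g \<in> D"
  by (cases g) (auto simp: redex_poss_def)

lemma Cons_in_redex_poss [simp]:
  "i # \<pi> \<in> redex_poss D (Fun g ts) \<longleftrightarrow> i < length ts \<and> \<pi> \<in> redex_poss D (ts ! i)"
  by (simp add: redex_poss_def)

lemma redex_poss_Var [simp]: "redex_poss D (Var x) = {}"
  by (simp add: redex_poss_def)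

lemma poss_annot [simp]: "poss (annot \<Phi> t) = poss t"
  by (induction \<Phi> t rule: annot.induct) auto

lemma subt_at_annot: "\<pi> \<in> poss t \<Longrightarrow> subt_at (annot \<Phi> t) \<pi> = annot {\<tau>. \<pi> @ \<tau> \<in> \<Phi>} (subt_at t \<pi>)"
proof (induction \<pi> arbitrary: t \<Phi>)
  case (Cons i \<pi>)
  then show ?case by (cases t) (auto simp del: poss.simps(2))
qed simp

lemma mem_redex_poss_annot: "\<pi> \<in> redex_poss D (annot \<Phi> t) \<longleftrightarrow> \<pi> \<in> redex_poss D t"
proof (induction \<pi> arbitrary: t \<Phi>)
  case Nil
  then show ?case by (cases t) auto
next
  case (Cons i \<pi>)
  then show ?case by (cases t) auto
qed

lemma redex_poss_annot [simp]: "redex_poss D (annot \<Phi> t) = redex_poss D t"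
  using mem_redex_poss_annot by blast

lemma redex_poss_flat [simp]: "redex_poss D (flat t) = redex_poss D t"
  by (simp add: flat_def)

text \<open>\<open>annot\<close> ignores variables and positions outside the term, hence the second
  conjunct.\<close>

lemma mem_sharp_poss_annot: "\<pi> \<in> sharp_poss (annot \<Phi> t) \<longleftrightarrow> \<pi> \<in> \<Phi> \<and> \<pi> \<in> fun_poss UNIV t"
proof (induction \<pi> arbitrary: t \<Phi>)
  case Nil
  then show ?case by (cases t) auto
next
  case (Cons i \<pi>)
  then show ?case by (cases t) auto
qed

lemma sharp_poss_annot: "sharp_poss (annot \<Phi> t) = \<Phi> \<inter> fun_poss UNIV t"
  using mem_sharp_poss_annot by blast

lemma sharp_poss_flat [simp]: "sharp_poss (flat t) = {}"
  by (simp add: flat_def sharp_poss_annot)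

lemma sharp_poss_subset: "sharp_poss t \<subseteq> fun_poss UNIV t"
  by (auto simp: sharp_poss_def fun_poss_def)

lemma annot_annot [simp]: "annot \<Phi> (annot \<Psi> t) = annot \<Phi> t"
proof (induction t arbitrary: \<Phi> \<Psi>)
  case (Fun g ts)
  then show ?case by auto
qed simp

lemma annot_flat [simp]: "annot \<Phi> (flat t) = annot \<Phi> t"
  by (simp add: flat_def)

lemma flat_annot [simp]: "flat (annot \<Phi> t) = flat t"
  by (simp add: flat_def)

lemma flat_flat [simp]: "flat (flat t) = flat t"
  by (simp add: flat_def)

lemma flat_flat_above [simp]: "flat (flat_above \<pi> t) = flat t"
  by (simp add: flat_above_def)

lemma flat_Var [simp]: "flat (Var x) = Var x"
  by (simp add: flat_def)

lemma flat_Fun [simp]: "flat (Fun g ts) = Fun (Plain (base g)) (map flat ts)"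
  by (auto simp: flat_def intro!: nth_equalityI)

lemma annot_sharp_poss [simp]: "annot (sharp_poss t) t = t"
proof (induction t)
  case (Fun g ts)
  have "{\<pi>. i # \<pi> \<in> sharp_poss (Fun g ts)} = sharp_poss (ts ! i)" if "i < length ts" for i
    using that by auto
  with Fun show ?case by (cases g) (auto intro!: nth_equalityI)
qed simp

text \<open>Re-annotating the flat term at its sharp positions gives the term back, so symbols and
  annotations can be compared separately.\<close>

lemma aterm_eqI:
  assumes "flat s = flat t" "sharp_poss s = sharp_poss t"
  shows "s = t"
proof -
  have "annot (sharp_poss s) (flat s) = annot (sharp_poss t) (flat t)" using assms by simp
  then show ?thesis by simp
qed

lemma poss_flat [simp]: "poss (flat t) = poss t"
  by (simp add: flat_def)

lemma poss_eqI: "flat s = flat t \<Longrightarrow> poss s = poss t"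
  by (metis poss_flat)

lemma subt_at_flat: "\<pi> \<in> poss t \<Longrightarrow> subt_at (flat t) \<pi> = flat (subt_at t \<pi>)"
  by (simp add: flat_def subt_at_annot)

lemma flat_replace_at: "\<pi> \<in> poss s \<Longrightarrow> flat (replace_at s \<pi> u) = replace_at (flat s) \<pi> (flat u)"
proof (induction \<pi> arbitrary: s)
  case (Cons i \<pi>)
  then show ?case by (cases s) (auto simp: map_update simp del: poss.simps(2))
qed simp

lemma replace_at_subt_at: "\<pi> \<in> poss s \<Longrightarrow> replace_at s \<pi> (subt_at s \<pi>) = s"
proof (induction \<pi> arbitrary: s)
  case (Cons i \<pi>)
  then show ?case by (cases s) (auto simp del: poss.simps(2))
qed simp

lemma mem_fun_poss_replace_at:
  "\<pi> \<in> poss s \<Longrightarrow> \<tau> \<in> fun_poss X (replace_at s \<pi> u) \<longleftrightarrow>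
    (\<tau> \<in> fun_poss X s \<and> \<not> prefix \<pi> \<tau>) \<or> (\<exists>\<rho>\<in>fun_poss X u. \<tau> = \<pi> @ \<rho>)"
proof (induction \<pi> arbitrary: s \<tau>)
  case (Cons i \<pi>)
  then obtain g ts where s: "s = Fun g ts" "i < length ts" "\<pi> \<in> poss (ts ! i)" by (cases s) auto
  show ?case
  proof (cases \<tau>)
    case (Cons k \<tau>')
    then show ?thesis using s Cons.IH[OF s(3)] by (cases "k = i") auto
  qed (use s in auto)
qed simp

lemma fun_poss_replace_at:
  "\<pi> \<in> poss s \<Longrightarrow> fun_poss X (replace_at s \<pi> u) = {\<tau> \<in> fun_poss X s. \<not> prefix \<pi> \<tau>} \<union> (@) \<pi> ` fun_poss X u"
  by (auto simp: mem_fun_poss_replace_at)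

lemma sharp_poss_flat_above: "sharp_poss (flat_above \<pi> t) = {\<tau> \<in> sharp_poss t. \<not> strict_prefix \<tau> \<pi>}"
  using sharp_poss_subset[of t] by (auto simp: flat_above_def sharp_poss_annot)

lemma poss_inst: "\<pi> \<in> poss t \<Longrightarrow> \<pi> \<in> poss (inst t \<sigma>)"
proof (induction \<pi> arbitrary: t)
  case (Cons i \<pi>)
  then show ?case by (cases t) (auto simp del: poss.simps(2))
qed simp

lemma subt_at_inst: "\<pi> \<in> poss t \<Longrightarrow> subt_at (inst t \<sigma>) \<pi> = inst (subt_at t \<pi>) \<sigma>"
proof (induction \<pi> arbitrary: t)
  case (Cons i \<pi>)
  then show ?case by (cases t) (auto simp del: poss.simps(2))
qed simp

lemma mem_fun_poss_inst:
  "\<pi> \<in> fun_poss X (inst t \<sigma>) \<longleftrightarrow> \<pi> \<in> fun_poss X t \<or>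
    (\<exists>\<rho> \<tau> x. \<pi> = \<rho> @ \<tau> \<and> \<rho> \<in> poss t \<and> subt_at t \<rho> = Var x \<and> \<tau> \<in> fun_poss X (\<sigma> x))"
proof (induction \<pi> arbitrary: t)
  case Nil
  then show ?case by (cases t) auto
next
  case (Cons i \<pi>)
  show ?case
  proof (cases t)
    case (Fun g ts)
    show ?thesis
    proof (cases "i < length ts")
      case True
      have "(\<exists>\<rho> \<tau> x. i # \<pi> = \<rho> @ \<tau> \<and> \<rho> \<in> poss t \<and> subt_at t \<rho> = Var x \<and> \<tau> \<in> fun_poss X (\<sigma> x)) \<longleftrightarrow>
        (\<exists>\<rho> \<tau> x. \<pi> = \<rho> @ \<tau> \<and> \<rho> \<in> poss (ts ! i) \<and> subt_at (ts ! i) \<rho> = Var x \<and> \<tau> \<in> fun_poss X (\<sigma> x))"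
        (is "?A \<longleftrightarrow> ?B")
      proof
        assume ?A
        then obtain \<rho> \<tau> x where A: "i # \<pi> = \<rho> @ \<tau>" "\<rho> \<in> poss t" "subt_at t \<rho> = Var x" "\<tau> \<in> fun_poss X (\<sigma> x)"
          by blast
        with Fun obtain \<rho>' where "\<rho> = i # \<rho>'" by (cases \<rho>) auto
        with A Fun show ?B by auto
      next
        assume ?B
        then obtain \<rho> \<tau> x where "\<pi> = \<rho> @ \<tau>" "\<rho> \<in> poss (ts ! i)" "subt_at (ts ! i) \<rho> = Var x"
          "\<tau> \<in> fun_poss X (\<sigma> x)" by blast
        with Fun True show ?A
          by (intro exI[of _ "i # \<rho>"] exI[of _ \<tau>] exI[of _ x]) (auto simp del: poss.simps)
      qed
      with Cons.IH[of "ts ! i"] Fun True show ?thesis by simp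
    next
      case False
      then show ?thesis using Fun by (auto simp: Cons_eq_append_conv)
    qed
  qed (auto)
qed

lemma flat_inst: "flat (inst t \<sigma>) = inst (flat t) (\<lambda>x. flat (\<sigma> x))"
  by (induction t) auto

lemma plain_term_flat: "t \<in> plain_terms F \<Longrightarrow> flat t = t"
proof (induction t)
  case (Fun g ts)
  then show ?case by (cases g) (auto intro: map_idI)
qed simp

lemma plain_term_sharp_poss: "t \<in> plain_terms F \<Longrightarrow> sharp_poss t = {}"
  using sharp_poss_flat[of t] by (simp add: plain_term_flat)

lemma subst_flat: "\<sigma> \<in> substs F \<Longrightarrow> flat (\<sigma> x) = \<sigma> x"
  by (auto simp: substs_def intro: plain_term_flat)

lemma flat_inst_subst: "\<sigma> \<in> substs F \<Longrightarrow> flat (inst t \<sigma>) = inst (flat t) \<sigma>"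
  by (simp add: flat_inst subst_flat)

lemma sharp_poss_inst_subst:
  assumes "\<sigma> \<in> substs F"
  shows "sharp_poss (inst t \<sigma>) = sharp_poss t"
proof -
  have "sharp_poss (\<sigma> x) = {}" for x
    using assms by (intro plain_term_sharp_poss[of _ F]) (simp add: substs_def)
  then show ?thesis by (auto simp: sharp_poss_def mem_fun_poss_inst)
qed

lemma flat_plain_terms: "t \<in> ann_terms F D \<Longrightarrow> flat t \<in> plain_terms F"
proof (induction t)
  case (Fun g ts)
  then show ?case by (cases g) (auto split: if_splits)
qed simp

text \<open>Separates the symbols from their annotations: well-formedness of a reduct then reduces
  to locating its annotations at defined symbols.\<close>

lemma ann_terms_iff:
  "t \<in> ann_terms F D \<longleftrightarrow> flat t \<in> plain_terms F \<and> sharp_poss t \<subseteq> redex_poss D t"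
proof (induction t)
  case (Fun g ts)
  have "sharp_poss (Fun g ts) \<subseteq> redex_poss D (Fun g ts) \<longleftrightarrow>
    (g \<in> range Sharp \<longrightarrow> base g \<in> D) \<and> (\<forall>i<length ts. sharp_poss (ts ! i) \<subseteq> redex_poss D (ts ! i))"
  proof -
    have "sharp_poss (Fun g ts) \<subseteq> redex_poss D (Fun g ts) \<longleftrightarrow>
      (\<forall>\<pi>. \<pi> \<in> sharp_poss (Fun g ts) \<longrightarrow> \<pi> \<in> redex_poss D (Fun g ts))" by auto
    also have "\<dots> \<longleftrightarrow> ([] \<in> sharp_poss (Fun g ts) \<longrightarrow> [] \<in> redex_poss D (Fun g ts)) \<and>
      (\<forall>i \<pi>. i # \<pi> \<in> sharp_poss (Fun g ts) \<longrightarrow> i # \<pi> \<in> redex_poss D (Fun g ts))"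
      by (metis list.exhaust)
    finally show ?thesis by auto
  qed
  with Fun show ?case by (cases g) (auto simp: all_set_conv_all_nth split: if_splits)
qed simp

lemma terms_subt_at: "t \<in> terms S \<Longrightarrow> \<pi> \<in> poss t \<Longrightarrow> subt_at t \<pi> \<in> terms S"
proof (induction \<pi> arbitrary: t)
  case (Cons i \<pi>)
  then show ?case by (cases t) (auto simp del: poss.simps(2))
qed simp

lemma terms_replace_at: "t \<in> terms S \<Longrightarrow> \<pi> \<in> poss t \<Longrightarrow> u \<in> terms S \<Longrightarrow> replace_at t \<pi> u \<in> terms S"
proof (induction \<pi> arbitrary: t)
  case (Cons i \<pi>)
  then show ?case
    by (cases t) (auto simp del: poss.simps(2) dest!: subsetD[OF set_update_subset_insert])
qed simp

lemma terms_inst: "t \<in> terms S \<Longrightarrow> (\<And>x. \<sigma> x \<in> terms S) \<Longrightarrow> inst t \<sigma> \<in> terms S"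
  by (induction t) auto

text \<open>Recovers an enumeration of an original right-hand side from an enumeration of its
  flattened form.\<close>

lemma mset_eq_image_mset_obtain:
  assumes "mset ys = image_mset f M"
  obtains xs where "mset xs = M" "map f xs = ys"
proof -
  have "\<exists>xs. mset xs = M \<and> map f xs = ys"
    using assms
  proof (induction ys arbitrary: M)
    case (Cons y ys)
    then obtain x M' where M: "M = add_mset x M'" "f x = y" "mset ys = image_mset f M'"
      by (metis (no_types, opaque_lifting) mset.simps(2) msed_map_invR)
    from Cons.IH[OF M(3)] obtain xs where "mset xs = M'" "map f xs = ys" by blast
    with M show ?case by (intro exI[of _ "x # xs"]) auto
  qed simp
  then show ?thesis using that by blast
qed

section \<open>Full and innermost steps as instances of one relation\<close>

text \<open>One formula for all cases of rewriting: \<open>b\<close> decides whether the annotations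
  of the right-hand side survive, \<open>m\<close> whether those above the redex do.\<close>

definition outcome :: "bool \<Rightarrow> bool \<Rightarrow> ('f, 'v) aterm \<Rightarrow> pos \<Rightarrow> ('f, 'v) aterm \<Rightarrow> (pos \<Rightarrow> pos option) \<Rightarrow>
    ('f, 'v) aterm \<Rightarrow> ('v \<Rightarrow> ('f, 'v) aterm) \<Rightarrow> ('f, 'v) aterm" where
  "outcome m b s \<pi> l \<phi> r \<sigma> = (if m then id else flat_above \<pi>) (replace_at s \<pi>
     (annot ((if b then sharp_poss r else {}) \<union> Psi l \<phi> (subt_at s \<pi>)) (inst r \<sigma>)))"

text \<open>
  \<open>adm\<close> selects the rewrite strategy. Innermost steps are those with the variable reposition
  function that is constantly \<open>\<bottom>\<close>, so that no annotation below the redex survives.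
\<close>

definition gen_step :: "(bool \<Rightarrow> bool \<Rightarrow> (nat \<Rightarrow> pos \<Rightarrow> pos option) \<Rightarrow> ('f, 'v) aterm \<Rightarrow> bool) \<Rightarrow>
    ('f \<rightharpoonup> nat) \<Rightarrow> ('f, 'v) adp set \<Rightarrow> bool \<Rightarrow> ('f, 'v) aterm \<Rightarrow> ('f, 'v) mdist \<Rightarrow> bool" where
  "gen_step adm F P b s \<mu> \<longleftrightarrow> (\<exists>l prs m \<phi> \<sigma> \<pi>. s \<in> ann_terms F (defined P) \<and> (l, mset prs, m) \<in> P \<and>
     vrf l prs \<phi> \<and> \<sigma> \<in> substs F \<and> \<pi> \<in> redex_poss (defined P) s \<and> flat (subt_at s \<pi>) = inst l \<sigma> \<and>
     (b \<longleftrightarrow> \<pi> \<in> sharp_poss s) \<and> adm m b \<phi> (inst l \<sigma>) \<and>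
     \<mu> = with_terms prs (\<lambda>j. outcome m b s \<pi> l (\<phi> j) (snd (prs ! j)) \<sigma>))"

text \<open>\<open>m \<or> b\<close> excludes exactly the combination that full rewriting lacks,
  flag False at a redex without annotation.\<close>

lemma full_step_eq: "full_step F P = gen_step (\<lambda>m b \<phi> u. m \<or> b) F P"
proof (intro ext iffI)
  fix b s \<mu>
  show "gen_step (\<lambda>m b \<phi> u. m \<or> b) F P b s \<mu>" if "full_step F P b s \<mu>"
    using that
  proof cases
    case (full_at l prs \<phi> \<sigma> \<pi>)
    then show ?thesis unfolding gen_step_def
      by (intro exI[of _ l] exI[of _ prs] exI[of _ True] exI[of _ \<phi>] exI[of _ \<sigma>] exI[of _ \<pi>])
        (auto simp: outcome_def Phi_def)
  next
    case (full_af l prs \<phi> \<sigma> \<pi>)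
    then show ?thesis unfolding gen_step_def
      by (intro exI[of _ l] exI[of _ prs] exI[of _ False] exI[of _ \<phi>] exI[of _ \<sigma>] exI[of _ \<pi>])
        (auto simp: outcome_def Phi_def)
  next
    case (full_nt l prs \<phi> \<sigma> \<pi>)
    then show ?thesis unfolding gen_step_def
      by (intro exI[of _ l] exI[of _ prs] exI[of _ True] exI[of _ \<phi>] exI[of _ \<sigma>] exI[of _ \<pi>])
        (auto simp: outcome_def Phi_def)
  qed
  show "full_step F P b s \<mu>" if "gen_step (\<lambda>m b \<phi> u. m \<or> b) F P b s \<mu>"
  proof -
    from that obtain l prs m \<phi> \<sigma> \<pi> where *: "s \<in> ann_terms F (defined P)" "(l, mset prs, m) \<in> P"
      "vrf l prs \<phi>" "\<sigma> \<in> substs F" "\<pi> \<in> redex_poss (defined P) s" "flat (subt_at s \<pi>) = inst l \<sigma>"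
      "b \<longleftrightarrow> \<pi> \<in> sharp_poss s" "m \<or> b"
      and \<mu>: "\<mu> = with_terms prs (\<lambda>j. outcome m b s \<pi> l (\<phi> j) (snd (prs ! j)) \<sigma>)"
      unfolding gen_step_def by blast
    show ?thesis
    proof (cases m; cases b)
      assume mb: "m" "b"
      show ?thesis using full_at[of s F P l prs \<phi> \<sigma> \<pi>] * mb by (simp add: \<mu> outcome_def Phi_def)
    next
      assume mb: "m" "\<not> b"
      show ?thesis using full_nt[of s F P l prs \<phi> \<sigma> \<pi>] * mb by (simp add: \<mu> outcome_def)
    next
      assume mb: "\<not> m" "b"
      show ?thesis using full_af[of s F P l prs \<phi> \<sigma> \<pi>] * mb by (simp add: \<mu> outcome_def Phi_def)
    qed (use * in simp)
  qed
qed

lemma Psi_None [simp]: "Psi l (\<lambda>_. None) u = {}"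
  by (simp add: Psi_def)

text \<open>Substitutions introduce no annotations. With \<open>Psi\<close> empty,
  \<open>annot\<close> therefore either restores the annotations of \<open>r\<close> or removes them
  all.\<close>

lemma outcome_None:
  assumes "\<sigma> \<in> substs F"
  shows "outcome m b s \<pi> l (\<lambda>_. None) r \<sigma> =
    (if m then id else flat_above \<pi>) (replace_at s \<pi> (inst (if b then r else flat r) \<sigma>))"
  using assms flat_inst_subst[OF assms, of r, symmetric] annot_sharp_poss[of "inst r \<sigma>"]
  by (auto simp: outcome_def sharp_poss_inst_subst flat_def)

lemma innermost_step_eq:
  "innermost_step F P = gen_step (\<lambda>m b \<phi> u. \<phi> = (\<lambda>_ _. None) \<and> u \<in> ANF F P) F P"
proof (intro ext iffI)
  fix b s \<mu>
  have vrf: "vrf l prs (\<lambda>_ _. None)" for l :: "('a, 'b) aterm" and prs by (simp add: vrf_def)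
  show "gen_step (\<lambda>m b \<phi> u. \<phi> = (\<lambda>_ _. None) \<and> u \<in> ANF F P) F P b s \<mu>" if "innermost_step F P b s \<mu>"
    using that
  proof cases
    case (inn_at l prs \<sigma> \<pi>)
    then show ?thesis unfolding gen_step_def
      by (intro exI[of _ l] exI[of _ prs] exI[of _ True] exI[of _ "\<lambda>_ _. None"] exI[of _ \<sigma>] exI[of _ \<pi>])
        (auto simp: outcome_None vrf)
  next
    case (inn_af l prs \<sigma> \<pi>)
    then show ?thesis unfolding gen_step_def
      by (intro exI[of _ l] exI[of _ prs] exI[of _ False] exI[of _ "\<lambda>_ _. None"] exI[of _ \<sigma>] exI[of _ \<pi>])
        (auto simp: outcome_None vrf)
  next
    case (inn_nt l prs \<sigma> \<pi>)
    then show ?thesis unfolding gen_step_def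
      by (intro exI[of _ l] exI[of _ prs] exI[of _ True] exI[of _ "\<lambda>_ _. None"] exI[of _ \<sigma>] exI[of _ \<pi>])
        (auto simp: outcome_None vrf)
  next
    case (inn_nf l prs \<sigma> \<pi>)
    then show ?thesis unfolding gen_step_def
      by (intro exI[of _ l] exI[of _ prs] exI[of _ False] exI[of _ "\<lambda>_ _. None"] exI[of _ \<sigma>] exI[of _ \<pi>])
        (auto simp: outcome_None vrf)
  qed
  show "innermost_step F P b s \<mu>" if "gen_step (\<lambda>m b \<phi> u. \<phi> = (\<lambda>_ _. None) \<and> u \<in> ANF F P) F P b s \<mu>"
  proof -
    from that obtain l prs m \<sigma> \<pi> where *: "s \<in> ann_terms F (defined P)" "(l, mset prs, m) \<in> P"
      "\<sigma> \<in> substs F" "\<pi> \<in> redex_poss (defined P) s" "flat (subt_at s \<pi>) = inst l \<sigma>"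
      "b \<longleftrightarrow> \<pi> \<in> sharp_poss s" "inst l \<sigma> \<in> ANF F P"
      and \<mu>: "\<mu> = with_terms prs (\<lambda>j. outcome m b s \<pi> l (\<lambda>_. None) (snd (prs ! j)) \<sigma>)"
      unfolding gen_step_def by blast
    show ?thesis
    proof (cases m; cases b)
      assume mb: "m" "b"
      show ?thesis using inn_at[of s F P l prs \<sigma> \<pi>] * mb by (simp add: \<mu> outcome_None)
    next
      assume mb: "m" "\<not> b"
      show ?thesis using inn_nt[of s F P l prs \<sigma> \<pi>] * mb by (simp add: \<mu> outcome_None)
    next
      assume mb: "\<not> m" "b"
      show ?thesis using inn_af[of s F P l prs \<sigma> \<pi>] * mb by (simp add: \<mu> outcome_None)
    next
      assume mb: "\<not> m" "\<not> b"
      show ?thesis using inn_nf[of s F P l prs \<sigma> \<pi>] * mb by (simp add: \<mu> outcome_None)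
    qed
  qed
qed

section \<open>Evaluation of polynomial interpretations\<close>

definition monom_value :: "('x \<Rightarrow> 'r) \<Rightarrow> ('x \<Rightarrow>\<^sub>0 nat) \<Rightarrow> 'r::comm_semiring_1" where
  "monom_value a m = (\<Prod>x\<in>Poly_Mapping.keys m. a x ^ Poly_Mapping.lookup m x)"

lemma monom_value_superset:
  assumes "finite S" "Poly_Mapping.keys m \<subseteq> S"
  shows "monom_value a m = (\<Prod>x\<in>S. a x ^ Poly_Mapping.lookup m x)"
  unfolding monom_value_def using assms
  by (intro prod.mono_neutral_left) (auto simp: in_keys_iff)

lemma monom_value_add: "monom_value a (m + m') = monom_value a m * monom_value a m'"
proof -
  let ?S = "Poly_Mapping.keys m \<union> Poly_Mapping.keys m'"
  have "monom_value a (m + m') = (\<Prod>x\<in>?S. a x ^ Poly_Mapping.lookup (m + m') x)"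
    by (intro monom_value_superset) (auto simp: Poly_Mapping.keys_add)
  also have "\<dots> = (\<Prod>x\<in>?S. a x ^ Poly_Mapping.lookup m x) * (\<Prod>x\<in>?S. a x ^ Poly_Mapping.lookup m' x)"
    by (simp add: lookup_add power_add prod.distrib)
  also have "\<dots> = monom_value a m * monom_value a m'"
    by (simp add: monom_value_superset[of ?S])
  finally show ?thesis .
qed

lemma psubst_superset:
  assumes "finite S" "Poly_Mapping.keys p \<subseteq> S"
  shows "psubst p a = (\<Sum>m\<in>S. of_nat (Poly_Mapping.lookup p m) * monom_value a m)"
  unfolding psubst_def monom_value_def[symmetric] using assms
  by (intro sum.mono_neutral_left) (auto simp: in_keys_iff)

lemma psubst_0 [simp]: "psubst 0 a = 0"
  by (simp add: psubst_def)

lemma psubst_single: "psubst (Poly_Mapping.single m c) a = of_nat c * monom_value a m"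
  by (subst psubst_superset[of "{m}"]) auto

lemma psubst_add: "psubst (p + q) a = psubst p a + psubst q a"
proof -
  let ?S = "Poly_Mapping.keys p \<union> Poly_Mapping.keys q"
  have "psubst (p + q) a = (\<Sum>m\<in>?S. of_nat (Poly_Mapping.lookup (p + q) m) * monom_value a m)"
    by (intro psubst_superset) (auto simp: Poly_Mapping.keys_add)
  then show ?thesis
    by (simp add: psubst_superset[of ?S] lookup_add distrib_right sum.distrib)
qed

lemma psubst_sum: "psubst (\<Sum>i\<in>A. f i) a = (\<Sum>i\<in>A. psubst (f i) a)"
  by (induction A rule: infinite_finite_induct) (auto simp: psubst_add)

lemma sum_monomials: "p = (\<Sum>m\<in>Poly_Mapping.keys p. Poly_Mapping.single m (Poly_Mapping.lookup p m))"
  by (rule poly_mapping_eqI) (auto simp: lookup_sum lookup_single when_def in_keys_iff)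

lemma psubst_mult: "psubst (p * q) a = psubst p a * psubst q a"
proof -
  have "psubst (p * q) a = psubst ((\<Sum>m\<in>Poly_Mapping.keys p. Poly_Mapping.single m (Poly_Mapping.lookup p m)) *
      (\<Sum>m\<in>Poly_Mapping.keys q. Poly_Mapping.single m (Poly_Mapping.lookup q m))) a"
    by (subst (1 2) sum_monomials[symmetric]) simp
  also have "\<dots> = psubst p a * psubst q a"
    by (simp add: psubst_def[of p] psubst_def[of q] monom_value_def[symmetric] sum_product psubst_sum
        mult_single psubst_single monom_value_add algebra_simps)
  finally show ?thesis .
qed

lemma psubst_of_nat: "psubst (of_nat n) a = of_nat n"
proof -
  have "psubst (Poly_Mapping.single 0 1) a = 1" unfolding psubst_single by (simp add: monom_value_def)
  then have "psubst 1 a = 1" by (simp only: single_one)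
  then show ?thesis by (induction n) (auto simp: psubst_add)
qed

lemma psubst_power: "psubst (p ^ n) a = psubst p a ^ n"
  using psubst_of_nat[of 1 a] by (induction n) (auto simp: psubst_mult)

lemma psubst_prod: "psubst (\<Prod>i\<in>A. f i) a = (\<Prod>i\<in>A. psubst (f i) a)"
  using psubst_of_nat[of 1 a] by (induction A rule: infinite_finite_induct) (auto simp: psubst_mult)

text \<open>\<open>psubst\<close> preserves sums, products and constants, so it commutes with
  composition; this links \<open>pol\<close> to direct evaluation.\<close>

lemma psubst_psubst: "psubst (psubst p b) a = psubst p (\<lambda>i. psubst (b i) a)"
  unfolding psubst_def[of p] by (simp add: psubst_sum psubst_mult psubst_of_nat psubst_prod psubst_power)

lemma psubst_indet [simp]: "psubst (indet x) a = a x"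
  by (simp add: indet_def psubst_single monom_value_def)

lemma psubst_cong_keys:
  assumes "\<And>m x. m \<in> Poly_Mapping.keys p \<Longrightarrow> x \<in> Poly_Mapping.keys m \<Longrightarrow> a x = b x"
  shows "psubst p a = psubst p b"
  unfolding psubst_def using assms by (auto intro!: sum.cong prod.cong)

text \<open>Each monomial has exponent 0 or 1 at \<open>i\<close> and so is constant or linear in
  \<open>y\<close>; the coefficients add up to \<alpha> and \<beta>.\<close>

lemma psubst_multilinear_affine:
  fixes v :: "'x \<Rightarrow> 'r::comm_semiring_1"
  assumes "\<And>m. m \<in> Poly_Mapping.keys p \<Longrightarrow> Poly_Mapping.lookup m i \<in> {0, 1}"
  shows "\<exists>\<alpha> \<beta>. \<forall>y. psubst p (v(i := y)) = \<alpha> + \<beta> * y"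
proof -
  let ?c = "\<lambda>m. of_nat (Poly_Mapping.lookup p m) :: 'r"
  have "\<exists>\<alpha> \<beta>. \<forall>y. ?c m * monom_value (v(i := y)) m = \<alpha> + \<beta> * y" if m: "m \<in> Poly_Mapping.keys p" for m
  proof (cases "i \<in> Poly_Mapping.keys m")
    case True
    then have "Poly_Mapping.lookup m i = 1" using assms[OF m] by (auto simp: in_keys_iff)
    then have "monom_value (v(i := y)) m
        = y * (\<Prod>x\<in>Poly_Mapping.keys m - {i}. v x ^ Poly_Mapping.lookup m x)" for y
      unfolding monom_value_def using True by (subst prod.remove[of _ i]) auto
    then have "\<forall>y. ?c m * monom_value (v(i := y)) m
        = 0 + (?c m * (\<Prod>x\<in>Poly_Mapping.keys m - {i}. v x ^ Poly_Mapping.lookup m x)) * y"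
      by (simp add: algebra_simps)
    then show ?thesis by blast
  next
    case False
    then have "monom_value (v(i := y)) m = monom_value v m" for y
      unfolding monom_value_def by (intro prod.cong) auto
    then have "\<forall>y. ?c m * monom_value (v(i := y)) m = ?c m * monom_value v m + 0 * y" by simp
    then show ?thesis by blast
  qed
  then obtain \<alpha> \<beta> where ab: "\<And>m y. m \<in> Poly_Mapping.keys p \<Longrightarrow>
      ?c m * monom_value (v(i := y)) m = \<alpha> m + \<beta> m * y" by metis
  have "psubst p (v(i := y)) = sum \<alpha> (Poly_Mapping.keys p) + sum \<beta> (Poly_Mapping.keys p) * y" for y
    unfolding psubst_def monom_value_def[symmetric]
    by (simp add: ab sum.distrib sum_distrib_right del: fun_upd_apply)
  then show ?thesis by blast
qed

section \<open>Values of terms and weights of annotated terms under contexts\<close>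

primrec ev :: "('g \<Rightarrow> nat npoly) \<Rightarrow> ('v \<Rightarrow> nat) \<Rightarrow> ('g, 'v) trm \<Rightarrow> nat" where
  "ev I a (Var x) = a x"
| "ev I a (Fun g ts) = psubst (I g) (\<lambda>i. if i < length ts then map (ev I a) ts ! i else 0)"

text \<open>Absorbs the matching substitution into the assignment, so that the conditions on a rule
  apply to its instances.\<close>

lemma ev_inst: "ev I a (inst t \<sigma>) = ev I (\<lambda>x. ev I a (\<sigma> x)) t"
proof (induction t)
  case (Fun g ts)
  then have "(\<lambda>i. if i < length ts then ev I a (inst (ts ! i) \<sigma>) else 0)
    = (\<lambda>i. if i < length ts then ev I (\<lambda>x. ev I a (\<sigma> x)) (ts ! i) else 0)" by auto
  then show ?case by (simp cong: if_cong)
qed simp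

text \<open>The indeterminates of \<open>I g\<close> lie below the arity, so neither the default 0
  of \<open>ev\<close> nor the unspecified value of \<open>!\<close> beyond the list is
  read.\<close>

lemma psubst_pol:
  assumes "poly_interpretation S I" "t \<in> terms S"
  shows "psubst (pol I t) a = ev I a t"
  using assms(2)
proof (induction t rule: trm.induct)
  case (Fun g ts)
  then have "S g = Some (length ts)" by simp
  then have "\<forall>m\<in>Poly_Mapping.keys (I g). Poly_Mapping.keys m \<subseteq> {..<length ts}"
    using assms(1) unfolding poly_interpretation_def by blast
  moreover have "psubst (pol I (ts ! i)) a = ev I a (ts ! i)" if "i < length ts" for i
    using Fun that by auto
  ultimately have "psubst (I g) (\<lambda>i. psubst (map (pol I) ts ! i) a) =
      psubst (I g) (\<lambda>i. if i < length ts then map (ev I a) ts ! i else 0)"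
    by (intro psubst_cong_keys) fastforce
  then show ?case by (simp add: psubst_psubst)
qed simp

text \<open>Owing to the default 0 in \<open>ev\<close>, a list update becomes a function update of
  the argument values at every index, so affinity in one indeterminate applies.\<close>

lemma ev_list_update_affine:
  assumes "multilinear S I" "g \<in> dom S" "i < length ts"
  shows "\<exists>\<alpha> \<beta>. \<forall>u. ev I a (Fun g (ts[i := u])) = \<alpha> + \<beta> * ev I a u"
proof -
  let ?v = "\<lambda>k. if k < length ts then ev I a (ts ! k) else 0"
  obtain \<alpha> \<beta> where ab: "\<forall>y. psubst (I g) (?v(i := y)) = \<alpha> + \<beta> * y"
    using psubst_multilinear_affine[of "I g" i ?v] assms(1,2) by (auto simp: multilinear_def)
  have "ev I a (Fun g (ts[i := u])) = psubst (I g) (?v(i := ev I a u))" for u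
    using assms(3) by (auto simp: nth_list_update intro!: arg_cong[of _ _ "psubst (I g)"])
  with ab show ?thesis by auto
qed

text \<open>Affine maps compose along the path to the hole. Their coefficients are natural numbers,
  so inequalities pass through the context.\<close>

lemma ev_replace_at_affine:
  assumes "multilinear S I"
  shows "s \<in> terms S \<Longrightarrow> \<pi> \<in> poss s \<Longrightarrow> \<exists>\<alpha> \<beta>. \<forall>u. ev I a (replace_at s \<pi> u) = \<alpha> + \<beta> * ev I a u"
proof (induction \<pi> arbitrary: s)
  case Nil
  have "\<forall>u. ev I a (replace_at s [] u) = 0 + 1 * ev I a u" by simp
  then show ?case by blast
next
  case (Cons i \<pi>)
  then obtain g ts where s: "s = Fun g ts" "i < length ts" "\<pi> \<in> poss (ts ! i)" by (cases s) auto
  with Cons.prems have "g \<in> dom S" "ts ! i \<in> terms S" by auto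
  from ev_list_update_affine[OF assms this(1) s(2), of a] obtain \<alpha> \<beta>
    where 1: "\<forall>u. ev I a (Fun g (ts[i := u])) = \<alpha> + \<beta> * ev I a u" by blast
  from Cons.IH[OF \<open>ts ! i \<in> terms S\<close> s(3)] obtain \<alpha>' \<beta>'
    where 2: "\<forall>u. ev I a (replace_at (ts ! i) \<pi> u) = \<alpha>' + \<beta>' * ev I a u" by blast
  have "\<forall>u. ev I a (replace_at s (i # \<pi>) u) = (\<alpha> + \<beta> * \<alpha>') + (\<beta> * \<beta>') * ev I a u"
    using 1 2 s(1) by (simp del: ev.simps add: algebra_simps)
  then show ?case by blast
qed

text \<open>The value of \<open>ann_sum\<close> at \<open>a\<close> (see
  \<open>psubst_ann_sum\<close>); it serves as the ranking function on terms.\<close>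

definition weight :: "('f asym \<Rightarrow> nat npoly) \<Rightarrow> ('v \<Rightarrow> nat) \<Rightarrow> ('f, 'v) aterm \<Rightarrow> nat" where
  "weight I a t = (\<Sum>\<pi>\<in>sharp_poss t. ev I a (sharp (flat (subt_at t \<pi>))))"

lemma weight_Fun:
  "weight I a (Fun g ts) = (if g \<in> range Sharp then ev I a (Fun (Sharp (base g)) (map flat ts)) else 0) +
     (\<Sum>i<length ts. weight I a (ts ! i))"
proof -
  let ?h = "\<lambda>\<pi>. ev I a (sharp (flat (subt_at (Fun g ts) \<pi>)))"
  let ?A = "if g \<in> range Sharp then {[]} else {} :: pos set"
  let ?B = "\<Union>i<length ts. (#) i ` sharp_poss (ts ! i)"
  have "\<pi> \<in> sharp_poss (Fun g ts) \<longleftrightarrow> \<pi> \<in> ?A \<union> ?B" for \<pi> by (cases \<pi>) auto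
  then have eq: "sharp_poss (Fun g ts) = ?A \<union> ?B" by blast
  have "weight I a (Fun g ts) = sum ?h ?A + sum ?h ?B"
    unfolding weight_def eq by (rule sum.union_disjoint) auto
  also have "sum ?h ?B = (\<Sum>i<length ts. sum ?h ((#) i ` sharp_poss (ts ! i)))"
    by (rule sum.UNION_disjoint) auto
  also have "\<dots> = (\<Sum>i<length ts. weight I a (ts ! i))"
    unfolding weight_def by (rule sum.cong[OF refl], subst sum.reindex) (auto simp: comp_def)
  finally show ?thesis by simp
qed

lemma sum_nth_list_update:
  fixes f :: "'a \<Rightarrow> nat"
  assumes "i < length xs"
  shows "(\<Sum>k<length xs. f (xs[i := x] ! k)) = (\<Sum>k\<in>{..<length xs} - {i}. f (xs ! k)) + f x"
  using assms by (subst sum.remove[of _ i]) auto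

text \<open>Annotations at ancestors of the hole have values affine in the value of
  \<open>u\<close>, those at parallel positions are constant, and those inside \<open>u\<close> make
  up its own weight.\<close>

lemma weight_replace_at:
  assumes "multilinear (asig F D) I"
  shows "s \<in> ann_terms F D \<Longrightarrow> \<pi> \<in> poss s \<Longrightarrow>
    \<exists>\<alpha> \<beta>. \<forall>u. weight I a (replace_at s \<pi> u) = \<alpha> + \<beta> * ev I a (flat u) + weight I a u"
proof (induction \<pi> arbitrary: s)
  case Nil
  have "\<forall>u. weight I a (replace_at s [] u) = 0 + 0 * ev I a (flat u) + weight I a u" by simp
  then show ?case by blast
next
  case (Cons i \<pi>)
  then obtain g ts where s: "s = Fun g ts" "i < length ts" "\<pi> \<in> poss (ts ! i)" by (cases s) auto
  with Cons.prems have g: "g \<in> dom (asig F D)" and tsi: "ts ! i \<in> ann_terms F D" by auto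
  from Cons.IH[OF tsi s(3)] obtain \<alpha> \<beta>
    where 1: "\<forall>u. weight I a (replace_at (ts ! i) \<pi> u) = \<alpha> + \<beta> * ev I a (flat u) + weight I a u"
    by (elim exE) (rule that)
  have "flat (ts ! i) \<in> ann_terms F D"
    using flat_plain_terms[OF tsi] ann_terms_iff[of "flat (ts ! i)" F D] by simp
  from ev_replace_at_affine[OF assms this, of \<pi> a] s(3) obtain \<alpha>1 \<beta>1
    where 2: "\<forall>u. ev I a (replace_at (flat (ts ! i)) \<pi> u) = \<alpha>1 + \<beta>1 * ev I a u" by auto
  \<comment> \<open>The contribution of the root, which is an ancestor of the hole.\<close>
  have "\<exists>\<alpha>2 \<beta>2. \<forall>u. (if g \<in> range Sharp then ev I a (Fun (Sharp (base g)) ((map flat ts)[i := u])) else 0)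
      = \<alpha>2 + \<beta>2 * ev I a u"
  proof (cases "g \<in> range Sharp")
    case True
    then have "Sharp (base g) \<in> dom (asig F D)" using g by auto
    from ev_list_update_affine[OF assms this, of i "map flat ts" a] True s(2) show ?thesis by simp
  next
    case False
    then show ?thesis by (intro exI[of _ 0]) simp
  qed
  then obtain \<alpha>2 \<beta>2 where 3: "\<forall>u. (if g \<in> range Sharp
      then ev I a (Fun (Sharp (base g)) ((map flat ts)[i := u])) else 0) = \<alpha>2 + \<beta>2 * ev I a u"
    by (elim exE) (rule that)
  let ?R = "\<Sum>k\<in>{..<length ts} - {i}. weight I a (ts ! k)"
  have "weight I a (replace_at s (i # \<pi>) u) =
    (\<alpha>2 + \<beta>2 * \<alpha>1 + ?R + \<alpha>) + (\<beta>2 * \<beta>1 + \<beta>) * ev I a (flat u) + weight I a u" for u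
  proof -
    have "weight I a (replace_at s (i # \<pi>) u) =
      (if g \<in> range Sharp then ev I a (Fun (Sharp (base g))
        ((map flat ts)[i := replace_at (flat (ts ! i)) \<pi> (flat u)])) else 0) +
      (\<Sum>k<length ts. weight I a (ts[i := replace_at (ts ! i) \<pi> u] ! k))"
      using s by (simp add: weight_Fun map_update flat_replace_at del: ev.simps)
    also have "\<dots> = \<alpha>2 + \<beta>2 * (\<alpha>1 + \<beta>1 * ev I a (flat u)) + (?R + (\<alpha> + \<beta> * ev I a (flat u) + weight I a u))"
      by (simp only: 3[rule_format] 2[rule_format] sum_nth_list_update[OF s(2)] 1[rule_format])
    finally show ?thesis by (simp add: algebra_simps)
  qed
  then show ?case by blast
qed

lemma flat_above_Cons:
  assumes "i < length ts"
  shows "flat_above (i # \<pi>) (Fun g ts) = Fun (Plain (base g)) (ts[i := flat_above \<pi> (ts ! i)])"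
proof (rule aterm_eqI)
  show "flat (flat_above (i # \<pi>) (Fun g ts)) = flat (Fun (Plain (base g)) (ts[i := flat_above \<pi> (ts ! i)]))"
    using assms by (simp add: map_update) (metis list_update_id nth_map)
  have "\<tau> \<in> sharp_poss (flat_above (i # \<pi>) (Fun g ts)) \<longleftrightarrow>
    \<tau> \<in> sharp_poss (Fun (Plain (base g)) (ts[i := flat_above \<pi> (ts ! i)]))" for \<tau>
  proof (cases \<tau>)
    case (Cons k \<tau>')
    then show ?thesis using assms
      by (cases "k = i") (auto simp: sharp_poss_flat_above strict_prefix_def)
  qed (auto simp: sharp_poss_flat_above strict_prefix_def)
  then show "sharp_poss (flat_above (i # \<pi>) (Fun g ts)) =
      sharp_poss (Fun (Plain (base g)) (ts[i := flat_above \<pi> (ts ! i)]))" by blast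
qed

lemma flat_above_Nil [simp]: "flat_above [] t = t"
  by (simp add: flat_above_def)

text \<open>With the ancestors stripped, the context contributes only parallel annotations, whose
  values are constant. The inequality with the same \<alpha> later bounds the weight before the
  step.\<close>

lemma weight_flat_above_replace_at:
  "\<pi> \<in> poss s \<Longrightarrow> \<exists>\<alpha>. \<forall>u. weight I a (flat_above \<pi> (replace_at s \<pi> u)) = \<alpha> + weight I a u \<and>
    \<alpha> + weight I a u \<le> weight I a (replace_at s \<pi> u)"
proof (induction \<pi> arbitrary: s)
  case Nil
  then show ?case by (intro exI[of _ 0]) simp
next
  case (Cons i \<pi>)
  then obtain g ts where s: "s = Fun g ts" "i < length ts" "\<pi> \<in> poss (ts ! i)" by (cases s) auto
  from Cons.IH[OF s(3)] obtain \<alpha> where 1: "\<And>u. weight I a (flat_above \<pi> (replace_at (ts ! i) \<pi> u)) = \<alpha> + weight I a u"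
    "\<And>u. \<alpha> + weight I a u \<le> weight I a (replace_at (ts ! i) \<pi> u)" by blast
  let ?R = "\<Sum>k\<in>{..<length ts} - {i}. weight I a (ts ! k)"
  have "weight I a (flat_above (i # \<pi>) (replace_at s (i # \<pi>) u)) = (?R + \<alpha>) + weight I a u" for u
  proof -
    have "weight I a (flat_above (i # \<pi>) (replace_at s (i # \<pi>) u)) =
        (\<Sum>k<length ts. weight I a (ts[i := flat_above \<pi> (replace_at (ts ! i) \<pi> u)] ! k))"
      using s by (auto simp add: flat_above_Cons weight_Fun simp del: ev.simps)
    then show ?thesis by (simp only: sum_nth_list_update[OF s(2)] 1 add.assoc)
  qed
  moreover have "(?R + \<alpha>) + weight I a u \<le> weight I a (replace_at s (i # \<pi>) u)" for u
  proof -
    have "(\<Sum>k<length ts. weight I a (ts[i := replace_at (ts ! i) \<pi> u] ! k)) \<le> weight I a (replace_at s (i # \<pi>) u)"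
      using s by (simp add: weight_Fun del: ev.simps)
    then show ?thesis using 1(2)[of u] by (simp only: sum_nth_list_update[OF s(2)])
  qed
  ultimately show ?case by blast
qed

section \<open>The weight of a reduct\<close>

lemma var_poss_append_eq:
  assumes "\<rho> \<in> var_poss l" "\<rho>' \<in> var_poss l" "\<rho> @ \<tau> = \<rho>' @ \<tau>'"
  shows "\<rho> = \<rho>'"
proof -
  have leaf: "\<kappa> = []" if "\<rho> \<in> var_poss l" "\<rho> @ \<kappa> \<in> var_poss l" for \<rho> \<kappa>
    using that by (auto simp: var_poss_def poss_append)
  from assms(3) consider \<kappa> where "\<rho>' = \<rho> @ \<kappa>" | \<kappa> where "\<rho> = \<rho>' @ \<kappa>"
    by (auto simp: append_eq_append_conv2)
  then show ?thesis using leaf assms(1,2) by cases auto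
qed

text \<open>
  The sum over \<open>sharp_poss s - {[]}\<close> pays for the annotations moved by the variable reposition
  function: a moved annotation at \<open>\<phi>(\<rho>).\<tau>\<close> is charged to \<open>\<rho>.\<tau>\<close>, and this charging is injective
  because distinct variable positions of \<open>l\<close> are incomparable.
\<close>

lemma weight_annot_inst:
  assumes \<sigma>: "\<sigma> \<in> substs F" and l: "l \<notin> range Var" and s: "flat s = inst l \<sigma>"
    and \<phi>: "\<And>\<rho> \<rho>'. \<rho> \<in> var_poss l \<Longrightarrow> \<phi> \<rho> = Some \<rho>' \<Longrightarrow> \<rho>' \<in> var_poss r \<and> subt_at l \<rho> = subt_at r \<rho>'"
  shows "weight I a (annot ((if b then sharp_poss r else {}) \<union> Psi l \<phi> s) (inst r \<sigma>)) \<le>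
    (if b then weight I (\<lambda>x. ev I a (\<sigma> x)) r else 0) +
    (\<Sum>\<tau>\<in>sharp_poss s - {[]}. ev I a (sharp (flat (subt_at s \<tau>))))"
proof -
  let ?A = "if b then sharp_poss r else {}"
  let ?u = "annot (?A \<union> Psi l \<phi> s) (inst r \<sigma>)"
  define h where "h \<tau> = ev I a (sharp (flat (subt_at (inst r \<sigma>) \<tau>)))" for \<tau>
  \<comment> \<open>The intersection makes the set finite. A position in both \<open>?A\<close> and
    \<open>B\<close> is counted twice below, which is harmless for an upper bound.\<close>
  define B where "B = Psi l \<phi> s \<inter> sharp_poss ?u"
  have finB: "finite B" by (simp add: B_def)
  have u_poss: "sharp_poss ?u \<subseteq> poss (inst r \<sigma>)"
    using fun_poss_subset_poss[of UNIV "inst r \<sigma>"] by (auto simp: sharp_poss_annot)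
  have "weight I a ?u = (\<Sum>\<tau>\<in>sharp_poss ?u. h \<tau>)"
    unfolding weight_def h_def using u_poss by (intro sum.cong refl) (auto simp: subt_at_annot)
  also have "\<dots> \<le> (\<Sum>\<tau>\<in>?A \<union> B. h \<tau>)"
    using finB by (intro sum_mono2) (auto simp: B_def sharp_poss_annot)
  also have "\<dots> \<le> (\<Sum>\<tau>\<in>?A. h \<tau>) + (\<Sum>\<tau>\<in>B. h \<tau>)"
    using sum.union_inter[of ?A B h] finB by auto
  also have "(\<Sum>\<tau>\<in>?A. h \<tau>) = (if b then weight I (\<lambda>x. ev I a (\<sigma> x)) r else 0)"
  proof (cases b)
    case True
    have "h \<tau> = ev I (\<lambda>x. ev I a (\<sigma> x)) (sharp (flat (subt_at r \<tau>)))" if "\<tau> \<in> sharp_poss r" for \<tau>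
    proof -
      from that obtain g ts where \<tau>: "\<tau> \<in> poss r" "subt_at r \<tau> = Fun g ts"
        by (auto simp: sharp_poss_def fun_poss_def)
      then have "sharp (flat (subt_at (inst r \<sigma>) \<tau>)) = inst (sharp (flat (subt_at r \<tau>))) \<sigma>"
        using \<sigma> by (simp add: subt_at_inst flat_inst_subst)
      then show ?thesis by (simp only: h_def ev_inst)
    qed
    with True show ?thesis by (simp add: weight_def)
  qed simp
  also have "(\<Sum>\<tau>\<in>B. h \<tau>) \<le> (\<Sum>\<tau>\<in>sharp_poss s - {[]}. ev I a (sharp (flat (subt_at s \<tau>))))"
  proof -
    have "\<forall>\<tau>. \<exists>\<rho> \<rho>' \<kappa>. \<tau> \<in> B \<longrightarrow>
        \<tau> = \<rho>' @ \<kappa> \<and> \<rho> \<in> var_poss l \<and> \<phi> \<rho> = Some \<rho>' \<and> \<rho> @ \<kappa> \<in> sharp_poss s"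
      by (auto simp: B_def Psi_def)
    then obtain R R' K where "\<forall>\<tau>. \<tau> \<in> B \<longrightarrow> \<tau> = R' \<tau> @ K \<tau> \<and> R \<tau> \<in> var_poss l \<and>
        \<phi> (R \<tau>) = Some (R' \<tau>) \<and> R \<tau> @ K \<tau> \<in> sharp_poss s"
      unfolding choice_iff by blast
    then have RK: "\<And>\<tau>. \<tau> \<in> B \<Longrightarrow> R \<tau> \<in> var_poss l"
      "\<And>\<tau>. \<tau> \<in> B \<Longrightarrow> \<phi> (R \<tau>) = Some (R' \<tau>)" "\<And>\<tau>. \<tau> \<in> B \<Longrightarrow> R \<tau> @ K \<tau> \<in> sharp_poss s"
      and RK_eq: "\<And>\<tau>. \<tau> \<in> B \<Longrightarrow> \<tau> = R' \<tau> @ K \<tau>"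
      by blast+
    have inj: "inj_on (\<lambda>\<tau>. R \<tau> @ K \<tau>) B"
    proof (rule inj_onI)
      fix \<tau> \<tau>' assume *: "\<tau> \<in> B" "\<tau>' \<in> B" "R \<tau> @ K \<tau> = R \<tau>' @ K \<tau>'"
      have "R \<tau> = R \<tau>'" by (rule var_poss_append_eq[OF RK(1) RK(1) *(3)]) fact+
      moreover from this have "K \<tau> = K \<tau>'" using *(3) by simp
      ultimately have "R' \<tau> @ K \<tau> = R' \<tau>' @ K \<tau>'" using RK(2)[OF *(1)] RK(2)[OF *(2)] by simp
      then show "\<tau> = \<tau>'" unfolding RK_eq[OF *(1), symmetric] RK_eq[OF *(2), symmetric] .
    qed
    \<comment> \<open>Both positions point to the same place inside the same
      \<open>\<sigma> x\<close>.\<close>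
    have val: "h \<tau> = ev I a (sharp (flat (subt_at s (R \<tau> @ K \<tau>))))" if "\<tau> \<in> B" for \<tau>
    proof -
      note \<tau> = RK[OF that] and \<tau>_eq = RK_eq[OF that]
      have l_poss: "R \<tau> \<in> poss l" using \<tau> by (auto simp: var_poss_def)
      obtain x where x: "subt_at l (R \<tau>) = Var x" using \<tau> by (auto simp: var_poss_def)
      have r: "R' \<tau> \<in> poss r" "subt_at r (R' \<tau>) = Var x"
        using \<phi>[of "R \<tau>" "R' \<tau>"] \<tau> x by (auto simp: var_poss_def)
      have "R \<tau> @ K \<tau> \<in> poss s" using \<tau> by (auto simp: sharp_poss_def fun_poss_def)
      then have "flat (subt_at s (R \<tau> @ K \<tau>)) = subt_at (inst l \<sigma>) (R \<tau> @ K \<tau>)"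
        by (simp add: subt_at_flat[symmetric] s)
      also have "\<dots> = subt_at (\<sigma> x) (K \<tau>)"
        using l_poss x by (simp add: subt_at_append poss_inst subt_at_inst)
      also have "\<dots> = subt_at (inst r \<sigma>) \<tau>"
        by (subst \<tau>_eq) (simp add: subt_at_append poss_inst subt_at_inst r)
      finally have "subt_at (inst r \<sigma>) \<tau> = flat (subt_at s (R \<tau> @ K \<tau>))" by simp
      then show ?thesis by (simp add: h_def)
    qed
    \<comment> \<open>\<open>l\<close> is not a variable, so no charge falls on the root annotation
      of the redex, which is reserved for \<open>sharp l\<close>.\<close>
    have nonempty: "R \<tau> @ K \<tau> \<noteq> []" if "\<tau> \<in> B" for \<tau>
      using RK[OF that] l by (auto simp: var_poss_def)
    have "(\<Sum>\<tau>\<in>B. h \<tau>) = (\<Sum>\<tau>\<in>(\<lambda>\<tau>. R \<tau> @ K \<tau>) ` B. ev I a (sharp (flat (subt_at s \<tau>))))"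
      unfolding sum.reindex[OF inj] comp_def using val by (intro sum.cong) auto
    also have "\<dots> \<le> (\<Sum>\<tau>\<in>sharp_poss s - {[]}. ev I a (sharp (flat (subt_at s \<tau>))))"
      using RK nonempty by (intro sum_mono2) auto
    finally show ?thesis .
  qed
  finally show ?thesis by simp
qed

text \<open>
  \<open>\<alpha>\<close> and \<open>\<beta>\<close> come from the context of the redex, in whose hole multilinear interpretations are
  affine. An ADP with flag \<open>False\<close> has \<open>\<beta> = 0\<close> because it removes all annotations above the redex,
  and these are the only ones whose value depends on the contractum.
\<close>

lemma outcome_weight:
  fixes I :: "'f asym \<Rightarrow> nat npoly" and a :: "'v \<Rightarrow> nat" and \<sigma> :: "'v \<Rightarrow> ('f, 'v) aterm"
  assumes I: "multilinear (asig F D) I" and s: "s \<in> ann_terms F D" "\<pi> \<in> poss s"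
    and \<sigma>: "\<sigma> \<in> substs F" and l: "l \<notin> range Var" "l \<in> plain_terms F"
    and redex: "flat (subt_at s \<pi>) = inst l \<sigma>"
    and b: "b \<longleftrightarrow> \<pi> \<in> sharp_poss s"
  defines "e \<equiv> \<lambda>x. ev I a (\<sigma> x)"
  shows "\<exists>\<alpha> \<beta>. (\<not> m \<longrightarrow> \<beta> = 0) \<and>
    \<alpha> + \<beta> * ev I e l + (if b then ev I e (sharp l) else 0) \<le> weight I a s \<and>
    (\<forall>r \<phi>. (\<forall>\<rho>\<in>var_poss l. \<forall>\<rho>'. \<phi> \<rho> = Some \<rho>' \<longrightarrow> \<rho>' \<in> var_poss r \<and> subt_at l \<rho> = subt_at r \<rho>') \<longrightarrow>
      weight I a (outcome m b s \<pi> l \<phi> r \<sigma>) \<le> \<alpha> + \<beta> * ev I e (flat r) + (if b then weight I e r else 0))"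
proof -
  let ?s = "subt_at s \<pi>"
  let ?R = "\<Sum>\<tau>\<in>sharp_poss ?s - {[]}. ev I a (sharp (flat (subt_at ?s \<tau>)))"
  \<comment> \<open>Filling the hole with the old redex gives \<open>s\<close> back, so the same
    coefficients bound the weight before and after the step.\<close>
  have self: "replace_at s \<pi> ?s = s" using s by (simp add: replace_at_subt_at)
  have "\<exists>\<alpha> \<beta>. (\<not> m \<longrightarrow> \<beta> = 0) \<and>
    (\<forall>u. weight I a ((if m then id else flat_above \<pi>) (replace_at s \<pi> u)) = \<alpha> + \<beta> * ev I a (flat u) + weight I a u) \<and>
    \<alpha> + \<beta> * ev I a (flat ?s) + weight I a ?s \<le> weight I a s"
  proof (cases m)
    case True
    from weight_replace_at[OF I s, of a] obtain \<alpha> \<beta>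
      where ab: "\<forall>u. weight I a (replace_at s \<pi> u) = \<alpha> + \<beta> * ev I a (flat u) + weight I a u"
      by (elim exE) (rule that)
    from ab[rule_format, of ?s] self True ab show ?thesis by (intro exI[of _ \<alpha>] exI[of _ \<beta>]) simp
  next
    case False
    from weight_flat_above_replace_at[OF s(2), of I a] obtain \<alpha>
      where ab: "\<And>u. weight I a (flat_above \<pi> (replace_at s \<pi> u)) = \<alpha> + weight I a u"
        "\<And>u. \<alpha> + weight I a u \<le> weight I a (replace_at s \<pi> u)" by blast
    from ab(2)[of ?s] self False ab(1) show ?thesis by (intro exI[of _ \<alpha>] exI[of _ 0]) simp
  qed
  then obtain \<alpha> \<beta> where ab: "\<not> m \<longrightarrow> \<beta> = 0"
    "\<And>u. weight I a ((if m then id else flat_above \<pi>) (replace_at s \<pi> u)) = \<alpha> + \<beta> * ev I a (flat u) + weight I a u"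
    "\<alpha> + \<beta> * ev I a (flat ?s) + weight I a ?s \<le> weight I a s" by blast
  have "sharp (inst l \<sigma>) = inst (sharp l) \<sigma>" using l(1) by (cases l) auto
  then have sharp_l: "ev I a (sharp (flat ?s)) = ev I e (sharp l)"
    unfolding redex e_def by (simp add: ev_inst)
  have "b \<longleftrightarrow> [] \<in> sharp_poss ?s"
    using b s(2) fun_poss_append[of \<pi> s "[]" "range Sharp"] by (simp add: sharp_poss_def)
  then have "weight I a ?s = (if b then ev I e (sharp l) else 0) + ?R"
    unfolding weight_def by (auto simp: sum.remove[of _ "[]"] sharp_l)
  moreover have "ev I a (flat ?s) = ev I e l" unfolding redex e_def by (rule ev_inst)
  \<comment> \<open>The annotations strictly below the redex join the constant: present before the
    step, they pay for the repositioned ones after it.\<close>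
  ultimately have 1: "(\<alpha> + ?R) + \<beta> * ev I e l + (if b then ev I e (sharp l) else 0) \<le> weight I a s"
    using ab(3) by simp
  have 2: "weight I a (outcome m b s \<pi> l \<phi> r \<sigma>) \<le> (\<alpha> + ?R) + \<beta> * ev I e (flat r) + (if b then weight I e r else 0)"
    if \<phi>: "\<forall>\<rho>\<in>var_poss l. \<forall>\<rho>'. \<phi> \<rho> = Some \<rho>' \<longrightarrow> \<rho>' \<in> var_poss r \<and> subt_at l \<rho> = subt_at r \<rho>'" for r \<phi>
  proof -
    have "weight I a (annot ((if b then sharp_poss r else {}) \<union> Psi l \<phi> ?s) (inst r \<sigma>)) \<le>
      (if b then weight I e r else 0) + ?R"
      unfolding e_def by (rule weight_annot_inst[OF \<sigma> l(1) redex]) (use \<phi> in auto)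
    moreover have "ev I a (flat (inst r \<sigma>)) = ev I e (flat r)"
      using \<sigma> by (simp add: flat_inst_subst ev_inst e_def)
    ultimately show ?thesis unfolding outcome_def ab(2) by simp
  qed
  show ?thesis by (rule exI[of _ "\<alpha> + ?R"], rule exI[of _ \<beta>]) (intro conjI allI impI ab(1) 1 2)
qed

section \<open>Steps of the original and of the processed problem\<close>

text \<open>The simulation relation for completeness: the surplus of \<open>t\<close> consists of
  annotations that flattened ADPs have dropped, or their descendants.\<close>

definition below :: "('f \<rightharpoonup> nat) \<Rightarrow> 'f set \<Rightarrow> ('f, 'v) aterm \<Rightarrow> ('f, 'v) aterm \<Rightarrow> bool" where
  "below F D s t \<longleftrightarrow> flat s = flat t \<and> sharp_poss s \<subseteq> sharp_poss t \<and> t \<in> ann_terms F D"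

lemma Psi_mono: "sharp_poss s \<subseteq> sharp_poss t \<Longrightarrow> Psi l \<phi> s \<subseteq> Psi l \<phi> t"
  by (auto simp: Psi_def)

lemma sharp_poss_subt_at: "\<pi> \<in> poss t \<Longrightarrow> \<tau> \<in> sharp_poss (subt_at t \<pi>) \<longleftrightarrow> \<pi> @ \<tau> \<in> sharp_poss t"
  by (simp add: sharp_poss_def fun_poss_append)

text \<open>Every ingredient of \<open>outcome\<close> grows with the annotations of the term and
  the rule and with \<open>b\<close>, and \<open>flat_above\<close> deletes at positions that depend
  on \<pi> only.\<close>

lemma outcome_below:
  assumes s: "flat s = flat t" "sharp_poss s \<subseteq> sharp_poss t" and \<pi>: "\<pi> \<in> poss t"
    and r: "flat r = flat r'" "sharp_poss r \<subseteq> sharp_poss r'" and b: "b \<longrightarrow> b'" and \<sigma>: "\<sigma> \<in> substs F"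
  shows "flat (outcome m b s \<pi> l \<phi> r \<sigma>) = flat (outcome m b' t \<pi> l \<phi> r' \<sigma>) \<and>
    sharp_poss (outcome m b s \<pi> l \<phi> r \<sigma>) \<subseteq> sharp_poss (outcome m b' t \<pi> l \<phi> r' \<sigma>)"
proof -
  let ?u = "annot ((if b then sharp_poss r else {}) \<union> Psi l \<phi> (subt_at s \<pi>)) (inst r \<sigma>)"
  let ?u' = "annot ((if b' then sharp_poss r' else {}) \<union> Psi l \<phi> (subt_at t \<pi>)) (inst r' \<sigma>)"
  have \<pi>': "\<pi> \<in> poss s" using \<pi> poss_eqI[OF s(1)] by simp
  have inst_eq: "flat (inst r \<sigma>) = flat (inst r' \<sigma>)" using r \<sigma> by (simp add: flat_inst_subst)
  then have u_eq: "flat ?u = flat ?u'" by simp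
  have "fun_poss UNIV t = sharp_poss (annot UNIV (flat t))" for t :: "('a, 'b) aterm"
    by (simp add: sharp_poss_annot)
  then have "fun_poss UNIV (inst r \<sigma>) = fun_poss UNIV (inst r' \<sigma>)" using inst_eq by metis
  moreover have "Psi l \<phi> (subt_at s \<pi>) \<subseteq> Psi l \<phi> (subt_at t \<pi>)"
    using s \<pi> \<pi>' by (intro Psi_mono) (auto simp: sharp_poss_subt_at)
  ultimately have u_sub: "sharp_poss ?u \<subseteq> sharp_poss ?u'" using r b by (auto simp: sharp_poss_annot)
  have "sharp_poss (replace_at s \<pi> ?u) \<subseteq> sharp_poss (replace_at t \<pi> ?u')"
    using u_sub s(2) \<pi> \<pi>' unfolding sharp_poss_def by (auto simp: fun_poss_replace_at)
  moreover have "flat (replace_at s \<pi> ?u) = flat (replace_at t \<pi> ?u')"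
    using u_eq s(1) \<pi> \<pi>' by (simp add: flat_replace_at)
  ultimately show ?thesis by (auto simp: outcome_def sharp_poss_flat_above)
qed

lemma redex_poss_flat_above [simp]: "redex_poss D (flat_above \<pi> t) = redex_poss D t"
  by (simp add: flat_above_def)

text \<open>A repositioned annotation stays at the same place inside \<open>\<sigma> x\<close>,
  hence on a defined symbol.\<close>

lemma outcome_in_ann_terms:
  assumes t: "t \<in> ann_terms F D" "\<pi> \<in> poss t" and r: "r \<in> ann_terms F D" and \<sigma>: "\<sigma> \<in> substs F"
    and redex: "flat (subt_at t \<pi>) = inst l \<sigma>"
    and \<phi>: "\<And>\<rho> \<rho>'. \<rho> \<in> var_poss l \<Longrightarrow> \<phi> \<rho> = Some \<rho>' \<Longrightarrow> \<rho>' \<in> var_poss r \<and> subt_at l \<rho> = subt_at r \<rho>'"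
  shows "outcome m b t \<pi> l \<phi> r \<sigma> \<in> ann_terms F D"
proof -
  let ?u = "annot ((if b then sharp_poss r else {}) \<union> Psi l \<phi> (subt_at t \<pi>)) (inst r \<sigma>)"
  have "flat (inst r \<sigma>) \<in> plain_terms F"
    using flat_plain_terms[OF r] \<sigma> by (auto simp: flat_inst_subst substs_def intro!: terms_inst)
  then have flat_u: "flat (replace_at t \<pi> ?u) \<in> plain_terms F"
    using flat_plain_terms[OF t(1)] t(2) by (auto simp: flat_replace_at intro!: terms_replace_at)
  have sub: "sharp_poss r \<subseteq> redex_poss D r" "sharp_poss t \<subseteq> redex_poss D t"
    using r t ann_terms_iff by blast+
  have "Psi l \<phi> (subt_at t \<pi>) \<subseteq> redex_poss D (inst r \<sigma>)"
  proof
    fix \<tau> assume "\<tau> \<in> Psi l \<phi> (subt_at t \<pi>)"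
    then obtain \<rho> \<rho>' \<kappa> where \<tau>: "\<tau> = \<rho>' @ \<kappa>" "\<rho> \<in> var_poss l" "\<phi> \<rho> = Some \<rho>'"
      "\<rho> @ \<kappa> \<in> sharp_poss (subt_at t \<pi>)" by (auto simp: Psi_def)
    from \<tau>(2) obtain x where x: "\<rho> \<in> poss l" "subt_at l \<rho> = Var x" by (auto simp: var_poss_def)
    have r': "\<rho>' \<in> poss r" "subt_at r \<rho>' = Var x" using \<phi>[OF \<tau>(2,3)] x by (auto simp: var_poss_def)
    have "\<pi> @ \<rho> @ \<kappa> \<in> redex_poss D t" using \<tau>(4) t(2) sub by (auto simp: sharp_poss_subt_at)
    then have "\<rho> @ \<kappa> \<in> redex_poss D (subt_at t \<pi>)" using t(2) by (simp add: redex_poss_def fun_poss_append)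
    then have "\<rho> @ \<kappa> \<in> redex_poss D (inst l \<sigma>)" by (simp flip: redex)
    then have "\<kappa> \<in> redex_poss D (\<sigma> x)"
      using x by (simp add: redex_poss_def fun_poss_append poss_inst subt_at_inst)
    then show "\<tau> \<in> redex_poss D (inst r \<sigma>)"
      using r' \<tau>(1) by (simp add: redex_poss_def fun_poss_append poss_inst subt_at_inst)
  qed
  moreover have "redex_poss D r \<subseteq> redex_poss D (inst r \<sigma>)"
    by (auto simp: redex_poss_def mem_fun_poss_inst)
  ultimately have "sharp_poss ?u \<subseteq> redex_poss D ?u" using sub by (auto simp: sharp_poss_annot)
  then have "sharp_poss (replace_at t \<pi> ?u) \<subseteq> redex_poss D (replace_at t \<pi> ?u)"
    using sub(2) t(2) unfolding sharp_poss_def redex_poss_def by (auto simp: fun_poss_replace_at)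
  with flat_u show ?thesis
    unfolding ann_terms_iff[of "outcome _ _ _ _ _ _ _ _"] by (auto simp: outcome_def sharp_poss_flat_above)
qed

lemma rel_mset_with_terms:
  assumes "length prs = length prs'"
    and "\<And>j. j < length prs \<Longrightarrow> Q (fst (prs ! j), f j) (fst (prs' ! j), g j)"
  shows "rel_mset Q (with_terms prs f) (with_terms prs' g)"
  unfolding rel_mset_def with_terms_def
  using assms
  by (intro exI[of _ "map (\<lambda>j. (fst (prs ! j), f j)) [0..<length prs]"]
      exI[of _ "map (\<lambda>j. (fst (prs' ! j), g j)) [0..<length prs']"]) (auto simp: list_all2_conv_all_nth)

lemma flat_eq_Var [simp]: "flat t = Var x \<longleftrightarrow> t = Var x"
  by (cases t) auto

text \<open>Variable positions do not depend on annotations, so a reposition function transfers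
  between an ADP and its flattened form in both directions.\<close>

lemma vrf_flat:
  assumes "length prs = length prs'" "\<And>j. j < length prs \<Longrightarrow> flat (snd (prs ! j)) = flat (snd (prs' ! j))"
    and vrf: "vrf l prs \<phi>"
  shows "vrf l prs' \<phi>"
proof -
  have "\<rho> \<in> var_poss r' \<and> subt_at r' \<rho> = subt_at r \<rho>" if "\<rho> \<in> var_poss r" "flat r = flat r'"
    for \<rho> and r r' :: "('a, 'b) aterm"
  proof -
    from that obtain x where x: "\<rho> \<in> poss r" "subt_at r \<rho> = Var x" by (auto simp: var_poss_def)
    have "\<rho> \<in> poss r'" using x poss_eqI[OF that(2)] by simp
    moreover have "flat (subt_at r' \<rho>) = flat (subt_at r \<rho>)"
      using x \<open>\<rho> \<in> poss r'\<close> that(2) by (metis subt_at_flat)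
    ultimately show ?thesis using x by (auto simp: var_poss_def)
  qed
  note transfer = this
  show ?thesis unfolding vrf_def
  proof (intro allI ballI impI)
    fix j \<rho> \<rho>' assume j: "j < length prs'" and \<rho>: "\<rho> \<in> var_poss l" "\<phi> j \<rho> = Some \<rho>'"
    then have "\<rho>' \<in> var_poss (snd (prs ! j))" "subt_at l \<rho> = subt_at (snd (prs ! j)) \<rho>'"
      using vrf assms(1) by (auto simp: vrf_def)
    with transfer[of \<rho>' "snd (prs ! j)" "snd (prs' ! j)"] assms(1,2) j
    show "\<rho>' \<in> var_poss (snd (prs' ! j)) \<and> subt_at l \<rho> = subt_at (snd (prs' ! j)) \<rho>'" by simp
  qed
qed

lemma defined_Un_flat_adps: "defined (A \<union> flat_adps B) = defined (A \<union> B)"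
  by (force simp: defined_def flat_adps_def)

text \<open>Only left-hand sides enter \<open>ANF\<close>, and flattening keeps them.\<close>

lemma ANF_Un_flat_adps: "ANF F (A \<union> flat_adps B) = ANF F (A \<union> B)"
proof -
  have "fst ` flat_adps B = fst ` B"
    by (auto simp: flat_adps_def image_image case_prod_beta')
  then have lhs: "fst ` (A \<union> flat_adps B) = fst ` (A \<union> B)" by (simp add: image_Un)
  have "(\<exists>(l, \<mu>, m)\<in>P. R l) \<longleftrightarrow> (\<exists>l\<in>fst ` P. R l)" for P :: "('a, 'b) adp set" and R
    by (auto simp: case_prod_beta')
  then have "ANF F P = {t. \<not> (\<exists>\<tau>\<in>poss t - {[]}. \<exists>l\<in>fst ` P. \<exists>\<sigma>\<in>substs F. inst l \<sigma> = flat (subt_at t \<tau>))}"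
    for P :: "('a, 'b) adp set"
    unfolding ANF_def by simp
  note eq = this
  show ?thesis unfolding eq lhs ..
qed

text \<open>The step is repeated in \<open>t\<close> at the same redex with the unflattened ADP. The
  redex may be annotated in \<open>t\<close> but not in \<open>s\<close>, hence
  \<open>b \<longrightarrow> b'\<close> and the monotonicity demanded of \<open>adm\<close>.\<close>

lemma gen_step_simulation:
  assumes P: "P = P_ge \<union> P_gt" and Q: "Q = P_ge \<union> flat_adps P_gt"
    and adp: "\<And>\<alpha>. \<alpha> \<in> P \<Longrightarrow> is_adp F (defined P) \<alpha>"
    and adm: "\<And>m b b' \<phi> u. adm m b \<phi> u \<Longrightarrow> (b \<longrightarrow> b') \<Longrightarrow> adm m b' \<phi> u"
    and below: "below F (defined P) s t"
    and step: "gen_step adm F Q b s \<mu>"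
  shows "\<exists>b' \<mu>'. (b \<longrightarrow> b') \<and> gen_step adm F P b' t \<mu>' \<and> rel_mset (rel_prod (=) (below F (defined P))) \<mu> \<mu>'"
proof -
  let ?D = "defined P"
  have D: "defined Q = ?D" unfolding P Q by (rule defined_Un_flat_adps)
  from step obtain l prs m \<phi> \<sigma> \<pi> where *: "(l, mset prs, m) \<in> Q"
    "vrf l prs \<phi>" "\<sigma> \<in> substs F" "\<pi> \<in> redex_poss ?D s" "flat (subt_at s \<pi>) = inst l \<sigma>"
    "b \<longleftrightarrow> \<pi> \<in> sharp_poss s" "adm m b \<phi> (inst l \<sigma>)"
    and \<mu>: "\<mu> = with_terms prs (\<lambda>j. outcome m b s \<pi> l (\<phi> j) (snd (prs ! j)) \<sigma>)"
    unfolding gen_step_def D by blast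
  have st: "flat s = flat t" "sharp_poss s \<subseteq> sharp_poss t" "t \<in> ann_terms F ?D"
    using below by (auto simp: below_def)
  obtain prs' where prs': "(l, mset prs', m) \<in> P" "length prs = length prs'"
    "\<And>j. j < length prs \<Longrightarrow> fst (prs ! j) = fst (prs' ! j) \<and> flat (snd (prs ! j)) = flat (snd (prs' ! j)) \<and>
      sharp_poss (snd (prs ! j)) \<subseteq> sharp_poss (snd (prs' ! j))"
  proof (cases "(l, mset prs, m) \<in> P")
    case True
    then show ?thesis using that by blast
  next
    case False
    then obtain \<nu> where \<nu>: "(l, \<nu>, m) \<in> P_gt" "mset prs = image_mset (\<lambda>(p, r). (p, flat r)) \<nu>"
      using *(1) unfolding P Q flat_adps_def by auto
    from mset_eq_image_mset_obtain[OF \<nu>(2)] obtain prs' where prs':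
      "mset prs' = \<nu>" "map (\<lambda>(p, r). (p, flat r)) prs' = prs" by blast
    show ?thesis
      by (rule that[of prs']) (use prs' \<nu> in \<open>auto simp: P split: prod.splits\<close>)
  qed
  have \<pi>: "\<pi> \<in> redex_poss ?D t" using *(4) st(1) by (metis redex_poss_flat)
  then have \<pi>p: "\<pi> \<in> poss t" "\<pi> \<in> poss s" using poss_eqI[OF st(1)]
    by (auto simp: redex_poss_def fun_poss_def)
  have redex: "flat (subt_at t \<pi>) = inst l \<sigma>"
    using *(5) \<pi>p st(1) by (metis subt_at_flat)
  let ?b = "\<pi> \<in> sharp_poss t"
  have b: "b \<longrightarrow> ?b" using *(6) st(2) by auto
  have vrf: "vrf l prs' \<phi>" using vrf_flat[OF prs'(2) _ *(2)] prs'(3) by auto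
  let ?\<mu> = "with_terms prs' (\<lambda>j. outcome m ?b t \<pi> l (\<phi> j) (snd (prs' ! j)) \<sigma>)"
  have "gen_step adm F P ?b t ?\<mu>"
    unfolding gen_step_def
    using st(3) prs'(1) vrf *(3) \<pi> redex adm[OF *(7) b] by blast
  moreover have "rel_mset (rel_prod (=) (below F ?D)) \<mu> ?\<mu>"
    unfolding \<mu>
  proof (rule rel_mset_with_terms[OF prs'(2)])
    fix j assume j: "j < length prs"
    have "snd (prs' ! j) \<in># image_mset snd (mset prs')" using j prs'(2) by (auto intro!: image_eqI nth_mem)
    then have "snd (prs' ! j) \<in> ann_terms F ?D"
      using adp[OF prs'(1)] by (auto simp: is_adp_def)
    then have "outcome m ?b t \<pi> l (\<phi> j) (snd (prs' ! j)) \<sigma> \<in> ann_terms F ?D"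
      using vrf j prs'(2) by (intro outcome_in_ann_terms[OF st(3) \<pi>p(1) _ *(3) redex]) (auto simp: vrf_def)
    with outcome_below[OF st(1,2) \<pi>p(1) _ _ b *(3), of "snd (prs ! j)" "snd (prs' ! j)" m l "\<phi> j"] prs'(3)[OF j]
    show "rel_prod (=) (below F ?D) (fst (prs ! j), outcome m b s \<pi> l (\<phi> j) (snd (prs ! j)) \<sigma>)
      (fst (prs' ! j), outcome m ?b t \<pi> l (\<phi> j) (snd (prs' ! j)) \<sigma>)"
      by (auto simp: below_def)
  qed
  ultimately show ?thesis using b by blast
qed

text \<open>Without an annotation at the redex, \<open>outcome\<close> does not read the annotations
  of the right-hand side, so a flattened ADP yields the same distribution.\<close>

lemma gen_step_transfer:
  assumes P: "P = P_ge \<union> P_gt" and Q: "Q = P_ge \<union> flat_adps P_gt"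
    and s: "s \<in> ann_terms F (defined P)" and rule: "(l, mset prs, m) \<in> P" and vrf: "vrf l prs \<phi>"
    and \<sigma>: "\<sigma> \<in> substs F" and \<pi>: "\<pi> \<in> redex_poss (defined P) s" and redex: "flat (subt_at s \<pi>) = inst l \<sigma>"
    and b: "b \<longleftrightarrow> \<pi> \<in> sharp_poss s" and adm: "adm m b \<phi> (inst l \<sigma>)"
    and "(l, mset prs, m) \<in> P_ge \<or> \<not> b"
  shows "gen_step adm F Q b s (with_terms prs (\<lambda>j. outcome m b s \<pi> l (\<phi> j) (snd (prs ! j)) \<sigma>))"
proof -
  have D: "defined Q = defined P" unfolding P Q by (rule defined_Un_flat_adps)
  show ?thesis
  proof (cases "(l, mset prs, m) \<in> P_ge")
    case True
    then have "(l, mset prs, m) \<in> Q" by (simp add: Q)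
    then show ?thesis unfolding gen_step_def D using s vrf \<sigma> \<pi> redex b adm by blast
  next
    case False
    with assms(11) have nb: "\<not> b" by simp
    define prs' where "prs' = map (\<lambda>(p, r). (p, flat r)) prs"
    have len: "length prs = length prs'" by (simp add: prs'_def)
    have nth: "fst (prs' ! j) = fst (prs ! j)" "snd (prs' ! j) = flat (snd (prs ! j))" if "j < length prs" for j
      using that by (auto simp: prs'_def split: prod.splits)
    have rule': "(l, mset prs', m) \<in> Q"
      using rule False unfolding P Q flat_adps_def prs'_def by (force simp: image_iff)
    have vrf': "vrf l prs' \<phi>" by (rule vrf_flat[OF len _ vrf]) (simp add: nth)
    have eq: "with_terms prs (\<lambda>j. outcome m b s \<pi> l (\<phi> j) (snd (prs ! j)) \<sigma>) =
      with_terms prs' (\<lambda>j. outcome m b s \<pi> l (\<phi> j) (snd (prs' ! j)) \<sigma>)"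
    proof -
      have "outcome m b s \<pi> l (\<phi> j) (flat r) \<sigma> = outcome m b s \<pi> l (\<phi> j) r \<sigma>" for j r
      proof -
        have "annot \<Phi> (inst (flat r) \<sigma>) = annot \<Phi> (inst r \<sigma>)" for \<Phi>
          using flat_inst_subst[OF \<sigma>, of r] by (metis annot_flat)
        then show ?thesis using nb by (simp add: outcome_def)
      qed
      then show ?thesis unfolding with_terms_def len[symmetric] by (intro arg_cong[of _ _ mset] map_cong) (auto simp: nth)
    qed
    show ?thesis unfolding gen_step_def D eq using s rule' vrf' \<sigma> \<pi> redex b adm by blast
  qed
qed

section \<open>Expectations over steps and the least probability\<close>

lemma sum_mset_with_terms:
  "(\<Sum>(p, t)\<in>#with_terms prs f. p * g t) = (\<Sum>j<length prs. fst (prs ! j) * g (f j))"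
proof -
  have "(\<Sum>(p, t)\<in>#with_terms prs f. p * g t) = (\<Sum>j\<leftarrow>[0..<length prs]. fst (prs ! j) * g (f j))"
    by (simp add: with_terms_def comp_def flip: mset_map sum_mset_sum_list)
  also have "\<dots> = (\<Sum>j<length prs. fst (prs ! j) * g (f j))"
    by (simp add: sum_list_sum_nth lessThan_atLeast0 flip: interv_sum_list_conv_sum_set_nat)
  finally show ?thesis .
qed

lemma sum_mset_mset:
  fixes prs :: "(real \<times> ('f, 'v) aterm) list"
  shows "(\<Sum>(p, r)\<in>#mset prs. p * g r) = (\<Sum>j<length prs. fst (prs ! j) * g (snd (prs ! j)))"
proof -
  have "mset prs = with_terms prs (\<lambda>j. snd (prs ! j))"
    unfolding with_terms_def by (intro arg_cong[of _ _ mset] nth_equalityI) auto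
  then show ?thesis by (simp only: sum_mset_with_terms)
qed

lemma gen_step_prob:
  assumes "\<And>\<alpha>. \<alpha> \<in> P \<Longrightarrow> is_adp F (defined P) \<alpha>" "gen_step adm F P b s \<mu>"
  shows "(\<Sum>(p, t)\<in>#\<mu>. p) = 1"
proof -
  from assms(2) obtain l prs m f where rule: "(l, mset prs, m) \<in> P" and \<mu>: "\<mu> = with_terms prs f"
    unfolding gen_step_def by blast
  have "(\<Sum>(p, t)\<in>#\<mu>. p * 1) = (\<Sum>(p, r)\<in>#mset prs. p * 1)"
    unfolding \<mu> sum_mset_with_terms sum_mset_mset ..
  also have "\<dots> = 1" using assms(1)[OF rule] by (auto simp: is_adp_def)
  finally show ?thesis by simp
qed

lemma is_adp_flat_adps:
  assumes "\<And>\<alpha>. \<alpha> \<in> A \<Longrightarrow> is_adp F D \<alpha>" "\<alpha> \<in> flat_adps A"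
  shows "is_adp F D \<alpha>"
proof -
  from assms(2) obtain l \<mu> m where \<alpha>: "\<alpha> = (l, image_mset (\<lambda>(p, r). (p, flat r)) \<mu>, m)" "(l, \<mu>, m) \<in> A"
    by (auto simp: flat_adps_def)
  have adp: "is_adp F D (l, \<mu>, m)" by (rule assms(1)[OF \<alpha>(2)])
  have "flat r \<in> ann_terms F D" if "r \<in> ann_terms F D" for r :: "('a, 'b) aterm"
    using flat_plain_terms[OF that] ann_terms_iff[of "flat r" F D] by simp
  moreover have "vars (flat r) = vars r" for r :: "('a, 'b) aterm"
    by (induction r) auto
  moreover have "(\<Sum>(p, r)\<in>#image_mset (\<lambda>(p, r). (p, flat r)) \<mu>. p) = (\<Sum>(p, r)\<in>#\<mu>. p)"
    by (simp add: image_mset.compositionality comp_def case_prod_beta')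
  ultimately show ?thesis using adp unfolding \<alpha>(1) is_adp_def by fastforce
qed

lemma psubst_ann_sum:
  assumes "poly_interpretation (asig F D) I" "r \<in> ann_terms F D"
  shows "psubst (ann_sum I r) a = weight I a r"
proof -
  have "sharp (flat (subt_at r \<pi>)) \<in> ann_terms F D" if \<pi>: "\<pi> \<in> sharp_poss r" for \<pi>
  proof -
    obtain f ts where sub: "\<pi> \<in> poss r" "subt_at r \<pi> = Fun (Sharp f) ts"
      using \<pi> by (auto simp: sharp_poss_def fun_poss_def)
    have t: "Fun (Sharp f) ts \<in> ann_terms F D" using terms_subt_at[OF assms(2) sub(1)] sub(2) by simp
    have "flat u \<in> ann_terms F D" if "u \<in> set ts" for u
      using flat_plain_terms[of u F D] ann_terms_iff[of "flat u" F D] t that by simp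
    with t sub(2) show ?thesis by auto
  qed
  then show ?thesis unfolding ann_sum_def weight_def by (simp add: psubst_sum psubst_pol[OF assms(1)])
qed

lemma min_probability:
  assumes "finite P" "\<And>\<alpha>. \<alpha> \<in> P \<Longrightarrow> is_adp F D \<alpha>"
  obtains q :: real where "0 < q" "\<And>l \<mu> m p r. (l, \<mu>, m) \<in> P \<Longrightarrow> (p, r) \<in># \<mu> \<Longrightarrow> q \<le> p"
proof -
  \<comment> \<open>The element 1 keeps the set nonempty when \<open>P\<close> is empty.\<close>
  let ?S = "insert 1 (\<Union>(l, \<mu>, m)\<in>P. fst ` set_mset \<mu>) :: real set"
  have fin: "finite ?S" using assms(1) by auto
  have pos: "0 < p" if "p \<in> ?S" for p using that assms(2) by (fastforce simp: is_adp_def)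
  show ?thesis
  proof (rule that)
    show "0 < Min ?S" using fin pos by (subst Min_gr_iff) auto
    fix l \<mu> m p r assume "(l, \<mu>, m) \<in> P" "(p, r) \<in># \<mu>"
    then have "p \<in> ?S" by force
    with fin show "Min ?S \<le> p" by (rule Min_le)
  qed
qed

section \<open>Soundness and completeness of the processor\<close>

locale reduction_pair_problem =
  fixes F :: "'f \<rightharpoonup> nat" and P P_ge P_gt Q :: "('f, 'v) adp set" and I :: "'f asym \<Rightarrow> nat npoly"
  assumes adp: "adp_problem F P"
    and P: "P = P_ge \<union> P_gt" and Q: "Q = P_ge \<union> flat_adps P_gt"
    and interp: "poly_interpretation (asig F (defined P)) I"
    and multilin: "multilinear (asig F (defined P)) I"
    and ann_sum_le: "\<forall>(l, \<mu>, m)\<in>P. \<forall>a :: 'v \<Rightarrow> nat.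
      real (psubst (pol I (sharp l)) a) \<ge> (\<Sum>(p, r)\<in>#\<mu>. p * real (psubst (ann_sum I r) a))"
    and ann_sum_less: "\<forall>(l, \<mu>, m)\<in>P_gt. \<exists>(p, r)\<in>#\<mu>.
      (\<forall>a :: 'v \<Rightarrow> nat. psubst (pol I (sharp l)) a > psubst (ann_sum I r) a) \<and>
      (m \<longrightarrow> (\<forall>a :: 'v \<Rightarrow> nat. psubst (pol I l) a \<ge> psubst (pol I (flat r)) a))"
    and flat_le: "\<forall>(l, \<mu>, m)\<in>P. m \<longrightarrow> (\<forall>a :: 'v \<Rightarrow> nat.
      real (psubst (pol I l) a) \<ge> (\<Sum>(p, r)\<in>#\<mu>. p * real (psubst (pol I (flat r)) a)))"
begin

lemma adpD: "\<alpha> \<in> P \<Longrightarrow> is_adp F (defined P) \<alpha>"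
  using adp by (simp add: adp_problem_def)

lemma defined_Q: "defined Q = defined P"
  unfolding P Q by (rule defined_Un_flat_adps)

lemma adpD_Q: "\<alpha> \<in> Q \<Longrightarrow> is_adp F (defined Q) \<alpha>"
  using adpD[of \<alpha>] is_adp_flat_adps[of P_gt F "defined P" \<alpha>] adpD P Q unfolding defined_Q by blast

text \<open>The three conditions as inequalities between numbers; \<open>e\<close> will be the
  assignment composed with the matching substitution.\<close>

lemma rule_ineqs:
  assumes rule: "(l, mset prs, m) \<in> P"
  shows "(\<Sum>j<length prs. fst (prs ! j) * real (weight I e (snd (prs ! j)))) \<le> real (ev I e (sharp l))"
    and "m \<Longrightarrow> (\<Sum>j<length prs. fst (prs ! j) * real (ev I e (flat (snd (prs ! j))))) \<le> real (ev I e l)"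
    and "(l, mset prs, m) \<in> P_gt \<Longrightarrow> \<exists>j<length prs. weight I e (snd (prs ! j)) < ev I e (sharp l) \<and>
      (m \<longrightarrow> ev I e (flat (snd (prs ! j))) \<le> ev I e l)"
proof -
  let ?D = "defined P"
  have l: "l \<in> plain_terms F" "l \<notin> range Var" using adpD[OF rule] by (auto simp: is_adp_def)
  have r: "snd (prs ! j) \<in> ann_terms F ?D" if "j < length prs" for j
  proof -
    have "prs ! j \<in># mset prs" using that by simp
    then show ?thesis using adpD[OF rule] unfolding is_adp_def by (fastforce simp: case_prod_beta')
  qed
  have flat_ann: "flat t \<in> ann_terms F ?D" if "t \<in> ann_terms F D'" for t :: "('f, 'v) aterm" and D'
    using flat_plain_terms[OF that] ann_terms_iff[of "flat t" F ?D] by simp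
  have l': "l \<in> ann_terms F ?D" using flat_ann[OF l(1)] plain_term_flat[OF l(1)] by simp
  \<comment> \<open>Well-formed because the root of a left-hand side is a defined symbol.\<close>
  have sharp_l: "sharp l \<in> ann_terms F ?D"
  proof -
    obtain g ts where g: "l = Fun g ts" using l(2) by (cases l) auto
    then obtain f where f: "g = Plain f" using l(1) by (cases g) auto
    have "f \<in> ?D" using rule g f by (auto simp: defined_def)
    then show ?thesis using l' g f by simp
  qed
  have W: "psubst (ann_sum I (snd (prs ! j))) e = weight I e (snd (prs ! j))" if "j < length prs" for j
    by (rule psubst_ann_sum[OF interp r[OF that]])
  have E: "psubst (pol I (flat (snd (prs ! j)))) e = ev I e (flat (snd (prs ! j)))" if "j < length prs" for j
    by (rule psubst_pol[OF interp flat_ann[OF r[OF that]]])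
  note L = psubst_pol[OF interp l', of e] psubst_pol[OF interp sharp_l, of e]
  have "(\<Sum>(p, r)\<in>#mset prs. p * real (psubst (ann_sum I r) e)) \<le> real (psubst (pol I (sharp l)) e)"
    using ann_sum_le rule by blast
  then show "(\<Sum>j<length prs. fst (prs ! j) * real (weight I e (snd (prs ! j)))) \<le> real (ev I e (sharp l))"
    unfolding sum_mset_mset L by (simp add: W)
  show "(\<Sum>j<length prs. fst (prs ! j) * real (ev I e (flat (snd (prs ! j))))) \<le> real (ev I e l)" if m
  proof -
    have "(\<Sum>(p, r)\<in>#mset prs. p * real (psubst (pol I (flat r)) e)) \<le> real (psubst (pol I l) e)"
      using flat_le rule that by blast
    then show ?thesis unfolding sum_mset_mset L by (simp add: E)
  qed
  show "\<exists>j<length prs. weight I e (snd (prs ! j)) < ev I e (sharp l) \<and>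
      (m \<longrightarrow> ev I e (flat (snd (prs ! j))) \<le> ev I e l)" if gt: "(l, mset prs, m) \<in> P_gt"
  proof -
    obtain p r where pr: "(p, r) \<in> set prs"
      "psubst (ann_sum I r) e < psubst (pol I (sharp l)) e"
      "m \<longrightarrow> psubst (pol I (flat r)) e \<le> psubst (pol I l) e"
      using ann_sum_less gt by fastforce
    then obtain j where j: "j < length prs" "prs ! j = (p, r)" by (auto simp: in_set_conv_nth)
    with pr W[OF j(1)] E[OF j(1)] L show ?thesis by auto
  qed
qed

text \<open>In the bound of \<open>outcome_weight\<close>, condition (3) settles the \<beta>-part
  and condition (1) the part present for \<open>b\<close>. For the second claim, the index from (2)
  gives the branch on which the weight drops.\<close>

lemma step_ranking:
  fixes a :: "'v \<Rightarrow> nat"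
  assumes s: "s \<in> ann_terms F (defined P)" and step: "gen_step adm F P b s \<mu>"
  shows "(\<Sum>(p, t)\<in>#\<mu>. p * real (weight I a t)) \<le> real (weight I a s)"
    and "(\<And>l \<mu> m p r. (l, \<mu>, m) \<in> P \<Longrightarrow> (p, r) \<in># \<mu> \<Longrightarrow> q \<le> p) \<Longrightarrow>
      gen_step adm F Q b s \<mu> \<or> (\<exists>(p, t)\<in>#\<mu>. q \<le> p \<and> weight I a t < weight I a s)"
proof -
  from step obtain l prs m \<phi> \<sigma> \<pi> where rule: "(l, mset prs, m) \<in> P" and vrf: "vrf l prs \<phi>"
    and \<sigma>: "\<sigma> \<in> substs F" and \<pi>: "\<pi> \<in> redex_poss (defined P) s" and redex: "flat (subt_at s \<pi>) = inst l \<sigma>"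
    and b: "b \<longleftrightarrow> \<pi> \<in> sharp_poss s" and adm: "adm m b \<phi> (inst l \<sigma>)"
    and \<mu>: "\<mu> = with_terms prs (\<lambda>j. outcome m b s \<pi> l (\<phi> j) (snd (prs ! j)) \<sigma>)"
    unfolding gen_step_def by blast
  have l: "l \<in> plain_terms F" "l \<notin> range Var" using adpD[OF rule] by (auto simp: is_adp_def)
  have "\<pi> \<in> poss s" using \<pi> by (auto simp: redex_poss_def fun_poss_def)
  define e where "e = (\<lambda>x. ev I a (\<sigma> x))"
  let ?t = "\<lambda>j. outcome m b s \<pi> l (\<phi> j) (snd (prs ! j)) \<sigma>"
  from outcome_weight[OF multilin s \<open>\<pi> \<in> poss s\<close> \<sigma> l(2,1) redex b, of m a, folded e_def]
  obtain \<alpha> \<beta> where \<beta>: "\<not> m \<longrightarrow> \<beta> = 0"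
    and ws: "\<alpha> + \<beta> * ev I e l + (if b then ev I e (sharp l) else 0) \<le> weight I a s"
    and wt: "\<forall>r \<phi>. (\<forall>\<rho>\<in>var_poss l. \<forall>\<rho>'. \<phi> \<rho> = Some \<rho>' \<longrightarrow> \<rho>' \<in> var_poss r \<and> subt_at l \<rho> = subt_at r \<rho>') \<longrightarrow>
      weight I a (outcome m b s \<pi> l \<phi> r \<sigma>) \<le> \<alpha> + \<beta> * ev I e (flat r) + (if b then weight I e r else 0)"
    by (elim exE conjE) (rule that)
  have wj: "weight I a (?t j) \<le> \<alpha> + \<beta> * ev I e (flat (snd (prs ! j))) + (if b then weight I e (snd (prs ! j)) else 0)"
    if "j < length prs" for j
    using wt[rule_format, of "\<phi> j" "snd (prs ! j)"] vrf that by (auto simp: vrf_def)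
  let ?p = "\<lambda>j. fst (prs ! j)"
  have pos: "0 \<le> ?p j" if "j < length prs" for j
  proof -
    have "prs ! j \<in># mset prs" using that by simp
    then have "0 < ?p j" using adpD[OF rule] unfolding is_adp_def by (fastforce simp: case_prod_beta')
    then show ?thesis by simp
  qed
  have total: "(\<Sum>j<length prs. ?p j) = 1"
    using gen_step_prob[OF adpD step] sum_mset_with_terms[of "\<lambda>_. 1" prs ?t] by (simp add: \<mu>)
  show "(\<Sum>(p, t)\<in>#\<mu>. p * real (weight I a t)) \<le> real (weight I a s)"
  proof -
    have "(\<Sum>(p, t)\<in>#\<mu>. p * real (weight I a t)) = (\<Sum>j<length prs. ?p j * real (weight I a (?t j)))"
      unfolding \<mu> by (rule sum_mset_with_terms)
    also have "\<dots> \<le> (\<Sum>j<length prs. ?p j * (real \<alpha> + real \<beta> * real (ev I e (flat (snd (prs ! j)))) +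
        (if b then 1 else 0) * real (weight I e (snd (prs ! j)))))"
    proof (intro sum_mono mult_left_mono)
      fix j assume "j \<in> {..<length prs}"
      then have "real (weight I a (?t j)) \<le> real (\<alpha> + \<beta> * ev I e (flat (snd (prs ! j))) +
          (if b then weight I e (snd (prs ! j)) else 0))"
        using wj by (intro of_nat_mono) simp
      then show "real (weight I a (?t j)) \<le> real \<alpha> + real \<beta> * real (ev I e (flat (snd (prs ! j)))) +
          (if b then 1 else 0) * real (weight I e (snd (prs ! j)))" by (cases b) simp_all
    qed (use pos in simp)
    also have "\<dots> = real \<alpha> * (\<Sum>j<length prs. ?p j) +
        real \<beta> * (\<Sum>j<length prs. ?p j * real (ev I e (flat (snd (prs ! j))))) +
        (if b then 1 else 0) * (\<Sum>j<length prs. ?p j * real (weight I e (snd (prs ! j))))"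
      by (simp add: sum_distrib_left sum.distrib algebra_simps)
    also have "\<dots> \<le> real \<alpha> * 1 + real \<beta> * real (ev I e l) + (if b then 1 else 0) * real (ev I e (sharp l))"
    proof (intro add_mono)
      \<comment> \<open>Condition (3) is available only for flag True; for flag False this summand
        vanishes, as \<beta> = 0.\<close>
      show "real \<beta> * (\<Sum>j<length prs. ?p j * real (ev I e (flat (snd (prs ! j))))) \<le> real \<beta> * real (ev I e l)"
        using rule_ineqs(2)[OF rule] \<beta> by (cases m) (auto intro!: mult_left_mono)
    qed (use total rule_ineqs(1)[OF rule] in auto)
    also have "\<dots> = real (\<alpha> + \<beta> * ev I e l + (if b then ev I e (sharp l) else 0))" by simp
    also have "\<dots> \<le> real (weight I a s)" using ws by (rule of_nat_mono)
    finally show ?thesis .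
  qed
  show "gen_step adm F Q b s \<mu> \<or> (\<exists>(p, t)\<in>#\<mu>. q \<le> p \<and> weight I a t < weight I a s)"
    if q: "\<And>l \<mu> m p r. (l, \<mu>, m) \<in> P \<Longrightarrow> (p, r) \<in># \<mu> \<Longrightarrow> q \<le> p"
  proof (cases "(l, mset prs, m) \<in> P_ge \<or> \<not> b")
    case True
    show ?thesis unfolding \<mu>
      by (rule disjI1, rule gen_step_transfer[where adm = adm, OF P Q s rule vrf \<sigma> \<pi> redex b adm True])
  next
    case False
    then have "(l, mset prs, m) \<in> P_gt" b using rule P by auto
    from rule_ineqs(3)[OF rule this(1), of e] obtain j where j: "j < length prs"
      "weight I e (snd (prs ! j)) < ev I e (sharp l)" "m \<longrightarrow> ev I e (flat (snd (prs ! j))) \<le> ev I e l" by blast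
    \<comment> \<open>The addition to (2) for flag True keeps the annotations above the redex from
      gaining value on the chosen branch.\<close>
    have "\<beta> * ev I e (flat (snd (prs ! j))) \<le> \<beta> * ev I e l" using \<beta> j(3) by (cases m) auto
    moreover have "weight I a (?t j) \<le> \<alpha> + \<beta> * ev I e (flat (snd (prs ! j))) + weight I e (snd (prs ! j))"
      using wj[OF j(1)] \<open>b\<close> by simp
    moreover have "\<alpha> + \<beta> * ev I e l + ev I e (sharp l) \<le> weight I a s" using ws \<open>b\<close> by simp
    ultimately have "weight I a (?t j) < weight I a s" using j(2) by linarith
    moreover have "q \<le> ?p j" using q[OF rule, of "?p j" "snd (prs ! j)"] j(1) by simp
    moreover have "(?p j, ?t j) \<in># \<mu>" using j(1) by (auto simp: \<mu> with_terms_def)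
    ultimately show ?thesis by blast
  qed
qed

lemma sound:
  assumes Q_AST: "\<And>(V :: nat set) E L A.
      chain_tree (ann_terms F (defined Q)) (gen_step adm F Q) V E L A \<Longrightarrow> leaf_prob V E L = 1"
    and tree: "chain_tree (ann_terms F (defined P)) (gen_step adm F P) V E L A"
  shows "leaf_prob (V :: nat set) E L = 1"
proof -
  obtain q where q: "0 < q" "\<And>l \<mu> m p r. (l, \<mu>, m) \<in> P \<Longrightarrow> (p, r) \<in># \<mu> \<Longrightarrow> q \<le> p"
    by (rule min_probability[of P F "defined P"]) (use adp in \<open>auto simp: adp_problem_def\<close>)
  show ?thesis
  \<comment> \<open>The conditions hold at every assignment, so the zero assignment serves as well
    as any other.\<close>
  proof (rule ranking_soundness[where W = "weight I (\<lambda>_. 0)" and q = q, OF _ _ _ q(1) _ _ tree])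
    fix b s \<mu>
    show "(\<Sum>(p, t)\<in>#\<mu>. p) = 1" if "gen_step adm F P b s \<mu>" by (rule gen_step_prob[OF adpD that])
    show "(\<Sum>(p, t)\<in>#\<mu>. p) = 1" if "gen_step adm F Q b s \<mu>" by (rule gen_step_prob[OF adpD_Q that])
    show "(\<Sum>(p, t)\<in>#\<mu>. p * real (weight I (\<lambda>_. 0) t)) \<le> real (weight I (\<lambda>_. 0) s)"
      if "s \<in> ann_terms F (defined P)" "gen_step adm F P b s \<mu>" by (rule step_ranking(1)[OF that])
    show "gen_step adm F Q b s \<mu> \<or> (\<exists>(p, t)\<in>#\<mu>. q \<le> p \<and> weight I (\<lambda>_. 0) t < weight I (\<lambda>_. 0) s)"
      if "s \<in> ann_terms F (defined P)" "gen_step adm F P b s \<mu>" by (rule step_ranking(2)[OF that q(2)])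
  next
    fix V :: "nat set" and E L A
    assume "chain_tree (ann_terms F (defined P)) (gen_step adm F Q) V E L A"
    then show "leaf_prob V E L = 1" using Q_AST by (simp add: defined_Q)
  qed
qed

text \<open>The simulating tree keeps nodes, edges and probabilities, so its leaf probability is the
  one known to be 1.\<close>

lemma complete:
  assumes adm: "\<And>m b b' \<phi> u. adm m b \<phi> u \<Longrightarrow> (b \<longrightarrow> b') \<Longrightarrow> adm m b' \<phi> u"
    and P_AST: "\<And>(V :: nat set) E L A.
      chain_tree (ann_terms F (defined P)) (gen_step adm F P) V E L A \<Longrightarrow> leaf_prob V E L = 1"
    and tree: "chain_tree (ann_terms F (defined Q)) (gen_step adm F Q) V E L A"
  shows "leaf_prob (V :: nat set) E L = 1"
proof -
  have "\<exists>L' A'. chain_tree (ann_terms F (defined P)) (gen_step adm F P) V E L' A' \<and>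
      leaf_prob V E L' = leaf_prob V E L"
  proof (rule simulate_chain_tree[where R = "below F (defined P)", OF tree[unfolded defined_Q]])
    fix b s t \<mu> assume "below F (defined P) s t" "gen_step adm F Q b s \<mu>"
    then show "\<exists>b' \<mu>'. (b \<longrightarrow> b') \<and> gen_step adm F P b' t \<mu>' \<and> rel_mset (rel_prod (=) (below F (defined P))) \<mu> \<mu>'"
      by (intro gen_step_simulation[OF P Q adpD adm])
  qed (auto simp: below_def)
  with P_AST show ?thesis by metis
qed

end

theorem theorem36:
  fixes F :: "'f \<rightharpoonup> nat"
    and P P_ge P_gt :: "('f, 'v) adp set"
    and I :: "'f asym \<Rightarrow> nat npoly"
  assumes "finite (dom F)"
    and "adp_problem F P"
    and "P = P_ge \<union> P_gt" and "P_ge \<inter> P_gt = {}" and "P_gt \<noteq> {}"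
    and "poly_interpretation (asig F (defined P)) I"
    and "multilinear (asig F (defined P)) I"
    and "\<forall>(l, \<mu>, m)\<in>P. \<forall>a :: 'v \<Rightarrow> nat.
           real (psubst (pol I (sharp l)) a) \<ge> (\<Sum>(p, r)\<in>#\<mu>. p * real (psubst (ann_sum I r) a))"
    and "\<forall>(l, \<mu>, m)\<in>P_gt. \<exists>(p, r)\<in>#\<mu>.
           (\<forall>a :: 'v \<Rightarrow> nat. psubst (pol I (sharp l)) a > psubst (ann_sum I r) a) \<and>
           (m \<longrightarrow> (\<forall>a :: 'v \<Rightarrow> nat. psubst (pol I l) a \<ge> psubst (pol I (flat r)) a))"
    and "\<forall>(l, \<mu>, m)\<in>P. m \<longrightarrow> (\<forall>a :: 'v \<Rightarrow> nat.
           real (psubst (pol I l) a) \<ge> (\<Sum>(p, r)\<in>#\<mu>. p * real (psubst (pol I (flat r)) a)))"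
  shows "sound_for (iAST F) P (Proc_RP P_ge P_gt) \<and> complete_for (iAST F) P (Proc_RP P_ge P_gt) \<and>
         sound_for (AST F) P (Proc_RP P_ge P_gt) \<and> complete_for (AST F) P (Proc_RP P_ge P_gt)"
proof -
  interpret reduction_pair_problem F P P_ge P_gt "P_ge \<union> flat_adps P_gt" I
    by (rule reduction_pair_problem.intro) (rule assms refl)+
  let ?Q = "P_ge \<union> flat_adps P_gt"
  let ?full = "\<lambda>m b (\<phi> :: nat \<Rightarrow> pos \<Rightarrow> pos option) (u :: ('f, 'v) aterm). m \<or> b"
  let ?inn = "\<lambda>(m :: bool) (b :: bool) (\<phi> :: nat \<Rightarrow> pos \<Rightarrow> pos option) u. \<phi> = (\<lambda>_ _. None) \<and> u \<in> ANF F P"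
  \<comment> \<open>Both problems share their argument normal forms, so one \<open>adm\<close>
    describes innermost rewriting with either.\<close>
  have ANF: "ANF F ?Q = ANF F P" unfolding assms(3) by (rule ANF_Un_flat_adps)
  have "iAST F P \<longleftrightarrow> iAST F ?Q"
    unfolding iAST_def innermost_step_eq ANF
  proof (intro iffI allI impI)
    fix V :: "nat set" and E L A
    show "leaf_prob V E L = 1"
      if "\<forall>(V :: nat set) E L A. chain_tree (ann_terms F (defined P)) (gen_step ?inn F P) V E L A \<longrightarrow> leaf_prob V E L = 1"
        "chain_tree (ann_terms F (defined ?Q)) (gen_step ?inn F ?Q) V E L A"
      by (rule complete[where adm = ?inn, OF _ _ that(2)]) (use that(1) in auto)
    show "leaf_prob V E L = 1"
      if "\<forall>(V :: nat set) E L A. chain_tree (ann_terms F (defined ?Q)) (gen_step ?inn F ?Q) V E L A \<longrightarrow> leaf_prob V E L = 1"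
        "chain_tree (ann_terms F (defined P)) (gen_step ?inn F P) V E L A"
      by (rule sound[where adm = ?inn, OF _ that(2)]) (use that(1) in auto)
  qed
  moreover have "AST F P \<longleftrightarrow> AST F ?Q"
    unfolding AST_def full_step_eq
  proof (intro iffI allI impI)
    fix V :: "nat set" and E L A
    show "leaf_prob V E L = 1"
      if "\<forall>(V :: nat set) E L A. chain_tree (ann_terms F (defined P)) (gen_step ?full F P) V E L A \<longrightarrow> leaf_prob V E L = 1"
        "chain_tree (ann_terms F (defined ?Q)) (gen_step ?full F ?Q) V E L A"
      by (rule complete[where adm = ?full, OF _ _ that(2)]) (use that(1) in auto)
    show "leaf_prob V E L = 1"
      if "\<forall>(V :: nat set) E L A. chain_tree (ann_terms F (defined ?Q)) (gen_step ?full F ?Q) V E L A \<longrightarrow> leaf_prob V E L = 1"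
        "chain_tree (ann_terms F (defined P)) (gen_step ?full F P) V E L A"
      by (rule sound[where adm = ?full, OF _ that(2)]) (use that(1) in auto)
  qed
  ultimately show ?thesis by (simp add: sound_for_def complete_for_def Proc_RP_def)
qed

end
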